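(* Let $(N^{n+1},g)$ be a spacetime, $p\in N$, and let $K_p$, the frame field $\{e_a\}$, $R=R(p)$, $r\in(0,R]$, the uniform Temple neighborhood $U_p=U_{p,r}$ of $p$ and its uniform Temple charts $\Phi_q:W_r\to V_q=\Phi_q(W_r)$, $q\in U_p$, be as described in the context. There exists a constant $C>0$ that may only depend on the Lorentzian metric $g$ and the frame field $\{e_a\}$ on the compact set $K_p$, on the dimension of $(N,g)$, and on a positive constant $R$ such that $0<r\le R$, such that for all $q\in U_p$ the optical function $\omega_q$ of the chart $\Phi_q$ satisfies $$\Big||\nabla^{g_R}\omega_q|_{g_R}-\sqrt2\Big|<C\lambda_q\quad\text{in }V_q\setminus\eta_q,$$ where $\lambda_q$ is the radial function of the chart.
   Context: A spacetime $(N^{n+1},g)$, $n\ge1$, is a smooth connected time-oriented Lorentzian manifold of signature $(-,+,\ldots,+)$. $B^n(r)$ is the open Euclidean ball of radius $r$ about the origin of $\mathbb R^n$. A frame field is a collection of smooth vector fields $\{e_0,\ldots,e_n\}$ with $|g(e_a,e_b)|=\delta_{ab}$; a frame field on a compact set is defined on an open neighborhood of it. $\tilde V_p$ denotes a convex normal neighborhood of $p$: an open set for which $(q,v)\mapsto(q,\exp_qv)$ is a diffeomorphism from an open subset of $TN$ with star-shaped fibers about $0$ onto $\tilde V_p\times\tilde V_p$. Setting: $K_p$ is compact with $p\in K_p\subset\tilde V_p$; $\{e_a\}$ is a frame field on $K_p$ with $e_0$ future timelike and $e_1,\ldots,e_n$ spacelike; $R>0$; and for each $r\in(0,R]$, $U_p=U_{p,r}$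 is a neighborhood of $p$ (a uniform Temple neighborhood), $U_p\subset K_p$, such that: (1) for every $q\in U_p$ the geodesic $\eta_q$ with $\eta_q(0)=q$, $\dot\eta_q(0)=e_0$ is defined on $(-r,r)$, lies in $K_p$, satisfies $\dot\eta_q(t)=e_0$ for all $t$, and all $e_a$ are parallel along it; (2) for every $q\in U_p$ the map $\Phi_q(t,\vec x)=\exp_{\eta_q(t)}\big(|\vec x|e_0+\sum_{i=1}^nx^ie_i\big)$ on $W_r=(-r,r)\times B^n(r)$ (the uniform Temple chart) is a homeomorphism onto its image $V_q$ and a diffeomorphism onto its image away from $\{\vec x=\vec 0\}$; (3) $U_p\subset V_q\subset K_p$. The optical and radial functions on $V_q$ are $\omega_q(\Phi_q(t,\vec x))=t$ and $\lambda_q(\Phi_q(t,\vec x))=|\vec x|$; both are smooth on $V_q\setminus\eta_q$, where $\eta_q$ also denotes the image of the central geodesic. Riemannianized metric: $g_R(X,Y)=2g(X,e_0)g(Y,e_0)+g(X,Y)$, a Riemannian metric on a neighborhood of $K_p$; $\nabla^{g_R}f$ is the gradient, $g_R(\nabla^{g_R}f,X)=X(f)$, and $|\cdot|_{g_R}$ the $g_R$-norm. *)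

theory Defs
  imports "HOL-Analysis.Analysis"
begin

section \<open>Smooth maps and smooth manifolds\<close>

fun Ck_on :: "nat \<Rightarrow> 'a::euclidean_space set \<Rightarrow> ('a \<Rightarrow> 'b::euclidean_space) \<Rightarrow> bool" where
  "Ck_on 0 S f \<longleftrightarrow> continuous_on S f"
| "Ck_on (Suc k) S f \<longleftrightarrow> (\<forall>x\<in>S. f differentiable (at x)) \<and>
     (\<forall>v. Ck_on k S (\<lambda>x. frechet_derivative f (at x) v))"

text \<open>Only meaningful for open \<open>S\<close>.\<close>
definition smooth_on :: "'a::euclidean_space set \<Rightarrow> ('a \<Rightarrow> 'b::euclidean_space) \<Rightarrow> bool" where
  "smooth_on S f \<longleftrightarrow> (\<forall>k. Ck_on k S f)"

text \<open>A chart is a pair of a domain and a map; values of the map off the domain are irrelevant.\<close>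
type_synonym ('m, 'e) chart = "'m set \<times> ('m \<Rightarrow> 'e)"

abbreviation ch_dom :: "('m, 'e) chart \<Rightarrow> 'm set" where "ch_dom c \<equiv> fst c"
abbreviation ch_map :: "('m, 'e) chart \<Rightarrow> 'm \<Rightarrow> 'e" where "ch_map c \<equiv> snd c"
abbreviation ch_inv :: "('m, 'e) chart \<Rightarrow> 'e \<Rightarrow> 'm" where "ch_inv c \<equiv> inv_into (fst c) (snd c)"

definition smooth_atlas :: "('m::topological_space, 'e::euclidean_space) chart set \<Rightarrow> bool" where
  "smooth_atlas A \<longleftrightarrow>
     (\<Union>c\<in>A. ch_dom c) = UNIV \<and>
     (\<forall>c\<in>A. open (ch_dom c) \<and> open (ch_map c ` ch_dom c) \<and>
        homeomorphism (ch_dom c) (ch_map c ` ch_dom c) (ch_map c) (ch_inv c)) \<and>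
     (\<forall>c\<in>A. \<forall>d\<in>A. smooth_on (ch_map c ` (ch_dom c \<inter> ch_dom d)) (ch_map d \<circ> ch_inv c))"

text \<open>
  The following notions refer only to the atlases, not to a type-class topology.  This matters
  for tangent bundles, which are represented below on a product type whose product topology is
  not the bundle topology.
\<close>

definition atlas_open :: "('m, 'e::euclidean_space) chart set \<Rightarrow> 'm set \<Rightarrow> bool" where
  "atlas_open A S \<longleftrightarrow> (\<forall>c\<in>A. open (ch_map c ` (S \<inter> ch_dom c)))"

text \<open>Smoothness of \<open>f\<close> on \<open>S\<close> with respect to two atlases, for \<open>S\<close> open.  The openness clause
  expresses continuity of \<open>f\<close> (and openness of \<open>S\<close>).\<close>
definition smooth_map_on ::
  "('m, 'd::euclidean_space) chart set \<Rightarrow> ('k, 'e::euclidean_space) chart set \<Rightarrow>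
     'm set \<Rightarrow> ('m \<Rightarrow> 'k) \<Rightarrow> bool" where
  "smooth_map_on A B S f \<longleftrightarrow> (\<forall>a\<in>A. \<forall>b\<in>B.
     let D = ch_map a ` {x \<in> S \<inter> ch_dom a. f x \<in> ch_dom b}
     in open D \<and> smooth_on D (\<lambda>y. ch_map b (f (ch_inv a y))))"

definition diffeo_between ::
  "('m, 'd::euclidean_space) chart set \<Rightarrow> ('k, 'e::euclidean_space) chart set \<Rightarrow>
     'm set \<Rightarrow> 'k set \<Rightarrow> ('m \<Rightarrow> 'k) \<Rightarrow> bool" where
  "diffeo_between A B S T f \<longleftrightarrow>
     bij_betw f S T \<and> smooth_map_on A B S f \<and> smooth_map_on B A T (inv_into S f)"

definition std_atlas :: "('e, 'e::euclidean_space) chart set" where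
  "std_atlas = {(UNIV, id)}"

definition prod_atlas ::
  "('m, 'd) chart set \<Rightarrow> ('k, 'e) chart set \<Rightarrow> ('m \<times> 'k, 'd \<times> 'e) chart set" where
  "prod_atlas A B = {(ch_dom a \<times> ch_dom b, map_prod (ch_map a) (ch_map b)) | a b. a \<in> A \<and> b \<in> B}"


section \<open>Tangent vectors\<close>

text \<open>
  A tangent vector at \<open>x\<close> is represented by its component vector in the chart \<open>pref A x\<close>, a
  chart around \<open>x\<close> fixed once and for all by choice.  Hence \<open>T\<^sub>xN\<close> is the model space \<open>'e\<close>,
  and \<open>TN\<close> is \<open>'m \<times> 'e\<close> with the manifold structure given by \<open>tangent_atlas A\<close>.
  Component vectors in other charts are obtained with the usual transformation law.
\<close>

definition pref :: "('m, 'e) chart set \<Rightarrow> 'm \<Rightarrow> ('m, 'e) chart" where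
  "pref A x = (SOME c. c \<in> A \<and> x \<in> ch_dom c)"

definition tchange ::
  "('m, 'e::euclidean_space) chart \<Rightarrow> ('m, 'e) chart \<Rightarrow> 'm \<Rightarrow> 'e \<Rightarrow> 'e" where
  "tchange c d x v = frechet_derivative (ch_map d \<circ> ch_inv c) (at (ch_map c x)) v"

text \<open>\<open>tcoord A c x v\<close>: components in the chart \<open>c\<close> of the tangent vector \<open>v\<close> at \<open>x\<close>;
  \<open>tvec A c x u\<close>: the tangent vector at \<open>x\<close> whose components in \<open>c\<close> are \<open>u\<close>.\<close>
definition tcoord :: "('m, 'e::euclidean_space) chart set \<Rightarrow> ('m, 'e) chart \<Rightarrow> 'm \<Rightarrow> 'e \<Rightarrow> 'e" where
  "tcoord A c x v = tchange (pref A x) c x v"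

definition tvec :: "('m, 'e::euclidean_space) chart set \<Rightarrow> ('m, 'e) chart \<Rightarrow> 'm \<Rightarrow> 'e \<Rightarrow> 'e" where
  "tvec A c x u = tchange c (pref A x) x u"

definition tangent_atlas ::
  "('m, 'e::euclidean_space) chart set \<Rightarrow> ('m \<times> 'e, 'e \<times> 'e) chart set" where
  "tangent_atlas A = {(ch_dom c \<times> UNIV, \<lambda>(x, v). (ch_map c x, tcoord A c x v)) | c. c \<in> A}"

definition smooth_vector_field_on ::
  "('m, 'e::euclidean_space) chart set \<Rightarrow> 'm set \<Rightarrow> ('m \<Rightarrow> 'e) \<Rightarrow> bool" where
  "smooth_vector_field_on A S X \<longleftrightarrow> smooth_map_on A (tangent_atlas A) S (\<lambda>x. (x, X x))"

text \<open>\<open>X(f)\<close> for a tangent vector \<open>X\<close> at \<open>x\<close>.\<close>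
definition dir_deriv ::
  "('m, 'e::euclidean_space) chart set \<Rightarrow> ('m \<Rightarrow> real) \<Rightarrow> 'm \<Rightarrow> 'e \<Rightarrow> real" where
  "dir_deriv A f x X = frechet_derivative (f \<circ> ch_inv (pref A x)) (at (ch_map (pref A x) x)) X"


section \<open>Spacetimes\<close>

text \<open>The model space is \<open>\<real> \<times> \<real>\<^sup>n\<close> with \<open>n = CARD('n) \<ge> 1\<close>.\<close>
type_synonym 'n model = "real \<times> (real ^ 'n)"
type_synonym ('m, 'n) atlas = "('m, 'n model) chart set"
type_synonym ('m, 'n) vfield = "'m \<Rightarrow> 'n model"
type_synonym ('m, 'n) metric = "'m \<Rightarrow> 'n model \<Rightarrow> 'n model \<Rightarrow> real"

definition metric_coord ::
  "('m, 'n::finite) atlas \<Rightarrow> ('m, 'n) metric \<Rightarrow> ('m, 'n model) chart \<Rightarrow> 'n model \<Rightarrow>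
     'n model \<Rightarrow> 'n model \<Rightarrow> real" where
  "metric_coord A g c y u v =
     (let x = ch_inv c y in g x (tvec A c x u) (tvec A c x v))"

definition lorentz_metric :: "('m, 'n::finite) atlas \<Rightarrow> ('m, 'n) metric \<Rightarrow> bool" where
  "lorentz_metric A g \<longleftrightarrow>
     (\<forall>x. bilinear (g x) \<and> (\<forall>u v. g x u v = g x v u) \<and>
        (\<exists>L :: 'n model \<Rightarrow> 'n model. linear L \<and> bij L \<and>
           (\<forall>s t u v. g x (L (s, u)) (L (t, v)) = - (s * t) + u \<bullet> v))) \<and>
     (\<forall>c\<in>A. \<forall>u v. smooth_on (ch_map c ` ch_dom c) (\<lambda>y. metric_coord A g c y u v))"

text \<open>The time orientation is given by a smooth timelike vector field \<open>\<tau>\<close>.\<close>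
definition spacetime ::
  "('m::{t2_space,second_countable_topology}, 'n::finite) atlas \<Rightarrow> ('m, 'n) metric \<Rightarrow>
     ('m, 'n) vfield \<Rightarrow> bool" where
  "spacetime A g \<tau> \<longleftrightarrow>
     smooth_atlas A \<and> connected (UNIV :: 'm set) \<and> lorentz_metric A g \<and>
     smooth_vector_field_on A UNIV \<tau> \<and> (\<forall>x. g x (\<tau> x) (\<tau> x) < 0)"

definition timelike :: "('m, 'n::finite) metric \<Rightarrow> 'm \<Rightarrow> 'n model \<Rightarrow> bool" where
  "timelike g x v \<longleftrightarrow> g x v v < 0"

definition future_timelike ::
  "('m, 'n::finite) metric \<Rightarrow> ('m, 'n) vfield \<Rightarrow> 'm \<Rightarrow> 'n model \<Rightarrow> bool" where
  "future_timelike g \<tau> x v \<longleftrightarrow> timelike g x v \<and> g x v (\<tau> x) < 0"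

definition spacelike :: "('m, 'n::finite) metric \<Rightarrow> 'm \<Rightarrow> 'n model \<Rightarrow> bool" where
  "spacelike g x v \<longleftrightarrow> v = 0 \<or> g x v v > 0"


section \<open>Levi-Civita connection, geodesics, exponential map\<close>

text \<open>\<open>christoffel A g c y u v\<close> has components \<open>\<Gamma>\<^sup>k\<^sub>i\<^sub>j u\<^sup>i v\<^sup>j\<close> in the chart \<open>c\<close> at the coordinate
  point \<open>y\<close>; the condition is the Koszul formula for constant coordinate fields.\<close>
definition christoffel ::
  "('m, 'n::finite) atlas \<Rightarrow> ('m, 'n) metric \<Rightarrow> ('m, 'n model) chart \<Rightarrow> 'n model \<Rightarrow>
     'n model \<Rightarrow> 'n model \<Rightarrow> 'n model" where
  "christoffel A g c y u v = (THE z. \<forall>w.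
     2 * metric_coord A g c y z w =
       frechet_derivative (\<lambda>y'. metric_coord A g c y' v w) (at y) u
     + frechet_derivative (\<lambda>y'. metric_coord A g c y' u w) (at y) v
     - frechet_derivative (\<lambda>y'. metric_coord A g c y' u v) (at y) w)"

definition has_velocity ::
  "('m::topological_space, 'n::finite) atlas \<Rightarrow> (real \<Rightarrow> 'm) \<Rightarrow> 'n model \<Rightarrow> real \<Rightarrow> bool" where
  "has_velocity A \<gamma> v t \<longleftrightarrow> isCont \<gamma> t \<and>
     (\<forall>c\<in>A. \<gamma> t \<in> ch_dom c \<longrightarrow>
        ((\<lambda>s. ch_map c (\<gamma> s)) has_vector_derivative tcoord A c (\<gamma> t) v) (at t))"

text \<open>\<open>Z\<close> is the covariant derivative at \<open>t\<close> of the field \<open>Y\<close> along the curve \<open>\<gamma>\<close>: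
  \<open>Z\<^sup>k = (Y\<^sup>k)' + \<Gamma>\<^sup>k\<^sub>i\<^sub>j (\<gamma>\<^sup>i)' Y\<^sup>j\<close> in every chart.\<close>
definition has_cov_deriv ::
  "('m::topological_space, 'n::finite) atlas \<Rightarrow> ('m, 'n) metric \<Rightarrow> (real \<Rightarrow> 'm) \<Rightarrow>
     (real \<Rightarrow> 'n model) \<Rightarrow> 'n model \<Rightarrow> real \<Rightarrow> bool" where
  "has_cov_deriv A g \<gamma> Y Z t \<longleftrightarrow> (\<exists>v. has_velocity A \<gamma> v t \<and>
     (\<forall>c\<in>A. \<gamma> t \<in> ch_dom c \<longrightarrow>
        ((\<lambda>s. tcoord A c (\<gamma> s) (Y s)) has_vector_derivative
           tcoord A c (\<gamma> t) Z
           - christoffel A g c (ch_map c (\<gamma> t)) (tcoord A c (\<gamma> t) v) (tcoord A c (\<gamma> t) (Y t)))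
          (at t)))"

definition parallel_along ::
  "('m::topological_space, 'n::finite) atlas \<Rightarrow> ('m, 'n) metric \<Rightarrow> (real \<Rightarrow> 'm) \<Rightarrow>
     real set \<Rightarrow> (real \<Rightarrow> 'n model) \<Rightarrow> bool" where
  "parallel_along A g \<gamma> I Y \<longleftrightarrow> (\<forall>t\<in>I. has_cov_deriv A g \<gamma> Y 0 t)"

definition geodesic_on ::
  "('m::topological_space, 'n::finite) atlas \<Rightarrow> ('m, 'n) metric \<Rightarrow> real set \<Rightarrow>
     (real \<Rightarrow> 'm) \<Rightarrow> bool" where
  "geodesic_on A g I \<gamma> \<longleftrightarrow> open I \<and> is_interval I \<and>
     (\<exists>V. (\<forall>t\<in>I. has_velocity A \<gamma> (V t) t) \<and> parallel_along A g \<gamma> I V)"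

definition geodesic_from ::
  "('m::topological_space, 'n::finite) atlas \<Rightarrow> ('m, 'n) metric \<Rightarrow> 'm \<Rightarrow> 'n model \<Rightarrow>
     real set \<Rightarrow> (real \<Rightarrow> 'm) \<Rightarrow> bool" where
  "geodesic_from A g q v I \<gamma> \<longleftrightarrow>
     geodesic_on A g I \<gamma> \<and> 0 \<in> I \<and> \<gamma> 0 = q \<and> has_velocity A \<gamma> v 0"

text \<open>The maximal geodesic with initial velocity \<open>v\<close> at \<open>q\<close>, evaluated at \<open>t\<close>
  (unspecified unless \<open>geod_defined\<close>).\<close>
definition geod_defined ::
  "('m::topological_space, 'n::finite) atlas \<Rightarrow> ('m, 'n) metric \<Rightarrow> 'm \<Rightarrow> 'n model \<Rightarrow>
     real \<Rightarrow> bool" where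
  "geod_defined A g q v t \<longleftrightarrow> (\<exists>I \<gamma>. geodesic_from A g q v I \<gamma> \<and> t \<in> I)"

definition geod ::
  "('m::topological_space, 'n::finite) atlas \<Rightarrow> ('m, 'n) metric \<Rightarrow> 'm \<Rightarrow> 'n model \<Rightarrow>
     real \<Rightarrow> 'm" where
  "geod A g q v t = (THE y. \<exists>I \<gamma>. geodesic_from A g q v I \<gamma> \<and> t \<in> I \<and> y = \<gamma> t)"

definition expmap_defined ::
  "('m::topological_space, 'n::finite) atlas \<Rightarrow> ('m, 'n) metric \<Rightarrow> 'm \<Rightarrow> 'n model \<Rightarrow> bool" where
  "expmap_defined A g q v \<longleftrightarrow> geod_defined A g q v 1"

definition expmap ::
  "('m::topological_space, 'n::finite) atlas \<Rightarrow> ('m, 'n) metric \<Rightarrow> 'm \<Rightarrow> 'n model \<Rightarrow> 'm" where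
  "expmap A g q v = geod A g q v 1"

definition convex_normal_nbhd ::
  "('m::topological_space, 'n::finite) atlas \<Rightarrow> ('m, 'n) metric \<Rightarrow> 'm \<Rightarrow> 'm set \<Rightarrow> bool" where
  "convex_normal_nbhd A g p V \<longleftrightarrow> open V \<and> p \<in> V \<and>
     (\<exists>D. atlas_open (tangent_atlas A) D \<and>
        (\<forall>q v. (q, v) \<in> D \<longrightarrow> expmap_defined A g q v) \<and>
        (\<forall>q v. (q, v) \<in> D \<longrightarrow> (\<forall>s\<in>{0..1}. (q, s *\<^sub>R v) \<in> D)) \<and>
        diffeo_between (tangent_atlas A) (prod_atlas A A) D (V \<times> V) (\<lambda>(q, v). (q, expmap A g q v)))"


section \<open>Frame fields and uniform Temple charts\<close>

text \<open>The frame index \<open>None\<close> stands for \<open>0\<close>; the indices \<open>Some i\<close> stand for \<open>1, \<dots>, n\<close>.\<close>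
type_synonym ('m, 'n) frame = "'n option \<Rightarrow> ('m, 'n) vfield"

definition frame_field_on ::
  "('m::topological_space, 'n::finite) atlas \<Rightarrow> ('m, 'n) metric \<Rightarrow> ('m, 'n) vfield \<Rightarrow>
     'm set \<Rightarrow> ('m, 'n) frame \<Rightarrow> bool" where
  "frame_field_on A g \<tau> K e \<longleftrightarrow> (\<exists>S. open S \<and> K \<subseteq> S \<and>
     (\<forall>a. smooth_vector_field_on A S (e a)) \<and>
     (\<forall>x\<in>S. (\<forall>a b. \<bar>g x (e a x) (e b x)\<bar> = (if a = b then 1 else 0)) \<and>
        future_timelike g \<tau> x (e None x) \<and> (\<forall>i. spacelike g x (e (Some i) x))))"

definition central_geod ::
  "('m::topological_space, 'n::finite) atlas \<Rightarrow> ('m, 'n) metric \<Rightarrow> ('m, 'n) frame \<Rightarrow> 'm \<Rightarrow>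
     real \<Rightarrow> 'm" where
  "central_geod A g e q t = geod A g q (e None q) t"

definition cylinder :: "real \<Rightarrow> 'n::finite model set" where
  "cylinder r = {-r<..<r} \<times> ball 0 r"

definition cone_vector ::
  "('m, 'n::finite) frame \<Rightarrow> 'm \<Rightarrow> real ^ 'n \<Rightarrow> 'n model" where
  "cone_vector e y x = norm x *\<^sub>R e None y + (\<Sum>i\<in>UNIV. x $ i *\<^sub>R e (Some i) y)"

definition temple_map ::
  "('m::topological_space, 'n::finite) atlas \<Rightarrow> ('m, 'n) metric \<Rightarrow> ('m, 'n) frame \<Rightarrow> 'm \<Rightarrow>
     'n model \<Rightarrow> 'm" where
  "temple_map A g e q = (\<lambda>(t, x).
     expmap A g (central_geod A g e q t) (cone_vector e (central_geod A g e q t) x))"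

definition temple_dom ::
  "('m::topological_space, 'n::finite) atlas \<Rightarrow> ('m, 'n) metric \<Rightarrow> ('m, 'n) frame \<Rightarrow> real \<Rightarrow>
     'm \<Rightarrow> 'm set" where
  "temple_dom A g e r q = temple_map A g e q ` cylinder r"

definition central_image ::
  "('m::topological_space, 'n::finite) atlas \<Rightarrow> ('m, 'n) metric \<Rightarrow> ('m, 'n) frame \<Rightarrow> real \<Rightarrow>
     'm \<Rightarrow> 'm set" where
  "central_image A g e r q = central_geod A g e q ` {-r<..<r}"

definition optical ::
  "('m::topological_space, 'n::finite) atlas \<Rightarrow> ('m, 'n) metric \<Rightarrow> ('m, 'n) frame \<Rightarrow> real \<Rightarrow>
     'm \<Rightarrow> 'm \<Rightarrow> real" where
  "optical A g e r q y = fst (inv_into (cylinder r) (temple_map A g e q) y)"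

definition radial ::
  "('m::topological_space, 'n::finite) atlas \<Rightarrow> ('m, 'n) metric \<Rightarrow> ('m, 'n) frame \<Rightarrow> real \<Rightarrow>
     'm \<Rightarrow> 'm \<Rightarrow> real" where
  "radial A g e r q y = norm (snd (inv_into (cylinder r) (temple_map A g e q) y))"

definition uniform_temple_nbhd ::
  "('m::topological_space, 'n::finite) atlas \<Rightarrow> ('m, 'n) metric \<Rightarrow> 'm \<Rightarrow> 'm set \<Rightarrow>
     ('m, 'n) frame \<Rightarrow> real \<Rightarrow> 'm set \<Rightarrow> bool" where
  "uniform_temple_nbhd A g p K e r U \<longleftrightarrow> p \<in> interior U \<and> U \<subseteq> K \<and>
     (\<forall>q\<in>U.
        (\<forall>t\<in>{-r<..<r}.
           geod_defined A g q (e None q) t \<and>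
           central_geod A g e q t \<in> K \<and>
           has_velocity A (central_geod A g e q) (e None (central_geod A g e q t)) t) \<and>
        (\<forall>a. parallel_along A g (central_geod A g e q) {-r<..<r}
           (\<lambda>t. e a (central_geod A g e q t))) \<and>
        (\<forall>(t, x)\<in>cylinder r. expmap_defined A g (central_geod A g e q t)
           (cone_vector e (central_geod A g e q t) x)) \<and>
        homeomorphism (cylinder r) (temple_dom A g e r q) (temple_map A g e q)
          (inv_into (cylinder r) (temple_map A g e q)) \<and>
        diffeo_between std_atlas A {z \<in> cylinder r. snd z \<noteq> 0}
          (temple_map A g e q ` {z \<in> cylinder r. snd z \<noteq> 0}) (temple_map A g e q) \<and>
        U \<subseteq> temple_dom A g e r q \<and> temple_dom A g e r q \<subseteq> K)"

definition temple_setting ::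
  "('m::topological_space, 'n::finite) atlas \<Rightarrow> ('m, 'n) metric \<Rightarrow> ('m, 'n) vfield \<Rightarrow> 'm \<Rightarrow>
     'm set \<Rightarrow> ('m, 'n) frame \<Rightarrow> real \<Rightarrow> (real \<Rightarrow> 'm set) \<Rightarrow> bool" where
  "temple_setting A g \<tau> p K e R U \<longleftrightarrow>
     compact K \<and> p \<in> K \<and> (\<exists>V. convex_normal_nbhd A g p V \<and> K \<subseteq> V) \<and>
     frame_field_on A g \<tau> K e \<and> R > 0 \<and>
     (\<forall>r\<in>{0<..R}. uniform_temple_nbhd A g p K e r (U r))"


section \<open>The Riemannianized metric\<close>

definition riem_metric ::
  "('m, 'n::finite) metric \<Rightarrow> ('m, 'n) frame \<Rightarrow> ('m, 'n) metric" where
  "riem_metric g e x X Y = 2 * g x X (e None x) * g x Y (e None x) + g x X Y"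

definition riem_grad ::
  "('m, 'n::finite) atlas \<Rightarrow> ('m, 'n) metric \<Rightarrow> ('m, 'n) frame \<Rightarrow> ('m \<Rightarrow> real) \<Rightarrow>
     ('m, 'n) vfield" where
  "riem_grad A g e f x = (THE Z. \<forall>X. riem_metric g e x Z X = dir_deriv A f x X)"

definition riem_norm ::
  "('m, 'n::finite) metric \<Rightarrow> ('m, 'n) frame \<Rightarrow> 'm \<Rightarrow> 'n model \<Rightarrow> real" where
  "riem_norm g e x X = sqrt (riem_metric g e x X X)"

end

theory Submission
  imports Defs
begin

text \<open>
  Fix a point \<open>\<Phi>\<^sub>q(t, x)\<close> with \<open>x \<noteq> 0\<close>.  It is the tip \<open>\<gamma>(1)\<close> of the null geodesic
  \<open>\<gamma>(s) = \<Phi>\<^sub>q(t, s x)\<close>, whose initial velocity is \<open>|x| e\<^sub>0 + \<Sum> x\<^sup>i e\<^sub>i\<close>.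

  The level sets of the optical function \<open>\<omega>\<close> are light cones with vertices on the central geodesic.
  A tangent vector \<open>X\<close> at the tip is the variation field of a family of generators of these cones
  whose vertices move with speed \<open>d\<omega>(X)\<close> along the central geodesic.  By the Gauss lemma
  (\<open>gauss_null_variation\<close>) the product of the variation field with the velocity is constant along
  \<open>\<gamma>\<close>; at the vertex it is \<open>- |x| d\<omega>(X)\<close>.  Hence \<open>d\<omega>(X) = - g(X, \<gamma>'(1)) / |x|\<close>
  (\<open>optical_derivative\<close>), and since \<open>\<gamma>'(1)\<close> is null, the Riemannian gradient has length
  \<open>\<surd>2 |f(1)| / |x|\<close> with \<open>f(s) = g(\<gamma>'(s), e\<^sub>0)\<close> and \<open>f(0) = - |x|\<close>.
  It remains to show that \<open>||f(1)| - |x||\<close> is less than a constant times \<open>|x|\<^sup>2\<close>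
  (\<open>null_geodesic_estimate\<close>).

  The derivative of \<open>f\<close> is a quadratic form in \<open>\<gamma>'\<close>, half the Lie derivative of \<open>g\<close> along
  \<open>e\<^sub>0\<close>.  On the compact set \<open>K\<close> it is bounded by a multiple of \<open>g\<^sub>R\<close>, and
  \<open>g\<^sub>R(\<gamma>', \<gamma>') = 2 f\<^sup>2\<close> for null \<open>\<gamma>'\<close>, so \<open>|f'| \<le> 2 B f\<^sup>2\<close>.  For small \<open>|x|\<close> this
  Riccati inequality gives the estimate (\<open>riccati_small\<close>).  For large \<open>|x|\<close> it allows blow-up
  before \<open>s = 1\<close>, and another argument is needed: \<open>\<gamma>\<close> lies in a convex normal neighbourhood, so the
  second half of \<open>\<gamma>\<close>, run backwards, is a ray of the exponential map between two points of \<open>K\<close>.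
  Thus \<open>- \<gamma>'(1) / 2\<close> is a value of the inverse of the exponential map on \<open>K \<times> K\<close>, where it is
  bounded by continuity (\<open>Log_bound\<close>).

  One constant has to serve all spacetimes that agree on \<open>K\<close>.  Off the vertex the generators run in
  the interior of \<open>K\<close>, where metrics that agree on \<open>K\<close> have the same connection and hence the
  same geodesics (\<open>geodesic_curve_transfer\<close>).  Therefore the bounds may be computed in one fixed spacetime
  and one fixed normal neighbourhood.  Starting the backward ray at the tip and ending it halfway keeps it
  away from the vertex, which may lie on the boundary of \<open>K\<close>.
\<close>

text \<open>Tangent vectors are pairs; quantifiers over them should not be split into components.\<close>
declare split_paired_All [simp del] split_paired_Ex [simp del]

section \<open>Smooth maps between Euclidean spaces\<close>

lemma smooth_on_imp_differentiable:
  assumes "smooth_on S f" "x \<in> S"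
  shows "f differentiable (at x)"
  using assms unfolding smooth_on_def by (metis Ck_on.simps(2))

lemma smooth_on_imp_continuous_on: "smooth_on S f \<Longrightarrow> continuous_on S f"
  unfolding smooth_on_def by (metis Ck_on.simps(1))

lemma smooth_on_frechet_derivative:
  "smooth_on S f \<Longrightarrow> smooth_on S (\<lambda>x. frechet_derivative f (at x) v)"
  unfolding smooth_on_def by (metis Ck_on.simps(2))

lemma linear_Basis_expansion:
  fixes f :: "'a::euclidean_space \<Rightarrow> 'b::real_vector"
  assumes "linear f" shows "f v = (\<Sum>b\<in>Basis. (v \<bullet> b) *\<^sub>R f b)"
proof -
  have "f v = f (\<Sum>b\<in>Basis. (v \<bullet> b) *\<^sub>R b)" by (simp add: euclidean_representation)
  then show ?thesis by (simp add: linear_sum[OF assms] linear_cmul[OF assms])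
qed

lemma has_vector_derivative_eventually_cong:
  assumes "(f has_vector_derivative f') (at t)" "eventually (\<lambda>s. f s = h s) (nhds t)"
  shows "(h has_vector_derivative f') (at t)"
proof -
  obtain U where U: "open U" "t \<in> U" "\<And>s. s \<in> U \<Longrightarrow> f s = h s"
    using assms(2) unfolding eventually_nhds by blast
  show ?thesis by (rule has_vector_derivative_transform_within_open[OF assms(1) U])
qed

text \<open>Smoothness is only given with fixed directions in the differentials and fixed arguments in the
  metric.  A family of linear maps on a finite-dimensional space that depends nicely on the parameter for
  each fixed argument does so jointly, by expanding the argument in a basis; this principle is used for
  continuity, for derivatives along curves, and below for Lipschitz bounds.\<close>
lemma continuous_on_linear_family:
  fixes L :: "'a::topological_space \<Rightarrow> 'b::euclidean_space \<Rightarrow> 'c::real_normed_vector"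
  assumes lin: "\<And>x. x \<in> S \<Longrightarrow> linear (L x)"
    and cont: "\<And>v. continuous_on S (\<lambda>x. L x v)"
    and p: "continuous_on T p" "p ` T \<subseteq> S" and q: "continuous_on T q"
  shows "continuous_on T (\<lambda>t. L (p t) (q t))"
proof -
  have eq: "L (p t) (q t) = (\<Sum>b\<in>Basis. (q t \<bullet> b) *\<^sub>R L (p t) b)" if "t \<in> T" for t
    using that p(2) by (intro linear_Basis_expansion lin) auto
  have "continuous_on T (\<lambda>t. \<Sum>b\<in>Basis. (q t \<bullet> b) *\<^sub>R L (p t) b)"
    by (intro continuous_intros continuous_on_compose2[OF cont p(1)] p q)
  then show ?thesis using eq by (simp cong: continuous_on_cong)
qed

lemma has_vector_derivative_linear_family:
  fixes L :: "'a::real_normed_vector \<Rightarrow> 'b::euclidean_space \<Rightarrow> 'c::real_normed_vector"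
  assumes lin: "\<And>x. x \<in> S \<Longrightarrow> linear (L x)"
    and "open S" "p t \<in> S"
    and diff: "\<And>v. (\<lambda>x. L x v) differentiable (at (p t))"
    and p: "(p has_vector_derivative p') (at t)" and q: "(q has_vector_derivative q') (at t)"
  shows "((\<lambda>t. L (p t) (q t)) has_vector_derivative
     (frechet_derivative (\<lambda>x. L x (q t)) (at (p t)) p' + L (p t) q')) (at t)"
proof -
  let ?D = "\<lambda>v. frechet_derivative (\<lambda>x. L x v) (at (p t))"
  have D: "((\<lambda>x. L x v) has_derivative ?D v) (at (p t))" for v
    using diff frechet_derivative_works by blast
  have eq: "L x v = (\<Sum>b\<in>Basis. (v \<bullet> b) *\<^sub>R L x b)" if "x \<in> S" for x v
    by (rule linear_Basis_expansion[OF lin[OF that]])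
  have Dsum: "?D v w = (\<Sum>b\<in>Basis. (v \<bullet> b) *\<^sub>R ?D b w)" for v w
  proof -
    have "((\<lambda>x. \<Sum>b\<in>Basis. (v \<bullet> b) *\<^sub>R L x b) has_derivative (\<lambda>w. \<Sum>b\<in>Basis. (v \<bullet> b) *\<^sub>R ?D b w)) (at (p t))"
      by (auto intro!: derivative_eq_intros D)
    then have "((\<lambda>x. L x v) has_derivative (\<lambda>w. \<Sum>b\<in>Basis. (v \<bullet> b) *\<^sub>R ?D b w)) (at (p t))"
      by (rule has_derivative_transform_within_open[OF _ \<open>open S\<close> \<open>p t \<in> S\<close>]) (simp add: eq)
    then show ?thesis using has_derivative_unique[OF D[of v]] by metis
  qed
  have Lp: "((\<lambda>t. L (p t) b) has_vector_derivative ?D b p') (at t)" for b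
    using vector_derivative_diff_chain_within[of p p' t UNIV "\<lambda>x. L x b" "?D b"] p D[of b]
    by (auto simp: o_def has_derivative_at_withinI)
  have "((\<lambda>t. \<Sum>b\<in>Basis. (q t \<bullet> b) *\<^sub>R L (p t) b) has_vector_derivative
      (\<Sum>b\<in>Basis. (q t \<bullet> b) *\<^sub>R ?D b p' + (q' \<bullet> b) *\<^sub>R L (p t) b)) (at t)"
  proof (rule has_vector_derivative_sum)
    fix b :: 'b
    have "((\<lambda>t. q t \<bullet> b) has_vector_derivative (q' \<bullet> b)) (at t)"
      using bounded_linear.has_vector_derivative[OF bounded_linear_inner_left q] by blast
    then have "((\<lambda>t. q t \<bullet> b) has_real_derivative (q' \<bullet> b)) (at t)"
      by (simp add: has_real_derivative_iff_has_vector_derivative)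
    from has_vector_derivative_scaleR[OF this Lp[of b]]
    show "((\<lambda>t. (q t \<bullet> b) *\<^sub>R L (p t) b) has_vector_derivative
        (q t \<bullet> b) *\<^sub>R ?D b p' + (q' \<bullet> b) *\<^sub>R L (p t) b) (at t)" by simp
  qed
  also have "(\<Sum>b\<in>Basis. (q t \<bullet> b) *\<^sub>R ?D b p' + (q' \<bullet> b) *\<^sub>R L (p t) b) = ?D (q t) p' + L (p t) q'"
    using \<open>p t \<in> S\<close> by (simp add: sum.distrib Dsum[of "q t"] eq[of "p t" q'])
  finally have *: "((\<lambda>t. \<Sum>b\<in>Basis. (q t \<bullet> b) *\<^sub>R L (p t) b) has_vector_derivative
      ?D (q t) p' + L (p t) q') (at t)" .
  have "continuous (at t) p" using p by (rule has_vector_derivative_continuous)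
  then obtain U where U: "open U" "t \<in> U" "p ` U \<subseteq> S"
    using \<open>open S\<close> \<open>p t \<in> S\<close> by (metis continuous_at_open image_subset_iff)
  show ?thesis
    by (rule has_vector_derivative_transform_within_open[OF * U(1,2)]) (use U eq in auto)
qed

text \<open>The increment of \<open>f\<close> in direction \<open>v\<close> is the integral of the derivative in
  direction \<open>v\<close>.  Differentiating under the integral in direction \<open>u\<close> and then taking the
  derivative of the resulting integral exchanges the two differentiations.\<close>
lemma symmetric_second_frechet_derivative:
  fixes f :: "'a::euclidean_space \<Rightarrow> 'b::euclidean_space"
  assumes f: "smooth_on S f" and S: "open S" and x: "x \<in> S"
  shows "frechet_derivative (\<lambda>y. frechet_derivative f (at y) u) (at x) v =
         frechet_derivative (\<lambda>y. frechet_derivative f (at y) v) (at x) u"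
proof -
  define Fu where "Fu = (\<lambda>y. frechet_derivative f (at y) u)"
  define Fv where "Fv = (\<lambda>y. frechet_derivative f (at y) v)"
  define G where "G = (\<lambda>y. frechet_derivative Fv (at y) u)"
  have sm: "smooth_on S Fu" "smooth_on S Fv" "smooth_on S G"
    unfolding Fu_def Fv_def G_def by (intro smooth_on_frechet_derivative f)+
  define P where "P = (\<lambda>z::real\<times>real. x + fst z *\<^sub>R u + snd z *\<^sub>R v)"
  have "open (P -` S)"
    unfolding P_def by (intro open_vimage S continuous_intros)
  moreover have "(0,0) \<in> P -` S" by (simp add: P_def x)
  ultimately obtain A B where AB: "open A" "open B" "(0,0) \<in> A \<times> B" "A \<times> B \<subseteq> P -` S"
    by (rule open_prod_elim)
  from AB(1,3) obtain a where a: "a > 0" "cball 0 a \<subseteq> A" by (auto simp: open_contains_cball)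
  from AB(2,3) obtain b where b: "b > 0" "cball 0 b \<subseteq> B" by (auto simp: open_contains_cball)
  have inS: "x + s *\<^sub>R u + t *\<^sub>R v \<in> S" if "\<bar>s\<bar> \<le> a" "\<bar>t\<bar> \<le> b" for s t
  proof -
    have "s \<in> A" "t \<in> B" using that a b by (auto simp: subset_eq)
    then have "(s,t) \<in> P -` S" using AB(4) by blast
    then show ?thesis by (simp add: P_def)
  qed
  have df: "(f has_derivative frechet_derivative f (at y)) (at y)" if "y \<in> S" for y
    using smooth_on_imp_differentiable[OF f that] frechet_derivative_works by blast
  have dFu: "(Fu has_derivative frechet_derivative Fu (at y)) (at y)" if "y \<in> S" for y
    using smooth_on_imp_differentiable[OF sm(1) that] frechet_derivative_works by blast
  have dFv: "(Fv has_derivative frechet_derivative Fv (at y)) (at y)" if "y \<in> S" for y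
    using smooth_on_imp_differentiable[OF sm(2) that] frechet_derivative_works by blast
  have chain: "((\<lambda>s. h (p + s *\<^sub>R w)) has_vector_derivative h' w) (at s within X)"
    if "(h has_derivative h') (at (p + s *\<^sub>R w))" for h :: "'a \<Rightarrow> 'b" and h' p w s X
  proof -
    have "((\<lambda>s. p + s *\<^sub>R w) has_vector_derivative w) (at s within X)"
      by (auto intro!: derivative_eq_intros)
    from vector_derivative_diff_chain_within[OF this has_derivative_at_withinI[OF that]]
    show ?thesis by (simp add: o_def)
  qed
  have incr: "f (x + s *\<^sub>R u + t *\<^sub>R v) - f (x + s *\<^sub>R u) = integral {0..t} (\<lambda>\<beta>. Fv (x + s *\<^sub>R u + \<beta> *\<^sub>R v))"
    if "\<bar>s\<bar> \<le> a" "0 \<le> t" "t \<le> b" for s t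
  proof -
    have "((\<lambda>\<beta>. Fv (x + s *\<^sub>R u + \<beta> *\<^sub>R v)) has_integral
       f (x + s *\<^sub>R u + t *\<^sub>R v) - f (x + s *\<^sub>R u + 0 *\<^sub>R v)) {0..t}"
    proof (intro fundamental_theorem_of_calculus \<open>0 \<le> t\<close>)
      fix \<beta> assume "\<beta> \<in> {0..t}"
      then have "x + s *\<^sub>R u + \<beta> *\<^sub>R v \<in> S" using that by (intro inS) auto
      from chain[OF df[OF this]]
      show "((\<lambda>\<beta>. f (x + s *\<^sub>R u + \<beta> *\<^sub>R v)) has_vector_derivative Fv (x + s *\<^sub>R u + \<beta> *\<^sub>R v)) (at \<beta> within {0..t})"
        by (simp add: Fv_def)
    qed
    then show ?thesis by (simp add: integral_unique)
  qed
  have key: "Fu (x + t *\<^sub>R v) - Fu x = integral {0..t} (\<lambda>\<beta>. G (x + \<beta> *\<^sub>R v))"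
    if t: "0 \<le> t" "t \<le> b" for t
  proof -
    have "((\<lambda>s. integral (cbox 0 t) (\<lambda>\<beta>. Fv (x + s *\<^sub>R u + \<beta> *\<^sub>R v))) has_vector_derivative
        integral (cbox 0 t) (\<lambda>\<beta>. G (x + 0 *\<^sub>R u + \<beta> *\<^sub>R v))) (at 0 within {-a..a})"
    proof (rule leibniz_rule_vector_derivative)
      fix s \<beta> assume "s \<in> {-a..a}" "\<beta> \<in> cbox 0 t"
      then have *: "x + s *\<^sub>R u + \<beta> *\<^sub>R v \<in> S" using t by (intro inS) auto
      have "((\<lambda>s. Fv ((x + \<beta> *\<^sub>R v) + s *\<^sub>R u)) has_vector_derivative G (x + s *\<^sub>R u + \<beta> *\<^sub>R v)) (at s within {-a..a})"
        unfolding G_def using dFv[OF *] by (intro chain) (simp add: algebra_simps)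
      then show "((\<lambda>s. Fv (x + s *\<^sub>R u + \<beta> *\<^sub>R v)) has_vector_derivative G (x + s *\<^sub>R u + \<beta> *\<^sub>R v)) (at s within {-a..a})"
        by (simp add: algebra_simps)
    next
      fix s assume "s \<in> {-a..a}"
      then show "(\<lambda>\<beta>. Fv (x + s *\<^sub>R u + \<beta> *\<^sub>R v)) integrable_on cbox 0 t"
        using t by (intro integrable_continuous continuous_on_compose2[OF smooth_on_imp_continuous_on[OF sm(2)]]
            continuous_intros) (auto intro!: inS)
    next
      show "continuous_on ({-a..a} \<times> cbox 0 t) (\<lambda>(s, \<beta>). G (x + s *\<^sub>R u + \<beta> *\<^sub>R v))"
        using t unfolding split_def
        by (intro continuous_on_compose2[OF smooth_on_imp_continuous_on[OF sm(3)]]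
            continuous_intros) (auto intro!: inS)
    qed (use a in auto)
    moreover have "((\<lambda>s. f (x + s *\<^sub>R u + t *\<^sub>R v) - f (x + s *\<^sub>R u)) has_vector_derivative
        Fu (x + 0 *\<^sub>R u + t *\<^sub>R v) - Fu (x + 0 *\<^sub>R u)) (at 0 within {-a..a})"
    proof (rule has_vector_derivative_diff)
      have "((\<lambda>s. f ((x + t *\<^sub>R v) + s *\<^sub>R u)) has_vector_derivative Fu (x + 0 *\<^sub>R u + t *\<^sub>R v)) (at 0 within {-a..a})"
        unfolding Fu_def using df[OF inS[of 0 t]] t a by (intro chain) (simp add: algebra_simps)
      then show "((\<lambda>s. f (x + s *\<^sub>R u + t *\<^sub>R v)) has_vector_derivative Fu (x + 0 *\<^sub>R u + t *\<^sub>R v)) (at 0 within {-a..a})"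
        by (simp add: algebra_simps)
      show "((\<lambda>s. f (x + s *\<^sub>R u)) has_vector_derivative Fu (x + 0 *\<^sub>R u)) (at 0 within {-a..a})"
        unfolding Fu_def using df[OF x] by (intro chain) simp
    qed
    then have "((\<lambda>s. integral (cbox 0 t) (\<lambda>\<beta>. Fv (x + s *\<^sub>R u + \<beta> *\<^sub>R v))) has_vector_derivative
        Fu (x + 0 *\<^sub>R u + t *\<^sub>R v) - Fu (x + 0 *\<^sub>R u)) (at 0 within {-a..a})"
      by (rule has_vector_derivative_transform[rotated 2]) (use incr t a in auto)
    ultimately have "integral (cbox 0 t) (\<lambda>\<beta>. G (x + 0 *\<^sub>R u + \<beta> *\<^sub>R v)) = Fu (x + 0 *\<^sub>R u + t *\<^sub>R v) - Fu (x + 0 *\<^sub>R u)"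
      using a by (intro vector_derivative_unique_within_closed_interval[of "-a" a 0]) auto
    then show ?thesis by simp
  qed
  have "((\<lambda>t. integral {0..t} (\<lambda>\<beta>. G (x + \<beta> *\<^sub>R v))) has_vector_derivative G (x + 0 *\<^sub>R v)) (at 0 within {0..b})"
    using b a by (intro integral_has_vector_derivative continuous_on_compose2[OF smooth_on_imp_continuous_on[OF sm(3)]]
            continuous_intros) (auto intro!: inS[of 0, simplified])
  then have "((\<lambda>t. Fu (x + t *\<^sub>R v) - Fu x) has_vector_derivative G (x + 0 *\<^sub>R v)) (at 0 within {0..b})"
    by (rule has_vector_derivative_transform[rotated 2]) (use key b in auto)
  moreover have "((\<lambda>t. Fu (x + t *\<^sub>R v) - Fu x) has_vector_derivative frechet_derivative Fu (at x) v) (at 0 within {0..b})"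
    using dFu[OF x] by (auto intro!: derivative_eq_intros chain)
  ultimately have "G (x + 0 *\<^sub>R v) = frechet_derivative Fu (at x) v"
    using b by (intro vector_derivative_unique_within_closed_interval[of 0 b 0]) auto
  then show ?thesis by (simp add: G_def Fu_def Fv_def)
qed

lemma has_vector_derivative_bilinear_family:
  fixes G :: "'a::real_normed_vector \<Rightarrow> 'b::euclidean_space \<Rightarrow> 'c::euclidean_space \<Rightarrow> 'd::real_normed_vector"
  assumes bil: "\<And>x. x \<in> S \<Longrightarrow> bilinear (G x)"
    and S: "open S" "p t \<in> S"
    and diff: "\<And>x u v. x \<in> S \<Longrightarrow> (\<lambda>x. G x u v) differentiable (at x)"
    and p: "(p has_vector_derivative p') (at t)"
    and q: "(q has_vector_derivative q') (at t)"
    and w: "(w has_vector_derivative w') (at t)"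
  shows "((\<lambda>t. G (p t) (q t) (w t)) has_vector_derivative
     (frechet_derivative (\<lambda>x. G x (q t) (w t)) (at (p t)) p' + G (p t) q' (w t) + G (p t) (q t) w')) (at t)"
proof -
  have "continuous (at t) p" using p by (rule has_vector_derivative_continuous)
  then obtain U where U: "open U" "t \<in> U" "p ` U \<subseteq> S"
    using S by (metis continuous_at_open image_subset_iff)
  have 1: "((\<lambda>t. G (p t) (q t) v) has_vector_derivative
     (frechet_derivative (\<lambda>x. G x (q t) v) (at (p t)) p' + G (p t) q' v)) (at t)" for v
  proof (rule has_vector_derivative_linear_family[OF _ S(1), of "\<lambda>x u. G x u v" p t p' q q'])
    show "linear (\<lambda>u. G x u v)" if "x \<in> S" for x
      using bil[OF that] by (simp add: bilinear_def)
  qed (use S diff p q in auto)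
  have 2: "((\<lambda>t. G (p (id t)) (q (id t)) (w t)) has_vector_derivative
     (frechet_derivative (\<lambda>x. G (p x) (q x) (w t)) (at (id t)) 1 + G (p (id t)) (q (id t)) w')) (at t)"
  proof (rule has_vector_derivative_linear_family[OF _ U(1), of "\<lambda>x v. G (p x) (q x) v" id])
    show "linear (\<lambda>v. G (p x) (q x) v)" if "x \<in> U" for x
      using bil[of "p x"] that U by (auto simp add: bilinear_def)
    show "(\<lambda>x. G (p x) (q x) v) differentiable at (id t)" for v
      using 1[of v] by (auto simp: has_vector_derivative_def differentiable_def)
    show "(id has_vector_derivative 1) (at t)" unfolding id_def by (auto intro!: derivative_eq_intros)
  qed (use U w in auto)
  have "frechet_derivative (\<lambda>x. G (p x) (q x) (w t)) (at t) 1
      = frechet_derivative (\<lambda>x. G x (q t) (w t)) (at (p t)) p' + G (p t) q' (w t)"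
    by (simp add: frechet_derivative_at[OF 1[of "w t", unfolded has_vector_derivative_def], symmetric])
  with 2 show ?thesis by simp
qed

text \<open>In the Gauss lemma \<open>H\<close> is the exponential map in charts, evaluated on a fan of rays
  \<open>s \<mapsto> s k(\<epsilon>)\<close> over a moving base point \<open>y(\<epsilon>)\<close>.  Only the values of \<open>y\<close>
  and \<open>k\<close> have to be differentiable, and only at one parameter: the second derivatives fall on
  \<open>H\<close>, whose symmetry makes the mixed derivative \<open>W\<close> the same in both orders.\<close>
lemma fan_mixed_derivatives:
  fixes H :: "'a::euclidean_space \<times> 'b::euclidean_space \<Rightarrow> 'c::euclidean_space"
  assumes H: "smooth_on S H" and S: "open S"
    and y: "(y has_vector_derivative y') (at e0)" and k: "(k has_vector_derivative k') (at e0)"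
  defines "Y \<equiv> \<lambda>s. frechet_derivative H (at (y e0, s *\<^sub>R k e0)) (y', s *\<^sub>R k')"
    and "X \<equiv> \<lambda>\<epsilon> s. frechet_derivative H (at (y \<epsilon>, s *\<^sub>R k \<epsilon>)) (0, k \<epsilon>)"
  shows "\<And>s. (y e0, s *\<^sub>R k e0) \<in> S \<Longrightarrow> ((\<lambda>\<epsilon>. H (y \<epsilon>, s *\<^sub>R k \<epsilon>)) has_vector_derivative Y s) (at e0)"
    and "\<And>s \<epsilon>. (y \<epsilon>, s *\<^sub>R k \<epsilon>) \<in> S \<Longrightarrow> ((\<lambda>s. H (y \<epsilon>, s *\<^sub>R k \<epsilon>)) has_vector_derivative X \<epsilon> s) (at s)"
    and "\<And>s. (y e0, s *\<^sub>R k e0) \<in> S \<Longrightarrow> \<exists>W. (Y has_vector_derivative W) (at s) \<and>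
      ((\<lambda>\<epsilon>. X \<epsilon> s) has_vector_derivative W) (at e0)"
proof -
  have dH: "(H has_derivative frechet_derivative H (at z)) (at z)" if "z \<in> S" for z
    using smooth_on_imp_differentiable[OF H that] frechet_derivative_works by blast
  have lin: "linear (frechet_derivative H (at z))" if "z \<in> S" for z
    using dH[OF that] has_derivative_linear by blast
  have ch: "((\<lambda>t. h (c t)) has_vector_derivative h' c') (at t)"
    if "(h has_derivative h') (at (c t))" "(c has_vector_derivative c') (at t)"
    for h :: "'a \<times> 'b \<Rightarrow> 'c" and h' c c' t
    using vector_derivative_diff_chain_within[OF that(2)[simplified] has_derivative_at_withinI[OF that(1)]]
    by (simp add: o_def)
  have c1: "((\<lambda>\<epsilon>. (y \<epsilon>, s *\<^sub>R k \<epsilon>)) has_vector_derivative (y', s *\<^sub>R k')) (at e0)" for s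
    using k by (intro has_vector_derivative_Pair y) (auto intro!: derivative_eq_intros)
  have c2: "((\<lambda>s. (y \<epsilon>, s *\<^sub>R k \<epsilon>)) has_vector_derivative (0, k \<epsilon>)) (at s)" for s \<epsilon>
    by (intro has_vector_derivative_Pair) (auto intro!: derivative_eq_intros)
  show 1: "((\<lambda>\<epsilon>. H (y \<epsilon>, s *\<^sub>R k \<epsilon>)) has_vector_derivative Y s) (at e0)" if "(y e0, s *\<^sub>R k e0) \<in> S" for s
    unfolding Y_def by (rule ch[OF dH c1]) (rule that)
  show 2: "((\<lambda>s. H (y \<epsilon>, s *\<^sub>R k \<epsilon>)) has_vector_derivative X \<epsilon> s) (at s)" if "(y \<epsilon>, s *\<^sub>R k \<epsilon>) \<in> S" for s \<epsilon>
    unfolding X_def by (rule ch[OF dH c2]) (rule that)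
  show "\<exists>W. (Y has_vector_derivative W) (at s) \<and>
      ((\<lambda>\<epsilon>. X \<epsilon> s) has_vector_derivative W) (at e0)" if z: "(y e0, s *\<^sub>R k e0) \<in> S" for s
  proof -
    let ?z = "(y e0, s *\<^sub>R k e0)"
    define W where "W = frechet_derivative (\<lambda>z. frechet_derivative H (at z) (y', s *\<^sub>R k')) (at ?z) (0, k e0)
       + frechet_derivative H (at ?z) (0, k')"
    have diff: "(\<lambda>z. frechet_derivative H (at z) v) differentiable (at ?z)" for v
      using smooth_on_imp_differentiable[OF smooth_on_frechet_derivative[OF H] z] .
    have "((\<lambda>s. (y', s *\<^sub>R k')) has_vector_derivative (0, k')) (at s)"
      by (intro has_vector_derivative_Pair) (auto intro!: derivative_eq_intros)
    from has_vector_derivative_linear_family[OF lin S _ _ c2 this, of _ e0, OF _ z diff]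
    have "(Y has_vector_derivative W) (at s)" by (simp add: Y_def W_def)
    moreover have "((\<lambda>\<epsilon>. (0, k \<epsilon>)) has_vector_derivative (0, k')) (at e0)"
      by (intro has_vector_derivative_Pair k) (auto intro!: derivative_eq_intros)
    from has_vector_derivative_linear_family[OF lin S _ _ c1 this, of _ s, OF _ z diff]
    have "((\<lambda>\<epsilon>. X \<epsilon> s) has_vector_derivative W) (at e0)"
      using symmetric_second_frechet_derivative[OF H S z, of "(0, k e0)" "(y', s *\<^sub>R k')"]
      by (simp add: X_def W_def)
    ultimately show ?thesis by blast
  qed
qed

lemma Ck_on_cong:
  assumes "open S" "\<And>x. x \<in> S \<Longrightarrow> f x = h x" "Ck_on k S f"
  shows "Ck_on k S h"
  using assms(2,3)
proof (induction k arbitrary: f h)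
  case 0
  then show ?case by (simp cong: continuous_on_cong)
next
  case (Suc k)
  have diff: "f differentiable (at x)" if "x \<in> S" for x using Suc.prems that by simp
  have fd: "frechet_derivative f (at x) = frechet_derivative h (at x)" if "x \<in> S" for x
    by (rule frechet_derivative_transform_within_open[OF diff[OF that] assms(1) that Suc.prems(1)])
  have "h differentiable (at x)" if x: "x \<in> S" for x
  proof -
    have "(f has_derivative frechet_derivative f (at x)) (at x)"
      using diff[OF x] frechet_derivative_works by blast
    then have "(h has_derivative frechet_derivative f (at x)) (at x)"
      by (rule has_derivative_transform_within_open[OF _ assms(1) x Suc.prems(1)])
    then show ?thesis unfolding differentiable_def by blast
  qed
  moreover have "Ck_on k S (\<lambda>x. frechet_derivative h (at x) v)" for v
    by (rule Suc.IH[of "\<lambda>x. frechet_derivative f (at x) v"]) (use fd Suc.prems in auto)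
  ultimately show ?case by simp
qed

lemma smooth_on_cong:
  assumes "open S" "\<And>x. x \<in> S \<Longrightarrow> f x = h x" "smooth_on S f"
  shows "smooth_on S h"
  unfolding smooth_on_def
proof
  fix k
  have "Ck_on k S f" using assms(3) by (simp add: smooth_on_def)
  with assms(1,2) show "Ck_on k S h" by (rule Ck_on_cong)
qed

lemma smooth_on_snd:
  assumes "open S" "smooth_on S f" shows "smooth_on S (\<lambda>x. snd (f x))"
proof -
  have "Ck_on k S (\<lambda>x. snd (f x))" if "Ck_on k S f" for k
    using that
  proof (induction k arbitrary: f)
    case 0
    then show ?case by (auto intro: continuous_intros)
  next
    case (Suc k)
    have D: "(f has_derivative frechet_derivative f (at x)) (at x)" if "x \<in> S" for x
      using Suc.prems that frechet_derivative_works by auto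
    have D2: "((\<lambda>x. snd (f x)) has_derivative (\<lambda>v. snd (frechet_derivative f (at x) v))) (at x)" if "x \<in> S" for x
      by (rule has_derivative_snd[OF D[OF that]])
    have fd: "snd (frechet_derivative f (at x) v) = frechet_derivative (\<lambda>x. snd (f x)) (at x) v" if "x \<in> S" for x v
      using fun_cong[OF frechet_derivative_at[OF D2[OF that]]] by simp
    have "Ck_on k S (\<lambda>x. frechet_derivative (\<lambda>x. snd (f x)) (at x) v)" for v
      by (rule Ck_on_cong[OF assms(1) fd]) (use Suc in auto)
    moreover have "(\<lambda>x. snd (f x)) differentiable (at x)" if "x \<in> S" for x
      using D2[OF that] unfolding differentiable_def by blast
    ultimately show ?case by simp
  qed
  with assms(2) show ?thesis unfolding smooth_on_def by blast
qed

section \<open>Lipschitz continuity and uniqueness for ordinary differential equations\<close>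

text \<open>A pointwise notion is convenient because it is closed under sums, products and composition with
  no bookkeeping of domains.\<close>
definition lip_at :: "('a::metric_space \<Rightarrow> 'b::metric_space) \<Rightarrow> 'a \<Rightarrow> bool" where
  "lip_at f x \<longleftrightarrow> (\<exists>r>0. \<exists>L. L-lipschitz_on (ball x r) f)"

lemma lip_atI:
  assumes "r > 0" "\<And>y z. y \<in> ball x r \<Longrightarrow> z \<in> ball x r \<Longrightarrow> dist (f y) (f z) \<le> L * dist y z"
  shows "lip_at f x"
proof -
  have "\<bar>L\<bar>-lipschitz_on (ball x r) f"
  proof (rule lipschitz_onI)
    fix y z assume "y \<in> ball x r" "z \<in> ball x r"
    then have "dist (f y) (f z) \<le> L * dist y z" by (rule assms)
    also have "\<dots> \<le> \<bar>L\<bar> * dist y z" by (intro mult_right_mono) auto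
    finally show "dist (f y) (f z) \<le> \<bar>L\<bar> * dist y z" .
  qed auto
  then show ?thesis using assms(1) unfolding lip_at_def by blast
qed

lemma lip_atE:
  assumes "lip_at f x" "d > 0"
  obtains r L where "0 < r" "r \<le> d" "L > 0" "L-lipschitz_on (ball x r) f"
proof -
  from assms obtain r L where "r > 0" and L: "L-lipschitz_on (ball x r) f"
    unfolding lip_at_def by blast
  from L have "(max L 1)-lipschitz_on (ball x (min d r)) f"
    by (rule lipschitz_on_mono) auto
  then show ?thesis using that[of "min d r" "max L 1"] assms \<open>r > 0\<close> by auto
qed

lemma lip_at_const: "lip_at (\<lambda>_. c) x"
  by (rule lip_atI[of 1 _ _ 0]) auto

lemma lip_at_add:
  fixes f g :: "'a::metric_space \<Rightarrow> 'b::real_normed_vector"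
  assumes "lip_at f x" "lip_at g x"
  shows "lip_at (\<lambda>y. f y + g y) x"
proof -
  obtain r1 L1 where 1: "0 < r1" "r1 \<le> 1" "L1 > 0"
     "L1-lipschitz_on (ball x r1) f"
    by (rule lip_atE[OF assms(1) zero_less_one])
  obtain r2 L2 where 2: "0 < r2" "r2 \<le> r1" "L2 > 0"
     "L2-lipschitz_on (ball x r2) g"
    by (rule lip_atE[OF assms(2) 1(1)])
  show ?thesis
  proof (rule lip_atI[OF 2(1), of _ _ "L1 + L2"])
    fix y z assume yz: "y \<in> ball x r2" "z \<in> ball x r2"
    have "dist (f y + g y) (f z + g z) \<le> dist (f y) (f z) + dist (g y) (g z)"
      by (simp add: dist_triangle_add)
    also have "\<dots> \<le> L1 * dist y z + L2 * dist y z"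
      using yz 2(2) by (intro add_mono lipschitz_onD[OF 1(4)] lipschitz_onD[OF 2(4)]) auto
    finally show "dist (f y + g y) (f z + g z) \<le> (L1 + L2) * dist y z" by (simp add: algebra_simps)
  qed
qed

lemma lip_at_sum:
  fixes f :: "'i \<Rightarrow> 'a::metric_space \<Rightarrow> 'b::real_normed_vector"
  assumes "\<And>i. i \<in> I \<Longrightarrow> lip_at (f i) x"
  shows "lip_at (\<lambda>y. \<Sum>i\<in>I. f i y) x"
  using assms by (induction I rule: infinite_finite_induct) (auto intro: lip_at_const lip_at_add)

lemma lip_at_scaleR:
  fixes f :: "'a::metric_space \<Rightarrow> real" and g :: "'a \<Rightarrow> 'b::real_normed_vector"
  assumes "lip_at f x" "lip_at g x"
  shows "lip_at (\<lambda>y. f y *\<^sub>R g y) x"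
proof -
  obtain r1 L1 where 1: "0 < r1" "r1 \<le> 1" "L1 > 0"
     "L1-lipschitz_on (ball x r1) f"
    by (rule lip_atE[OF assms(1) zero_less_one])
  obtain r2 L2 where 2: "0 < r2" "r2 \<le> r1" "L2 > 0"
     "L2-lipschitz_on (ball x r2) g"
    by (rule lip_atE[OF assms(2) 1(1)])
  define M1 where "M1 = \<bar>f x\<bar> + L1"
  define M2 where "M2 = norm (g x) + L2"
  have M1: "\<bar>f y\<bar> \<le> M1" if "y \<in> ball x r2" for y
  proof -
    have "\<bar>f y\<bar> \<le> \<bar>f x\<bar> + dist (f x) (f y)" by (auto simp: dist_real_def)
    also have "dist (f x) (f y) \<le> L1 * dist x y" using that 2 1 by (intro lipschitz_onD[OF 1(4)]) auto
    also have "\<dots> \<le> L1 * 1" using that 1 2 by (intro mult_left_mono) auto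
    finally show ?thesis by (simp add: M1_def)
  qed
  have M2: "norm (g y) \<le> M2" if "y \<in> ball x r2" for y
  proof -
    have "norm (g y) \<le> norm (g x) + dist (g x) (g y)"
      by (metis dist_norm norm_minus_commute norm_triangle_sub)
    also have "dist (g x) (g y) \<le> L2 * dist x y" using that 2 1 by (intro lipschitz_onD[OF 2(4)]) auto
    also have "\<dots> \<le> L2 * 1" using that 1 2 by (intro mult_left_mono) auto
    finally show ?thesis by (simp add: M2_def)
  qed
  show ?thesis
  proof (rule lip_atI[OF 2(1), of _ _ "L1 * M2 + M1 * L2"])
    fix y z assume yz: "y \<in> ball x r2" "z \<in> ball x r2"
    have "f y *\<^sub>R g y - f z *\<^sub>R g z = (f y - f z) *\<^sub>R g y + f z *\<^sub>R (g y - g z)"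
      by (simp add: algebra_simps)
    then have "dist (f y *\<^sub>R g y) (f z *\<^sub>R g z) \<le> norm ((f y - f z) *\<^sub>R g y) + norm (f z *\<^sub>R (g y - g z))"
      by (metis dist_norm norm_triangle_ineq)
    also have "\<dots> = dist (f y) (f z) * norm (g y) + \<bar>f z\<bar> * dist (g y) (g z)"
      by (simp add: dist_norm)
    also have "\<dots> \<le> (L1 * dist y z) * M2 + M1 * (L2 * dist y z)"
      using yz 1 2 M1[OF yz(2)] M2[OF yz(1)] lipschitz_onD[OF 1(4), of y z] lipschitz_onD[OF 2(4), of y z]
      by (intro add_mono mult_mono) auto
    finally show "dist (f y *\<^sub>R g y) (f z *\<^sub>R g z) \<le> (L1 * M2 + M1 * L2) * dist y z"
      by (simp add: algebra_simps)
  qed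
qed

lemma lip_at_bounded_linear:
  assumes "bounded_linear f" shows "lip_at f x"
proof -
  from bounded_linear.bounded[OF assms] obtain K where "\<And>x. norm (f x) \<le> norm x * K" by auto
  then show ?thesis
    by (intro lip_atI[of 1 _ _ K])
      (auto simp: dist_norm linear_diff[OF bounded_linear.linear[OF assms], symmetric] mult.commute)
qed

lemma lip_at_compose:
  assumes f: "lip_at f (g x)" and g: "lip_at g x"
  shows "lip_at (\<lambda>y. f (g y)) x"
proof -
  obtain r1 L1 where 1: "0 < r1" "r1 \<le> 1" "L1 > 0"
     "L1-lipschitz_on (ball (g x) r1) f"
    by (rule lip_atE[OF f zero_less_one])
  obtain r2 L2 where 2: "0 < r2" "r2 \<le> 1" "L2 > 0"
     "L2-lipschitz_on (ball x r2) g"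
    by (rule lip_atE[OF g zero_less_one])
  show ?thesis
  proof (rule lip_atI[of "min r2 (r1 / L2)" _ _ "L1 * L2"])
    have in1: "g y \<in> ball (g x) r1" if "y \<in> ball x (min r2 (r1 / L2))" for y
    proof -
      have "dist (g x) (g y) \<le> L2 * dist x y" using that 2 by (intro lipschitz_onD[OF 2(4)]) auto
      also have "\<dots> < L2 * (r1 / L2)" using that 2 by (intro mult_strict_left_mono) auto
      finally show ?thesis using 2 by simp
    qed
    fix y z assume yz: "y \<in> ball x (min r2 (r1 / L2))" "z \<in> ball x (min r2 (r1 / L2))"
    have "dist (f (g y)) (f (g z)) \<le> L1 * dist (g y) (g z)" using yz in1 by (intro lipschitz_onD[OF 1(4)]) auto
    also have "\<dots> \<le> L1 * (L2 * dist y z)" using yz 1 by (intro mult_left_mono lipschitz_onD[OF 2(4)]) auto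
    finally show "dist (f (g y)) (f (g z)) \<le> L1 * L2 * dist y z" by (simp add: mult.assoc)
  qed (use 1 2 in auto)
qed

text \<open>The directional derivatives along a basis are bounded on a compact ball, and they bound the
  operator norm of the differential.\<close>
lemma smooth_on_imp_lip_at:
  fixes f :: "'a::euclidean_space \<Rightarrow> 'b::euclidean_space"
  assumes f: "smooth_on S f" and S: "open S" "x \<in> S"
  shows "lip_at f x"
proof -
  obtain r where r: "r > 0" "cball x r \<subseteq> S" using S open_contains_cball by blast
  let ?D = "\<lambda>y. frechet_derivative f (at y)"
  have "\<exists>M. \<forall>y\<in>cball x r. norm (?D y b) \<le> M" for b
  proof -
    have "compact ((\<lambda>y. ?D y b) ` cball x r)"
      using smooth_on_imp_continuous_on[OF smooth_on_frechet_derivative[OF f]] r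
      by (intro compact_continuous_image) (auto intro: continuous_on_subset)
    then have "bounded ((\<lambda>y. ?D y b) ` cball x r)" by (rule compact_imp_bounded)
    then show ?thesis by (simp add: bounded_iff)
  qed
  then obtain M where M: "\<And>b y. y \<in> cball x r \<Longrightarrow> norm (?D y b) \<le> M b" by metis
  define L where "L = (\<Sum>b\<in>Basis. M b)"
  have D: "(f has_derivative ?D y) (at y)" if "y \<in> S" for y
    using smooth_on_imp_differentiable[OF f that] frechet_derivative_works by blast
  have "onorm (?D y) \<le> L" if y: "y \<in> cball x r" for y
  proof (rule onorm_bound)
    have l: "linear (?D y)" using y r by (intro has_derivative_linear[OF D]) auto
    show Lp: "0 \<le> L" unfolding L_def by (intro sum_nonneg order_trans[OF norm_ge_zero M[OF y]])
    fix v
    have "?D y v = (\<Sum>b\<in>Basis. (v \<bullet> b) *\<^sub>R ?D y b)" by (rule linear_Basis_expansion[OF l])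
    also have "norm \<dots> \<le> (\<Sum>b\<in>Basis. norm v * M b)"
      using M[OF y] by (intro sum_norm_le) (auto intro!: mult_mono Basis_le_norm)
    finally show "norm (?D y v) \<le> L * norm v" by (simp add: L_def sum_distrib_left mult.commute)
  qed
  then have "norm (f y - f z) \<le> L * norm (y - z)" if "y \<in> cball x r" "z \<in> cball x r" for y z
    using that D r
    by (intro differentiable_bound[of "cball x r" f ?D] has_derivative_at_withinI[OF D]) auto
  then show ?thesis using r by (intro lip_atI[of r _ _ L]) (auto simp: dist_norm)
qed

lemma lip_at_cong:
  assumes "lip_at f x" "open S" "x \<in> S" "\<And>y. y \<in> S \<Longrightarrow> f y = h y"
  shows "lip_at h x"
proof -
  obtain d where d: "d > 0" "ball x d \<subseteq> S" using assms(2,3) open_contains_ball by blast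
  obtain r L where r: "0 < r" "r \<le> d" "L > 0" "L-lipschitz_on (ball x r) f"
    by (rule lip_atE[OF assms(1) d(1)])
  show ?thesis
  proof (rule lip_atI[OF r(1), of _ _ L])
    fix y z assume yz: "y \<in> ball x r" "z \<in> ball x r"
    then have "y \<in> S" "z \<in> S" using r d by auto
    then show "dist (h y) (h z) \<le> L * dist y z"
      using lipschitz_onD[OF r(4) yz] assms(4) by simp
  qed
qed

lemma lip_at_linear_family:
  fixes L :: "'a::metric_space \<Rightarrow> 'b::euclidean_space \<Rightarrow> 'c::real_normed_vector"
  assumes lin: "\<And>y. y \<in> S \<Longrightarrow> linear (L y)" and S: "open S" "x \<in> S"
    and L: "\<And>v. lip_at (\<lambda>y. L y v) x" and q: "lip_at q x"
  shows "lip_at (\<lambda>y. L y (q y)) x"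
proof -
  have "lip_at (\<lambda>y. \<Sum>b\<in>Basis. (q y \<bullet> b) *\<^sub>R L y b) x"
    by (intro lip_at_sum lip_at_scaleR L lip_at_compose[OF lip_at_bounded_linear q] bounded_linear_inner_left)
  then show ?thesis
  proof (rule lip_at_cong[OF _ S])
    fix y assume "y \<in> S"
    from linear_Basis_expansion[OF lin[OF this], of "q y"]
    show "(\<Sum>b\<in>Basis. (q y \<bullet> b) *\<^sub>R L y b) = L y (q y)" by simp
  qed
qed

text \<open>Near \<open>x\<close> the operators \<open>M y\<close> are close to the identity, so their inverses are
  bounded; freezing one solution turns the difference of two solutions into a right hand side.  This replaces
  differentiability of matrix inversion.  Normalising \<open>M x\<close> to the identity is no loss, as a
  left inverse of \<open>M x\<close> may be applied first.\<close>
lemma lip_at_linear_system: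
  fixes Z :: "'a::metric_space \<Rightarrow> 'b::euclidean_space" and M :: "'a \<Rightarrow> 'b \<Rightarrow> 'b"
  assumes S: "open S" "x \<in> S"
    and lin: "\<And>y. y \<in> S \<Longrightarrow> linear (M y)"
    and Mid: "\<And>z. M x z = z"
    and M: "\<And>b. lip_at (\<lambda>y. M y b) x"
    and k: "lip_at k x"
    and sol: "\<And>y. y \<in> S \<Longrightarrow> M y (Z y) = k y"
  shows "lip_at Z x"
proof -
  have "\<exists>r L. r > 0 \<and> L-lipschitz_on (ball x r) (\<lambda>y. M y b)" for b
    using M[of b] unfolding lip_at_def by blast
  then obtain \<rho> L where L: "\<And>b. \<rho> b > 0" "\<And>b. (L b)-lipschitz_on (ball x (\<rho> b)) (\<lambda>y. M y b)"
    by metis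
  obtain s where s: "s > 0" "ball x s \<subseteq> S" using S open_contains_ball by blast
  define r0 where "r0 = min s (Min (\<rho> ` Basis))"
  have r0: "r0 > 0" "\<And>b. b \<in> Basis \<Longrightarrow> r0 \<le> \<rho> b" "ball x r0 \<subseteq> S"
    using s L(1) by (auto simp: r0_def min_le_iff_disj subset_eq)
  obtain r1 Lk where r1: "0 < r1" "r1 \<le> r0" "Lk > 0"
     "Lk-lipschitz_on (ball x r1) k"
    by (rule lip_atE[OF k r0(1)])
  define L' where "L' = (\<Sum>b\<in>Basis. \<bar>L b\<bar>) + 1"
  have L': "L' > 0" unfolding L'_def by (simp add: add_nonneg_pos sum_nonneg)
  define r where "r = min r1 (1 / (2 * L'))"
  have r: "r > 0" "r \<le> r1" "L' * r \<le> 1/2" using L' r1 by (auto simp: r_def min_def field_simps)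
  have diff: "norm (M y v - M z v) \<le> L' * dist y z * norm v"
    if "y \<in> ball x r" "z \<in> ball x r" for y z v
  proof -
    have yz0: "y \<in> ball x r0" "z \<in> ball x r0" using that r r1 by auto
    then have yz: "y \<in> S" "z \<in> S" using r0 by auto
    note repr = linear_Basis_expansion[OF lin]
    have "M y v - M z v = (\<Sum>b\<in>Basis. (v \<bullet> b) *\<^sub>R (M y b - M z b))"
      by (simp add: repr[OF yz(1), of v] repr[OF yz(2), of v] sum_subtractf scaleR_diff_right)
    also have "norm \<dots> \<le> (\<Sum>b\<in>Basis. norm v * (\<bar>L b\<bar> * dist y z))"
    proof (rule sum_norm_le)
      fix b :: 'b assume b: "b \<in> Basis"
      have "norm (M y b - M z b) \<le> L b * dist y z" using lipschitz_onD[OF L(2)[of b], of y z] yz0 r0(2)[OF b] by (auto simp: dist_norm)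
      also have "\<dots> \<le> \<bar>L b\<bar> * dist y z" by (intro mult_right_mono) auto
      finally show "norm ((v \<bullet> b) *\<^sub>R (M y b - M z b)) \<le> norm v * (\<bar>L b\<bar> * dist y z)"
        using Basis_le_norm[OF b] by (auto intro!: mult_mono)
    qed
    also have "\<dots> = (\<Sum>b\<in>(Basis::'b set). \<bar>L b\<bar>) * dist y z * norm v"
      by (simp add: sum_distrib_left sum_distrib_right mult_ac)
    also have "\<dots> \<le> L' * dist y z * norm v"
      by (intro mult_right_mono) (auto simp: L'_def)
    finally show ?thesis .
  qed
  have low: "norm v \<le> 2 * norm (M y v)" if y: "y \<in> ball x r" for y v
  proof -
    have "norm (M x v - M y v) \<le> L' * dist x y * norm v" using y r by (intro diff) auto
    also have "\<dots> \<le> L' * r * norm v" using y L' by (intro mult_right_mono mult_left_mono) auto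
    also have "\<dots> \<le> 1/2 * norm v" using r by (intro mult_right_mono) auto
    finally show ?thesis using Mid[of v] norm_triangle_sub[of v "M y v"] by simp
  qed
  define B where "B = 2 * (norm (k x) + Lk * r)"
  have inS: "y \<in> S" if "y \<in> ball x r" for y using that r r1 r0(3) by auto
  have Zbd: "norm (Z y) \<le> B" if y: "y \<in> ball x r" for y
  proof -
    have "dist (k y) (k x) \<le> Lk * dist y x" using y r r1 by (intro lipschitz_onD[OF r1(4)]) auto
    also have "\<dots> \<le> Lk * r" using y r1 by (intro mult_left_mono) (auto simp: dist_commute)
    finally have "norm (k y) \<le> norm (k x) + Lk * r"
      using norm_triangle_sub[of "k y" "k x"] by (simp add: dist_norm)
    then show ?thesis using low[OF y, of "Z y"] by (simp add: sol[OF inS[OF y]] B_def)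
  qed
  show ?thesis
  proof (rule lip_atI[OF r(1), of _ _ "2 * (Lk + L' * B)"])
    fix y z assume yz: "y \<in> ball x r" "z \<in> ball x r"
    have "norm (Z y - Z z) \<le> 2 * norm (M y (Z y - Z z))" by (rule low[OF yz(1)])
    also have "M y (Z y - Z z) = (k y - k z) + (M z (Z z) - M y (Z z))"
      by (simp add: linear_diff[OF lin[OF inS[OF yz(1)]]] sol[OF inS[OF yz(1)]] sol[OF inS[OF yz(2)]])
    also have "norm \<dots> \<le> Lk * dist y z + L' * dist z y * norm (Z z)"
      using lipschitz_onD[OF r1(4), of y z] diff[OF yz(2,1), of "Z z"] yz r
      by (intro order_trans[OF norm_triangle_ineq] add_mono) (auto simp: dist_norm)
    also have "\<dots> \<le> Lk * dist y z + L' * dist z y * B"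
      using Zbd[OF yz(2)] L' by (intro add_left_mono mult_left_mono) auto
    finally show "dist (Z y) (Z z) \<le> 2 * (Lk + L' * B) * dist y z"
      by (simp add: dist_norm dist_commute algebra_simps norm_minus_commute)
  qed
qed

text \<open>On an interval shorter than the inverse Lipschitz constant, the mean value theorem bounds the largest
  value of \<open>|z1 - z2|\<close> by half of itself.\<close>
lemma ode_unique_local:
  fixes f :: "'a::real_normed_vector \<Rightarrow> 'a" and z1 z2 :: "real \<Rightarrow> 'a"
  assumes f: "lip_at f (z1 t0)" and init: "z1 t0 = z2 t0" and I: "open I" "t0 \<in> I"
    and z1: "\<And>t. t \<in> I \<Longrightarrow> (z1 has_vector_derivative f (z1 t)) (at t)"
    and z2: "\<And>t. t \<in> I \<Longrightarrow> (z2 has_vector_derivative f (z2 t)) (at t)"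
  shows "\<exists>d>0. \<forall>t. \<bar>t - t0\<bar> < d \<longrightarrow> z1 t = z2 t"
proof -
  obtain r L where r: "0 < r" "r \<le> 1" "L > 0"
     "L-lipschitz_on (ball (z1 t0) r) f"
    by (rule lip_atE[OF f zero_less_one])
  have "isCont z1 t0" "isCont z2 t0"
    using z1 z2 I has_vector_derivative_continuous by blast+
  then have "\<forall>\<^sub>F t in nhds t0. dist (z1 t) (z1 t0) < r" "\<forall>\<^sub>F t in nhds t0. dist (z2 t) (z2 t0) < r"
    using r(1) by (auto simp: isCont_def tendsto_iff eventually_nhds_conv_at)
  moreover have "\<forall>\<^sub>F t in nhds t0. t \<in> I" using I by (simp add: eventually_nhds_in_open)
  ultimately have "\<forall>\<^sub>F t in nhds t0. t \<in> I \<and> z1 t \<in> ball (z1 t0) r \<and> z2 t \<in> ball (z1 t0) r"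
    by eventually_elim (auto simp: init dist_commute)
  then obtain e where e: "e > 0" "\<And>t. dist t t0 < e \<Longrightarrow> t \<in> I \<and> z1 t \<in> ball (z1 t0) r \<and> z2 t \<in> ball (z1 t0) r"
    unfolding eventually_nhds_metric by auto
  define d where "d = min (e / 2) (1 / (2 * L))"
  have d: "d > 0" "d < e" "L * d \<le> 1/2" using e r by (auto simp: d_def min_def field_simps)
  define J where "J = cball t0 d"
  have J: "t \<in> I" "z1 t \<in> ball (z1 t0) r" "z2 t \<in> ball (z1 t0) r" if "t \<in> J" for t
    using e(2)[of t] that d by (auto simp: J_def dist_commute)
  define h where "h = (\<lambda>t. z1 t - z2 t)"
  have dh: "(h has_vector_derivative (f (z1 t) - f (z2 t))) (at t)" if "t \<in> J" for t
    unfolding h_def using J[OF that] by (auto intro!: derivative_eq_intros z1 z2)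
  have "compact J" "J \<noteq> {}" using d by (auto simp: J_def)
  moreover have "continuous_on J (\<lambda>t. norm (h t))"
    by (intro continuous_on_norm continuous_at_imp_continuous_on ballI)
      (rule has_vector_derivative_continuous[OF dh])
  ultimately have "\<exists>s\<in>J. \<forall>t\<in>J. norm (h t) \<le> norm (h s)"
    by (rule continuous_attains_sup)
  then obtain s where s: "s \<in> J" "\<And>t. t \<in> J \<Longrightarrow> norm (h t) \<le> norm (h s)"
    by blast
  have "norm (h s - h t0) \<le> (L * norm (h s)) * norm (s - t0)"
  proof (rule differentiable_bound[of J h "\<lambda>t r. r *\<^sub>R (f (z1 t) - f (z2 t))"])
    fix t assume t: "t \<in> J"
    show "(h has_derivative (\<lambda>r. r *\<^sub>R (f (z1 t) - f (z2 t)))) (at t within J)"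
      using dh[OF t] by (simp add: has_vector_derivative_def has_derivative_at_withinI)
    have "norm (f (z1 t) - f (z2 t)) \<le> L * norm (h t)"
      using lipschitz_onD[OF r(4), of "z1 t" "z2 t"] J[OF t] by (simp add: dist_norm h_def)
    also have "\<dots> \<le> L * norm (h s)" using s t r by (intro mult_left_mono) auto
    finally show "onorm (\<lambda>r. r *\<^sub>R (f (z1 t) - f (z2 t))) \<le> L * norm (h s)"
      by (simp add: onorm_scaleR_left bounded_linear_ident onorm_id)
  qed (use s d in \<open>auto simp: J_def\<close>)
  also have "\<dots> \<le> (L * norm (h s)) * d"
    using s(1) r by (intro mult_left_mono) (auto simp: J_def dist_norm norm_minus_commute)
  also have "\<dots> = (L * d) * norm (h s)" by simp
  also have "\<dots> \<le> 1/2 * norm (h s)" using d by (intro mult_right_mono) auto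
  finally have "norm (h s) = 0" using init by (simp add: h_def)
  then have "\<forall>t\<in>J. h t = 0" using s(2) by fastforce
  then show ?thesis using d by (intro exI[of _ d]) (auto simp: J_def h_def dist_real_def)
qed

section \<open>Charts and tangent vectors\<close>

locale smooth_manifold =
  fixes A :: "('m::t2_space, 'n::finite) atlas"
  assumes atlas: "smooth_atlas A"
begin

lemma open_dom: "c \<in> A \<Longrightarrow> open (ch_dom c)"
  and homeo: "c \<in> A \<Longrightarrow> homeomorphism (ch_dom c) (ch_map c ` ch_dom c) (ch_map c) (ch_inv c)"
  and open_chart_image: "c \<in> A \<Longrightarrow> open (ch_map c ` ch_dom c)"
  and transition_smooth: "c \<in> A \<Longrightarrow> d \<in> A \<Longrightarrow>
    smooth_on (ch_map c ` (ch_dom c \<inter> ch_dom d)) (ch_map d \<circ> ch_inv c)"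
  using atlas unfolding smooth_atlas_def by blast+

lemma chart_around: obtains c where "c \<in> A" "x \<in> ch_dom c"
  using atlas unfolding smooth_atlas_def by (metis UNIV_I UN_iff)

lemma pref: "pref A x \<in> A" "x \<in> ch_dom (pref A x)"
proof -
  have "\<exists>c. c \<in> A \<and> x \<in> ch_dom c" using chart_around by metis
  then have "pref A x \<in> A \<and> x \<in> ch_dom (pref A x)" unfolding pref_def by (rule someI_ex)
  then show "pref A x \<in> A" "x \<in> ch_dom (pref A x)" by auto
qed

lemma inv_map [simp]: "c \<in> A \<Longrightarrow> x \<in> ch_dom c \<Longrightarrow> ch_inv c (ch_map c x) = x"
  using homeo by (meson homeomorphism_apply1)

lemma map_inv [simp]: "c \<in> A \<Longrightarrow> y \<in> ch_map c ` ch_dom c \<Longrightarrow> ch_map c (ch_inv c y) = y"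
  using homeo by (meson homeomorphism_apply2)

lemma inv_in_dom [simp]: "c \<in> A \<Longrightarrow> y \<in> ch_map c ` ch_dom c \<Longrightarrow> ch_inv c y \<in> ch_dom c"
  by (rule inv_into_into)

lemma open_image:
  assumes c: "c \<in> A" and S: "open S"
  shows "open (ch_map c ` (S \<inter> ch_dom c))"
proof -
  have "openin (top_of_set (ch_dom c)) (S \<inter> ch_dom c)"
    using S open_dom[OF c] by (metis Int_commute openin_open_Int)
  then have "openin (top_of_set (ch_map c ` ch_dom c)) (ch_map c ` (S \<inter> ch_dom c))"
    using homeo[OF c] homeomorphism_imp_open_map by blast
  then show ?thesis using open_chart_image[OF c] openin_open_trans by blast
qed

lemma isCont_chart: "c \<in> A \<Longrightarrow> x \<in> ch_dom c \<Longrightarrow> isCont (ch_map c) x"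
  using homeo[of c] open_dom[of c] by (simp add: homeomorphism_def continuous_on_eq_continuous_at)

lemma isCont_chart_inv: "c \<in> A \<Longrightarrow> x \<in> ch_dom c \<Longrightarrow> isCont (ch_inv c) (ch_map c x)"
  using homeo[of c] open_chart_image[of c] by (simp add: homeomorphism_def continuous_on_eq_continuous_at)

text \<open>Transition maps of tangent vectors satisfy the cocycle law, so the components of a
  tangent vector in the various charts determine each other; the preferred charts disappear behind
  \<open>tcoord\<close> and \<open>tvec\<close>.\<close>
lemma transition_derivative:
  assumes "c \<in> A" "d \<in> A" "x \<in> ch_dom c" "x \<in> ch_dom d"
  shows "((ch_map d \<circ> ch_inv c) has_derivative tchange c d x) (at (ch_map c x))"
  using smooth_on_imp_differentiable[OF transition_smooth, of c d "ch_map c x"] assms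
  unfolding tchange_def by (auto simp: frechet_derivative_works)

lemma tchange_linear:
  "c \<in> A \<Longrightarrow> d \<in> A \<Longrightarrow> x \<in> ch_dom c \<Longrightarrow> x \<in> ch_dom d \<Longrightarrow> linear (tchange c d x)"
  by (rule has_derivative_linear[OF transition_derivative])

lemma tchange_tchange:
  assumes "c \<in> A" "d \<in> A" "b \<in> A" "x \<in> ch_dom c" "x \<in> ch_dom d" "x \<in> ch_dom b"
  shows "tchange d b x (tchange c d x v) = tchange c b x v"
proof -
  have "((ch_map b \<circ> ch_inv d) \<circ> (ch_map d \<circ> ch_inv c) has_derivative tchange d b x \<circ> tchange c d x) (at (ch_map c x))"
    using transition_derivative[of c d x] transition_derivative[of d b x] assms
    by (intro diff_chain_at) auto
  then have "((ch_map b \<circ> ch_inv c) has_derivative tchange d b x \<circ> tchange c d x) (at (ch_map c x))"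
    by (rule has_derivative_transform_within_open[OF _ open_image[OF assms(1) open_dom[OF assms(2)]]])
      (use assms in auto)
  from has_derivative_unique[OF this transition_derivative[of c b x]] assms show ?thesis
    by (auto dest: fun_cong)
qed

lemma tchange_same:
  assumes "c \<in> A" "x \<in> ch_dom c" shows "tchange c c x v = v"
proof -
  have "((\<lambda>y. y) has_derivative (\<lambda>v. v)) (at (ch_map c x))" by (rule has_derivative_ident)
  then have "((ch_map c \<circ> ch_inv c) has_derivative (\<lambda>v. v)) (at (ch_map c x))"
    by (rule has_derivative_transform_within_open[OF _ open_chart_image[OF assms(1)]]) (use assms in auto)
  from has_derivative_unique[OF this transition_derivative[of c c x]] assms
  have "(\<lambda>v. v) = tchange c c x" by simp
  from fun_cong[OF this, of v] show ?thesis by simp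
qed

lemma tcoord_linear: "c \<in> A \<Longrightarrow> x \<in> ch_dom c \<Longrightarrow> linear (tcoord A c x)"
  unfolding tcoord_def by (rule tchange_linear) (simp_all add: pref)

lemma tvec_linear: "c \<in> A \<Longrightarrow> x \<in> ch_dom c \<Longrightarrow> linear (tvec A c x)"
  unfolding tvec_def by (rule tchange_linear) (simp_all add: pref)

lemma tvec_tcoord [simp]: "c \<in> A \<Longrightarrow> x \<in> ch_dom c \<Longrightarrow> tvec A c x (tcoord A c x v) = v"
  unfolding tvec_def tcoord_def by (simp add: tchange_tchange tchange_same pref)

lemma tcoord_tvec [simp]: "c \<in> A \<Longrightarrow> x \<in> ch_dom c \<Longrightarrow> tcoord A c x (tvec A c x u) = u"
  unfolding tvec_def tcoord_def by (simp add: tchange_tchange tchange_same pref)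

lemma tchange_tcoord:
  "c \<in> A \<Longrightarrow> d \<in> A \<Longrightarrow> x \<in> ch_dom c \<Longrightarrow> x \<in> ch_dom d \<Longrightarrow> tchange c d x (tcoord A c x v) = tcoord A d x v"
  unfolding tcoord_def by (simp add: tchange_tchange pref)

lemma tcoord_pref [simp]: "tcoord A (pref A x) x v = v"
  unfolding tcoord_def by (simp add: tchange_same pref)

lemma tcoord_inject:
  assumes "c \<in> A" "x \<in> ch_dom c" shows "tcoord A c x v = tcoord A c x w \<longleftrightarrow> v = w"
proof
  assume "tcoord A c x v = tcoord A c x w"
  then have "tvec A c x (tcoord A c x v) = tvec A c x (tcoord A c x w)" by (rule arg_cong)
  then show "v = w" using assms by simp
qed simp

lemmas tcoord_0 [simp] = linear_0[OF tcoord_linear]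
lemmas tcoord_scaleR = linear_cmul[OF tcoord_linear]

lemma has_velocityD:
  "has_velocity A \<gamma> v t \<Longrightarrow> c \<in> A \<Longrightarrow> \<gamma> t \<in> ch_dom c \<Longrightarrow>
     ((\<lambda>s. ch_map c (\<gamma> s)) has_vector_derivative tcoord A c (\<gamma> t) v) (at t)"
  and has_velocity_isCont: "has_velocity A \<gamma> v t \<Longrightarrow> isCont \<gamma> t"
  by (auto simp: has_velocity_def)

lemma isCont_eventually_in:
  "isCont \<gamma> t \<Longrightarrow> open S \<Longrightarrow> \<gamma> t \<in> S \<Longrightarrow> eventually (\<lambda>s. \<gamma> s \<in> S) (nhds t)"
  for \<gamma> :: "real \<Rightarrow> 'm"
  unfolding continuous_at_open eventually_nhds by blast

lemma has_velocity_unique: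
  assumes "has_velocity A \<gamma> v t" "has_velocity A \<gamma> w t" shows "v = w"
  using vector_derivative_unique_at[OF has_velocityD[OF assms(1) pref] has_velocityD[OF assms(2) pref]]
  by simp

lemma has_vector_derivative_chart_change:
  assumes cont: "isCont \<gamma> t" and c: "c \<in> A" "\<gamma> t \<in> ch_dom c" and d: "d \<in> A" "\<gamma> t \<in> ch_dom d"
    and der: "((\<lambda>s. ch_map c (\<gamma> s)) has_vector_derivative u) (at t)"
  shows "((\<lambda>s. ch_map d (\<gamma> s)) has_vector_derivative tchange c d (\<gamma> t) u) (at t)"
proof -
  have *: "((ch_map d \<circ> ch_inv c) \<circ> (\<lambda>s. ch_map c (\<gamma> s)) has_vector_derivative tchange c d (\<gamma> t) u) (at t)"
    by (rule vector_derivative_diff_chain_within[OF der has_derivative_at_withinI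
        [OF transition_derivative[OF c(1) d(1) c(2) d(2)]]])
  have "eventually (\<lambda>s. \<gamma> s \<in> ch_dom c) (nhds t)"
    by (rule isCont_eventually_in[OF cont open_dom[OF c(1)] c(2)])
  then have "eventually (\<lambda>s. ((ch_map d \<circ> ch_inv c) \<circ> (\<lambda>s. ch_map c (\<gamma> s))) s = ch_map d (\<gamma> s)) (nhds t)"
    by eventually_elim (simp add: c)
  then show ?thesis by (rule has_vector_derivative_eventually_cong[OF *])
qed

lemma has_velocity_chartI:
  assumes "isCont \<gamma> t" "c \<in> A" "\<gamma> t \<in> ch_dom c"
    and "((\<lambda>s. ch_map c (\<gamma> s)) has_vector_derivative u) (at t)"
  shows "has_velocity A \<gamma> (tvec A c (\<gamma> t) u) t"
  unfolding has_velocity_def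
proof (intro conjI ballI impI assms)
  fix d assume d: "d \<in> A" "\<gamma> t \<in> ch_dom d"
  have "tchange c d (\<gamma> t) u = tcoord A d (\<gamma> t) (tvec A c (\<gamma> t) u)"
    using tchange_tcoord[OF assms(2) d(1) assms(3) d(2), of "tvec A c (\<gamma> t) u"] assms by simp
  then show "((\<lambda>s. ch_map d (\<gamma> s)) has_vector_derivative tcoord A d (\<gamma> t) (tvec A c (\<gamma> t) u)) (at t)"
    using has_vector_derivative_chart_change[OF assms(1-3) d assms(4)] by simp
qed

lemma isCont_of_chart:
  assumes "c \<in> A" "eventually (\<lambda>s. \<gamma> s \<in> ch_dom c) (nhds t)" "isCont (\<lambda>s. ch_map c (\<gamma> s)) t"
  shows "isCont \<gamma> t"
proof -
  have t: "\<gamma> t \<in> ch_dom c" using assms(2) by (rule eventually_nhds_x_imp_x)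
  have "isCont (\<lambda>s. ch_inv c (ch_map c (\<gamma> s))) t"
    using isCont_o2[OF assms(3) isCont_chart_inv[OF assms(1) t]] .
  moreover have "eventually (\<lambda>s. ch_inv c (ch_map c (\<gamma> s)) = \<gamma> s) (nhds t)"
    using assms(2) by eventually_elim (use assms(1) in simp)
  ultimately show ?thesis by (simp add: isCont_cong)
qed

lemma has_velocity_cong:
  assumes "has_velocity A \<gamma> v t" "eventually (\<lambda>s. \<gamma> s = \<delta> s) (nhds t)"
  shows "has_velocity A \<delta> v t"
proof -
  have t: "\<gamma> t = \<delta> t" using assms(2) by (rule eventually_nhds_x_imp_x)
  have "isCont \<delta> t" using has_velocity_isCont[OF assms(1)] isCont_cong[OF assms(2)] by blast
  have "((\<lambda>s. ch_map c (\<delta> s)) has_vector_derivative tcoord A c (\<delta> t) v) (at t)"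
    if c: "c \<in> A" "\<delta> t \<in> ch_dom c" for c
  proof -
    have "((\<lambda>s. ch_map c (\<gamma> s)) has_vector_derivative tcoord A c (\<delta> t) v) (at t)"
      using has_velocityD[OF assms(1) c(1)] c(2) by (simp add: t)
    moreover have "eventually (\<lambda>s. ch_map c (\<gamma> s) = ch_map c (\<delta> s)) (nhds t)"
      using assms(2) by eventually_elim simp
    ultimately show ?thesis by (rule has_vector_derivative_eventually_cong)
  qed
  with \<open>isCont \<delta> t\<close> show ?thesis unfolding has_velocity_def by blast
qed

lemma has_velocity_affine:
  assumes "has_velocity A \<gamma> v (a + b * t)"
  shows "has_velocity A (\<lambda>t. \<gamma> (a + b * t)) (b *\<^sub>R v) t"
  unfolding has_velocity_def
proof (intro conjI ballI impI)
  have "((\<lambda>t. a + b * t) has_real_derivative b) (at t)"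
    by (auto intro!: derivative_eq_intros)
  then have lin: "((\<lambda>t. a + b * t) has_vector_derivative b) (at t)"
    by (simp add: has_real_derivative_iff_has_vector_derivative)
  show "isCont (\<lambda>t. \<gamma> (a + b * t)) t"
    by (rule isCont_o2[where g = \<gamma> and f = "\<lambda>t. a + b * t"])
      (use has_velocity_isCont[OF assms] in \<open>auto intro!: continuous_intros\<close>)
  fix c assume c: "c \<in> A" "\<gamma> (a + b * t) \<in> ch_dom c"
  have "((\<lambda>s. ch_map c (\<gamma> s)) \<circ> (\<lambda>t. a + b * t) has_vector_derivative
      b *\<^sub>R tcoord A c (\<gamma> (a + b * t)) v) (at t)"
    by (rule vector_diff_chain_at[OF lin has_velocityD[OF assms c]])
  then show "((\<lambda>s. ch_map c (\<gamma> (a + b * s))) has_vector_derivative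
      tcoord A c (\<gamma> (a + b * t)) (b *\<^sub>R v)) (at t)"
    by (simp add: o_def tcoord_scaleR c)
qed

end

section \<open>Lorentz metrics in charts\<close>

locale lorentz_manifold = smooth_manifold A
  for A :: "('m::t2_space, 'n::finite) atlas" +
  fixes g :: "('m, 'n) metric"
  assumes lorentz: "lorentz_metric A g"
begin

abbreviation "G \<equiv> metric_coord A g"
abbreviation "DG c y a u v \<equiv> frechet_derivative (\<lambda>y'. metric_coord A g c y' u v) (at y) a"
abbreviation "\<Gamma> \<equiv> christoffel A g"

lemma g_bilinear: "bilinear (g x)" and g_sym: "g x u v = g x v u"
  using lorentz unfolding lorentz_metric_def by blast+

lemmas g_simps = bilinear_ladd[OF g_bilinear] bilinear_radd[OF g_bilinear]
  bilinear_lmul[OF g_bilinear] bilinear_rmul[OF g_bilinear]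
  bilinear_lzero[OF g_bilinear] bilinear_rzero[OF g_bilinear]
  bilinear_lneg[OF g_bilinear] bilinear_rneg[OF g_bilinear]
  bilinear_lsub[OF g_bilinear] bilinear_rsub[OF g_bilinear]

lemma normal_form:
  "\<exists>L :: 'n model \<Rightarrow> 'n model. linear L \<and> surj L \<and>
     (\<forall>p q. g x (L p) (L q) = - (fst p * fst q) + snd p \<bullet> snd q)"
proof -
  from lorentz obtain L :: "'n model \<Rightarrow> 'n model" where "linear L" "bij L"
    "\<forall>s t u v. g x (L (s, u)) (L (t, v)) = - (s * t) + u \<bullet> v"
    unfolding lorentz_metric_def by blast
  then show ?thesis by (intro exI[of _ L]) (auto simp: bij_is_surj)
qed

lemma g_nondegenerate:
  assumes "\<And>w. g x z w = 0" shows "z = 0"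
proof -
  obtain L :: "'n model \<Rightarrow> 'n model" where L: "linear L" "surj L"
    "\<And>p q. g x (L p) (L q) = - (fst p * fst q) + snd p \<bullet> snd q"
    using normal_form[of x] by blast
  obtain p where z: "z = L p" using L(2) by (rule surjE)
  have "g x z (L (- fst p, snd p)) = fst p * fst p + snd p \<bullet> snd p" by (simp add: z L(3))
  then have "fst p * fst p + snd p \<bullet> snd p = 0" using assms by simp
  then have "fst p = 0 \<and> snd p = 0" by (simp add: add_nonneg_eq_0_iff)
  then have "p = 0" by (simp add: prod_eq_iff)
  then show ?thesis by (simp add: z linear_0[OF L(1)])
qed

text \<open>In a normal form of \<open>g\<close>, orthogonality to the timelike vector \<open>(s, u)\<close> reads
  \<open>t s = z \<bullet> u\<close>.  As \<open>|u| < |s|\<close>, the Cauchy-Schwarz inequality forces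
  \<open>|t| < |z|\<close>.\<close>
lemma orthogonal_timelike_pos:
  assumes e: "g x e e < 0" and w: "g x w e = 0" and "w \<noteq> 0"
  shows "g x w w > 0"
proof -
  obtain L :: "'n model \<Rightarrow> 'n model" where L: "linear L" "surj L"
    "\<And>p q. g x (L p) (L q) = - (fst p * fst q) + snd p \<bullet> snd q"
    using normal_form[of x] by blast
  obtain s u where eL: "e = L (s, u)" using L(2) by (metis surjD surj_pair)
  obtain t z where wL: "w = L (t, z)" using L(2) by (metis surjD surj_pair)
  have 1: "(norm u)\<^sup>2 < s\<^sup>2" using e by (simp add: eL L(3) power2_eq_square dot_square_norm)
  have 2: "t * s = z \<bullet> u" using w by (simp add: eL wL L(3))
  have s: "s \<noteq> 0" using 1 by auto
  have "z \<noteq> 0"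
  proof
    assume "z = 0"
    then have "t = 0" using 2 s by simp
    then show False using \<open>w \<noteq> 0\<close> \<open>z = 0\<close> by (simp add: wL linear_0[OF L(1)] zero_prod_def[symmetric])
  qed
  have "t\<^sup>2 * s\<^sup>2 = (z \<bullet> u)\<^sup>2" using 2 by (simp add: power_mult_distrib[symmetric])
  also have "\<dots> \<le> (norm z)\<^sup>2 * (norm u)\<^sup>2" using Cauchy_Schwarz_ineq[of z u] by (simp add: dot_square_norm)
  also have "\<dots> < (norm z)\<^sup>2 * s\<^sup>2" using 1 \<open>z \<noteq> 0\<close> by (intro mult_strict_left_mono) auto
  finally have "t\<^sup>2 < (norm z)\<^sup>2" by (rule mult_right_less_imp_less) simp
  then show ?thesis by (simp add: wL L(3) power2_eq_square[symmetric] dot_square_norm)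
qed

lemma G_tcoord [simp]:
  "c \<in> A \<Longrightarrow> x \<in> ch_dom c \<Longrightarrow> G c (ch_map c x) (tcoord A c x u) (tcoord A c x v) = g x u v"
  by (simp add: metric_coord_def)

lemma G_smooth: "c \<in> A \<Longrightarrow> smooth_on (ch_map c ` ch_dom c) (\<lambda>y. G c y u v)"
  using lorentz unfolding lorentz_metric_def by blast

lemma G_bilinear:
  assumes "c \<in> A" "y \<in> ch_map c ` ch_dom c" shows "bilinear (G c y)"
proof -
  have l: "linear (tvec A c (ch_inv c y))" using assms by (intro tvec_linear) auto
  show ?thesis
    unfolding bilinear_def metric_coord_def Let_def
    by (intro conjI allI linearI) (simp_all only: linear_add[OF l] linear_cmul[OF l] g_simps real_scaleR_def)
qed

lemma G_sym: "G c y u v = G c y v u"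
  by (simp add: metric_coord_def g_sym)

lemma G_nondegenerate:
  assumes "c \<in> A" "y \<in> ch_map c ` ch_dom c" "\<And>w. G c y z w = 0"
  shows "z = 0"
proof -
  have "g (ch_inv c y) (tvec A c (ch_inv c y) z) w = 0" for w
    using assms(3)[of "tcoord A c (ch_inv c y) w"] assms(1,2) by (simp add: metric_coord_def Let_def)
  then have "tvec A c (ch_inv c y) z = 0" by (rule g_nondegenerate)
  then show ?thesis using assms(1,2) by (metis inv_in_dom tcoord_0 tcoord_tvec)
qed

lemma G_differentiable:
  "c \<in> A \<Longrightarrow> y \<in> ch_map c ` ch_dom c \<Longrightarrow> (\<lambda>y. G c y u v) differentiable (at y)"
  by (rule smooth_on_imp_differentiable[OF G_smooth])

lemma DG_sym: "DG c y a u v = DG c y a v u"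
  by (simp only: G_sym[of c _ u v])

lemma DG_linear:
  assumes c: "c \<in> A" and y: "y \<in> ch_map c ` ch_dom c"
  shows "linear (\<lambda>a. DG c y a u v)" "linear (\<lambda>u. DG c y a u v)" "linear (\<lambda>v. DG c y a u v)"
proof -
  have D: "((\<lambda>y. G c y u v) has_derivative (\<lambda>a. DG c y a u v)) (at y)" for u v
    using G_differentiable[OF c y] frechet_derivative_works by blast
  show "linear (\<lambda>a. DG c y a u v)" using D has_derivative_linear by blast
  have add: "DG c y a (u + u') v = DG c y a u v + DG c y a u' v" for u u' v a
  proof -
    have "((\<lambda>y. G c y u v + G c y u' v) has_derivative (\<lambda>a. DG c y a u v + DG c y a u' v)) (at y)"
      by (intro has_derivative_add D)
    then have "((\<lambda>y. G c y (u + u') v) has_derivative (\<lambda>a. DG c y a u v + DG c y a u' v)) (at y)"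
      by (rule has_derivative_transform_within_open[OF _ open_chart_image[OF c] y])
        (simp add: bilinear_ladd[OF G_bilinear[OF c]])
    from has_derivative_unique[OF D this] show ?thesis by (rule fun_cong)
  qed
  have mul: "DG c y a (r *\<^sub>R u) v = r * DG c y a u v" for r u v a
  proof -
    have "((\<lambda>y. r * G c y u v) has_derivative (\<lambda>a. r * DG c y a u v)) (at y)"
      by (intro has_derivative_mult_right D)
    then have "((\<lambda>y. G c y (r *\<^sub>R u) v) has_derivative (\<lambda>a. r * DG c y a u v)) (at y)"
      by (rule has_derivative_transform_within_open[OF _ open_chart_image[OF c] y])
        (simp add: bilinear_lmul[OF G_bilinear[OF c]])
    from has_derivative_unique[OF D this] show ?thesis by (rule fun_cong)
  qed
  show l: "linear (\<lambda>u. DG c y a u v)" for u v by (intro linearI) (auto simp: add mul)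
  have "(\<lambda>v. DG c y a u v) = (\<lambda>v. DG c y a v u)" by (rule ext) (rule DG_sym)
  then show "linear (\<lambda>v. DG c y a u v)" using l by simp
qed

text \<open>Riesz representation with respect to the metric; it provides the solution of the Koszul formula.\<close>
lemma G_riesz:
  assumes c: "c \<in> A" and y: "y \<in> ch_map c ` ch_dom c" and K: "linear K"
  shows "\<exists>!z. \<forall>w. G c y z w = K w"
proof -
  note bil = G_bilinear[OF c y]
  define T where "T = (\<lambda>z. \<Sum>b\<in>Basis. G c y z b *\<^sub>R b)"
  have T: "linear T"
    unfolding T_def
    by (intro linearI)
      (auto simp: bilinear_ladd[OF bil] bilinear_lmul[OF bil] scaleR_add_left sum.distrib scaleR_sum_right)
  have TI: "T z \<bullet> w = G c y z w" for z w
  proof -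
    have "linear (G c y z)" using bil unfolding bilinear_def by blast
    from linear_Basis_expansion[OF this, of w]
    have "G c y z w = (\<Sum>b\<in>Basis. (w \<bullet> b) * G c y z b)" by simp
    also have "\<dots> = T z \<bullet> w"
      unfolding T_def inner_sum_left by (intro sum.cong refl) (simp add: inner_commute)
    finally show ?thesis by simp
  qed
  have "inj T"
    unfolding linear_injective_0[OF T]
  proof (intro allI impI)
    fix z assume "T z = 0"
    then have "G c y z w = 0" for w using TI[of z w] by simp
    then show "z = 0" by (rule G_nondegenerate[OF c y])
  qed
  then have "surj T" by (rule linear_injective_imp_surjective[OF T]) simp
  then obtain z where z: "adjoint K 1 = T z" by (rule surjE)
  have Kz: "G c y z w = K w" for w
    using adjoint_works[OF K, of w 1] by (simp add: TI[symmetric] z inner_commute)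
  have "z' = z" if "\<forall>w. G c y z' w = K w" for z'
  proof -
    have "z' - z = 0"
      by (rule G_nondegenerate[OF c y]) (use that Kz in \<open>simp add: bilinear_lsub[OF bil]\<close>)
    then show ?thesis by simp
  qed
  with Kz show ?thesis by blast
qed

lemma christoffel_koszul:
  assumes c: "c \<in> A" and y: "y \<in> ch_map c ` ch_dom c"
  shows "2 * G c y (\<Gamma> c y u v) w = DG c y u v w + DG c y v u w - DG c y w u v"
    and christoffel_eqI: "(\<And>w. 2 * G c y z w = DG c y u v w + DG c y v u w - DG c y w u v) \<Longrightarrow>
      \<Gamma> c y u v = z"
proof -
  define K where "K = (\<lambda>w. (DG c y u v w + DG c y v u w - DG c y w u v) / 2)"
  have "linear K"
    unfolding K_def
    by (intro linearI)
      (simp_all add: linear_add[OF DG_linear(1)[OF c y]] linear_cmul[OF DG_linear(1)[OF c y]]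
        linear_add[OF DG_linear(3)[OF c y]] linear_cmul[OF DG_linear(3)[OF c y]] algebra_simps add_divide_distrib diff_divide_distrib)
  from G_riesz[OF c y this] have ex: "\<exists>!z. \<forall>w. G c y z w = K w" .
  have \<Gamma>: "\<Gamma> c y u v = (THE z. \<forall>w. G c y z w = K w)"
    unfolding christoffel_def K_def by (rule arg_cong[where f = The]) (auto simp: fun_eq_iff field_simps)
  from theI'[OF ex] have *: "\<forall>w. G c y (\<Gamma> c y u v) w = K w" unfolding \<Gamma> .
  from *[rule_format, of w] show "2 * G c y (\<Gamma> c y u v) w = DG c y u v w + DG c y v u w - DG c y w u v"
    by (simp add: K_def)
  assume z: "\<And>w. 2 * G c y z w = DG c y u v w + DG c y v u w - DG c y w u v"
  have "G c y z w = K w" for w unfolding K_def z[of w, symmetric] by simp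
  then have "\<forall>w. G c y z w = K w" ..
  then show "\<Gamma> c y u v = z" unfolding \<Gamma> by (rule the1_equality[OF ex])
qed

lemma DG_scale:
  assumes c: "c \<in> A" and y: "y \<in> ch_map c ` ch_dom c"
  shows "DG c y (r *\<^sub>R a) u v = r * DG c y a u v"
    and "DG c y a (r *\<^sub>R u) v = r * DG c y a u v"
    and "DG c y a u (r *\<^sub>R v) = r * DG c y a u v"
  by (simp_all only: linear_cmul[OF DG_linear(1)[OF c y]] linear_cmul[OF DG_linear(2)[OF c y]]
      linear_cmul[OF DG_linear(3)[OF c y]] real_scaleR_def)

lemma christoffel_scale:
  assumes c: "c \<in> A" and y: "y \<in> ch_map c ` ch_dom c"
  shows "\<Gamma> c y (a *\<^sub>R u) (b *\<^sub>R v) = (a * b) *\<^sub>R \<Gamma> c y u v"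
proof (rule christoffel_eqI[OF c y])
  fix w
  have "2 * G c y ((a * b) *\<^sub>R \<Gamma> c y u v) w = a * b * (2 * G c y (\<Gamma> c y u v) w)"
    by (simp add: bilinear_lmul[OF G_bilinear[OF c y]])
  then show "2 * G c y ((a * b) *\<^sub>R \<Gamma> c y u v) w =
    DG c y (a *\<^sub>R u) (b *\<^sub>R v) w + DG c y (b *\<^sub>R v) (a *\<^sub>R u) w - DG c y w (a *\<^sub>R u) (b *\<^sub>R v)"
    unfolding christoffel_koszul[OF c y] DG_scale[OF c y] by (simp add: algebra_simps)
qed

end

section \<open>Geodesics\<close>

context lorentz_manifold
begin

text \<open>A geodesic together with its velocity field, which \<open>geodesic_on\<close> hides in an existential
  quantifier.\<close>
definition geodesic_curve :: "real set \<Rightarrow> (real \<Rightarrow> 'm) \<Rightarrow> (real \<Rightarrow> 'n model) \<Rightarrow> bool" where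
  "geodesic_curve I \<gamma> V \<longleftrightarrow> open I \<and> is_interval I \<and>
     (\<forall>t\<in>I. has_velocity A \<gamma> (V t) t) \<and> parallel_along A g \<gamma> I V"

lemma geodesic_from_iff:
  "geodesic_from A g q v I \<gamma> \<longleftrightarrow> 0 \<in> I \<and> \<gamma> 0 = q \<and> (\<exists>V. geodesic_curve I \<gamma> V \<and> V 0 = v)"
proof
  assume *: "geodesic_from A g q v I \<gamma>"
  then obtain V where "geodesic_curve I \<gamma> V"
    unfolding geodesic_from_def geodesic_on_def geodesic_curve_def by blast
  moreover from this * have "V 0 = v"
    unfolding geodesic_from_def geodesic_curve_def using has_velocity_unique by blast
  ultimately show "0 \<in> I \<and> \<gamma> 0 = q \<and> (\<exists>V. geodesic_curve I \<gamma> V \<and> V 0 = v)"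
    using * unfolding geodesic_from_def by blast
next
  assume "0 \<in> I \<and> \<gamma> 0 = q \<and> (\<exists>V. geodesic_curve I \<gamma> V \<and> V 0 = v)"
  then show "geodesic_from A g q v I \<gamma>"
    unfolding geodesic_from_def geodesic_on_def geodesic_curve_def by blast
qed

lemma geodesic_curve_velocity:
  "geodesic_curve I \<gamma> V \<Longrightarrow> t \<in> I \<Longrightarrow> has_velocity A \<gamma> (V t) t"
  by (simp add: geodesic_curve_def)

lemma geodesic_curve_in_chart:
  "geodesic_curve I \<gamma> V \<Longrightarrow> t \<in> I \<Longrightarrow> c \<in> A \<Longrightarrow> \<gamma> t \<in> ch_dom c \<Longrightarrow>
    eventually (\<lambda>s. \<gamma> s \<in> ch_dom c) (nhds t)"
  by (rule isCont_eventually_in[OF has_velocity_isCont[OF geodesic_curve_velocity] open_dom])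

lemma geodesic_curve_interval: "geodesic_curve I \<gamma> V \<Longrightarrow> 0 \<in> I \<Longrightarrow> 1 \<in> I \<Longrightarrow> {0..1} \<subseteq> I"
  unfolding geodesic_curve_def is_interval_1 by (meson atLeastAtMost_iff subsetI)

lemma has_cov_derivD:
  assumes "has_cov_deriv A g \<gamma> Y Z t" "has_velocity A \<gamma> v t" "c \<in> A" "\<gamma> t \<in> ch_dom c"
  shows "((\<lambda>s. tcoord A c (\<gamma> s) (Y s)) has_vector_derivative
           tcoord A c (\<gamma> t) Z - \<Gamma> c (ch_map c (\<gamma> t)) (tcoord A c (\<gamma> t) v) (tcoord A c (\<gamma> t) (Y t))) (at t)"
proof -
  obtain v' where v': "has_velocity A \<gamma> v' t" "\<forall>c\<in>A. \<gamma> t \<in> ch_dom c \<longrightarrow>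
        ((\<lambda>s. tcoord A c (\<gamma> s) (Y s)) has_vector_derivative
           tcoord A c (\<gamma> t) Z
           - christoffel A g c (ch_map c (\<gamma> t)) (tcoord A c (\<gamma> t) v') (tcoord A c (\<gamma> t) (Y t)))
          (at t)"
    using assms(1) unfolding has_cov_deriv_def by blast
  have "v' = v" by (rule has_velocity_unique[OF v'(1) assms(2)])
  with v'(2) assms(3,4) show ?thesis by blast
qed

lemma geodesic_curve_ode:
  assumes "geodesic_curve I \<gamma> V" "t \<in> I" "c \<in> A" "\<gamma> t \<in> ch_dom c"
  shows "((\<lambda>s. ch_map c (\<gamma> s)) has_vector_derivative tcoord A c (\<gamma> t) (V t)) (at t)"
    and "((\<lambda>s. tcoord A c (\<gamma> s) (V s)) has_vector_derivative
           - \<Gamma> c (ch_map c (\<gamma> t)) (tcoord A c (\<gamma> t) (V t)) (tcoord A c (\<gamma> t) (V t))) (at t)"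
proof -
  have v: "has_velocity A \<gamma> (V t) t" by (rule geodesic_curve_velocity[OF assms(1,2)])
  show "((\<lambda>s. ch_map c (\<gamma> s)) has_vector_derivative tcoord A c (\<gamma> t) (V t)) (at t)"
    by (rule has_velocityD[OF v assms(3,4)])
  have "has_cov_deriv A g \<gamma> V 0 t"
    using assms(1,2) unfolding geodesic_curve_def parallel_along_def by blast
  from has_cov_derivD[OF this v assms(3,4)]
  show "((\<lambda>s. tcoord A c (\<gamma> s) (V s)) has_vector_derivative
           - \<Gamma> c (ch_map c (\<gamma> t)) (tcoord A c (\<gamma> t) (V t)) (tcoord A c (\<gamma> t) (V t))) (at t)"
    using assms(3,4) by simp
qed

text \<open>Existence of geodesics is always part of the hypotheses, through the domain of the exponential
  map; affine reparametrisation supplies rescaled and reversed geodesics from these.\<close>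
lemma geodesic_curve_affine:
  assumes "geodesic_curve I \<gamma> V"
  shows "geodesic_curve ((\<lambda>t. a + b * t) -` I) (\<lambda>t. \<gamma> (a + b * t)) (\<lambda>t. b *\<^sub>R V (a + b * t))"
proof -
  let ?h = "\<lambda>t. a + b * t"
  have I: "open I" "is_interval I" using assms by (auto simp: geodesic_curve_def)
  have "open (?h -` I)" by (intro open_vimage I continuous_intros)
  moreover have "is_interval (?h -` I)"
    unfolding is_interval_1
  proof (intro ballI allI impI)
    fix s t x assume "s \<in> ?h -` I" "t \<in> ?h -` I" and x: "s \<le> x \<and> x \<le> t"
    then have st: "?h s \<in> I" "?h t \<in> I" by auto
    have "?h x \<in> I"
    proof (cases "b \<ge> 0")
      case True
      then have "?h s \<le> ?h x" "?h x \<le> ?h t" using x by (auto intro: mult_left_mono)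
      then show ?thesis using I(2) st unfolding is_interval_1 by blast
    next
      case False
      then have "?h t \<le> ?h x" "?h x \<le> ?h s" using x by (auto intro: mult_left_mono_neg)
      then show ?thesis using I(2) st unfolding is_interval_1 by blast
    qed
    then show "x \<in> ?h -` I" by simp
  qed
  moreover have vel: "has_velocity A (\<lambda>t. \<gamma> (?h t)) (b *\<^sub>R V (?h t)) t" if "t \<in> ?h -` I" for t
    using geodesic_curve_velocity[OF assms, of "?h t"] that by (intro has_velocity_affine) auto
  moreover have "has_cov_deriv A g (\<lambda>t. \<gamma> (?h t)) (\<lambda>t. b *\<^sub>R V (?h t)) 0 t" if t: "t \<in> ?h -` I" for t
    unfolding has_cov_deriv_def
  proof (intro exI[of _ "b *\<^sub>R V (?h t)"] conjI vel t ballI impI)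
    fix c assume c: "c \<in> A" "\<gamma> (?h t) \<in> ch_dom c"
    let ?y = "ch_map c (\<gamma> (?h t))" and ?w = "tcoord A c (\<gamma> (?h t)) (V (?h t))"
    have y: "?y \<in> ch_map c ` ch_dom c" using c by blast
    have "(?h has_real_derivative b) (at t)"
      by (auto intro!: derivative_eq_intros)
    then have lin: "(?h has_vector_derivative b) (at t)"
      by (simp add: has_real_derivative_iff_has_vector_derivative)
    have "?h t \<in> I" using t by simp
    from vector_diff_chain_at[OF lin geodesic_curve_ode(2)[OF assms this c]]
    have "((\<lambda>s. tcoord A c (\<gamma> (?h s)) (V (?h s))) has_vector_derivative b *\<^sub>R - \<Gamma> c ?y ?w ?w) (at t)"
      by (simp add: o_def)
    from bounded_linear.has_vector_derivative[OF bounded_linear_scaleR_right this, of b]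
    have *: "((\<lambda>s. b *\<^sub>R tcoord A c (\<gamma> (?h s)) (V (?h s))) has_vector_derivative b *\<^sub>R b *\<^sub>R - \<Gamma> c ?y ?w ?w) (at t)" .
    have "eventually (\<lambda>s. \<gamma> (?h s) \<in> ch_dom c) (nhds t)"
      by (rule isCont_eventually_in[OF has_velocity_isCont[OF vel[OF t]] open_dom[OF c(1)] c(2)])
    then have "eventually (\<lambda>s. b *\<^sub>R tcoord A c (\<gamma> (?h s)) (V (?h s)) = tcoord A c (\<gamma> (?h s)) (b *\<^sub>R V (?h s))) (nhds t)"
      by eventually_elim (simp add: tcoord_scaleR[OF c(1)])
    from has_vector_derivative_eventually_cong[OF * this]
    show "((\<lambda>s. tcoord A c (\<gamma> (?h s)) (b *\<^sub>R V (?h s))) has_vector_derivative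
       tcoord A c (\<gamma> (?h t)) 0 - \<Gamma> c ?y (tcoord A c (\<gamma> (?h t)) (b *\<^sub>R V (?h t))) (tcoord A c (\<gamma> (?h t)) (b *\<^sub>R V (?h t)))) (at t)"
      by (simp add: tcoord_scaleR[OF c] christoffel_scale[OF c(1) y] tcoord_0[OF c])
  qed
  ultimately show ?thesis unfolding geodesic_curve_def parallel_along_def by blast
qed

text \<open>The spray solves the linear system given by the Koszul formula, whose coefficients are
  smooth in the position and quadratic in the velocity.\<close>
lemma spray_lip_at:
  assumes c: "c \<in> A" and y: "y0 \<in> ch_map c ` ch_dom c"
  shows "lip_at (\<lambda>z. \<Gamma> c (fst z) (snd z) (snd z)) (y0, w0)"
proof -
  let ?O = "ch_map c ` ch_dom c"
  define S where "S = ?O \<times> (UNIV :: 'n model set)"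
  have S: "open S" "(y0, w0) \<in> S" unfolding S_def using open_chart_image[OF c] y by (auto intro: open_Times)
  have SO: "fst z \<in> ?O" if "z \<in> S" for z using that by (auto simp: S_def)
  define T where "T = (\<lambda>y z. \<Sum>b\<in>Basis. G c y z b *\<^sub>R b)"
  have T: "linear (T y)" if y: "y \<in> ?O" for y
    unfolding T_def using G_bilinear[OF c y]
    by (intro linearI)
      (auto simp: bilinear_ladd bilinear_lmul scaleR_add_left sum.distrib scaleR_sum_right)
  have "inj (T y0)"
    unfolding linear_injective_0[OF T[OF y]]
  proof (intro allI impI)
    fix z assume "T y0 z = 0"
    then have *: "T y0 z \<bullet> b = 0" for b by simp
    have "G c y0 z b = 0" if "b \<in> Basis" for b
      using *[of b] that unfolding T_def
      by (simp add: inner_sum_left inner_Basis if_distrib[of "\<lambda>x. _ * x"] sum.delta cong: if_cong)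
    moreover have "linear (G c y0 z)" using G_bilinear[OF c y] unfolding bilinear_def by blast
    ultimately have "G c y0 z w = 0" for w
      using linear_eq_0_on_span[of "G c y0 z" Basis w] by (simp add: span_Basis)
    then show "z = 0" by (rule G_nondegenerate[OF c y])
  qed
  then obtain T' where T': "linear T'" "T' \<circ> T y0 = id"
    using linear_injective_left_inverse[OF T[OF y]] by blast
  have T'b: "bounded_linear T'" using T'(1) by (simp add: linear_conv_bounded_linear)
  define K where "K = (\<lambda>b z. DG c (fst z) (snd z) (snd z) b - (1/2) *\<^sub>R DG c (fst z) b (snd z) (snd z))"
  have lfst: "lip_at fst (y0, w0)" and lsnd: "lip_at snd (y0, w0)"
    by (intro lip_at_bounded_linear bounded_linear_fst bounded_linear_snd)+
  have Gl: "lip_at (\<lambda>z. G c (fst z) u v) (y0, w0)" for u v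
    using smooth_on_imp_lip_at[OF G_smooth[OF c] open_chart_image[OF c] y]
    by (intro lip_at_compose[OF _ lfst]) simp
  have DGl: "lip_at (\<lambda>z. DG c (fst z) a u v) (y0, w0)" for a u v
    using smooth_on_imp_lip_at[OF smooth_on_frechet_derivative[OF G_smooth[OF c]] open_chart_image[OF c] y]
    by (intro lip_at_compose[OF _ lfst]) simp
  have 1: "lip_at (\<lambda>z. DG c (fst z) (snd z) u v) (y0, w0)" for u v
    by (rule lip_at_linear_family[OF DG_linear(1)[OF c SO] S DGl lsnd])
  have 2: "lip_at (\<lambda>z. DG c (fst z) (snd z) (snd z) v) (y0, w0)" for v
    by (rule lip_at_linear_family[OF DG_linear(2)[OF c SO] S 1 lsnd])
  have 3: "lip_at (\<lambda>z. DG c (fst z) b (snd z) v) (y0, w0)" for b v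
    by (rule lip_at_linear_family[OF DG_linear(2)[OF c SO] S DGl lsnd])
  have 4: "lip_at (\<lambda>z. DG c (fst z) b (snd z) (snd z)) (y0, w0)" for b
    by (rule lip_at_linear_family[OF DG_linear(3)[OF c SO] S 3 lsnd])
  have "lip_at (\<lambda>z. DG c (fst z) (snd z) (snd z) b + (- 1/2) *\<^sub>R DG c (fst z) b (snd z) (snd z)) (y0, w0)" for b
    by (intro lip_at_add lip_at_scaleR lip_at_const 2 4)
  then have Kl: "lip_at (K b) (y0, w0)" for b by (simp add: K_def)
  show ?thesis
  proof (rule lip_at_linear_system[OF S, of "\<lambda>z v. T' (T (fst z) v)" "\<lambda>z. T' (\<Sum>b\<in>Basis. K b z *\<^sub>R b)"])
    show "linear (\<lambda>v. T' (T (fst z) v))" if "z \<in> S" for z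
      using linear_compose[OF T[OF SO[OF that]] T'(1)] by (simp add: o_def)
    show "T' (T (fst (y0, w0)) z) = z" for z
      using fun_cong[OF T'(2), of z] by simp
    show "lip_at (\<lambda>z. T' (T (fst z) b)) (y0, w0)" for b
      unfolding T_def
      by (intro lip_at_compose[OF lip_at_bounded_linear[OF T'b]] lip_at_sum lip_at_scaleR lip_at_const Gl)
    show "lip_at (\<lambda>z. T' (\<Sum>b\<in>Basis. K b z *\<^sub>R b)) (y0, w0)"
      by (intro lip_at_compose[OF lip_at_bounded_linear[OF T'b]] lip_at_sum lip_at_scaleR lip_at_const Kl)
    show "T' (T (fst z) (\<Gamma> c (fst z) (snd z) (snd z))) = T' (\<Sum>b\<in>Basis. K b z *\<^sub>R b)" if "z \<in> S" for z
    proof -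
      have "G c (fst z) (\<Gamma> c (fst z) (snd z) (snd z)) b = K b z" for b
        using christoffel_koszul[OF c SO[OF that], of "snd z" "snd z" b] by (simp add: K_def)
      then show ?thesis by (simp add: T_def)
    qed
  qed
qed

lemma geodesic_unique_local:
  assumes 1: "geodesic_curve I1 \<gamma>1 V1" "t0 \<in> I1" and 2: "geodesic_curve I2 \<gamma>2 V2" "t0 \<in> I2"
    and eq: "\<gamma>1 t0 = \<gamma>2 t0" "V1 t0 = V2 t0"
  shows "eventually (\<lambda>t. \<gamma>1 t = \<gamma>2 t \<and> V1 t = V2 t) (nhds t0)"
proof -
  obtain c where c: "c \<in> A" "\<gamma>1 t0 \<in> ch_dom c" by (rule chart_around)
  have c2: "\<gamma>2 t0 \<in> ch_dom c" using c eq by simp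
  have "eventually (\<lambda>t. \<gamma>1 t \<in> ch_dom c) (nhds t0)"
    by (rule geodesic_curve_in_chart[OF 1 c])
  moreover have "eventually (\<lambda>t. \<gamma>2 t \<in> ch_dom c) (nhds t0)"
    by (rule geodesic_curve_in_chart[OF 2 c(1) c2])
  moreover have "eventually (\<lambda>t. t \<in> I1) (nhds t0)" "eventually (\<lambda>t. t \<in> I2) (nhds t0)"
    using 1 2 by (auto simp: geodesic_curve_def intro!: eventually_nhds_in_open)
  ultimately have ev: "eventually (\<lambda>t. \<gamma>1 t \<in> ch_dom c \<and> \<gamma>2 t \<in> ch_dom c \<and> t \<in> I1 \<and> t \<in> I2) (nhds t0)"
    by eventually_elim simp
  then obtain J where J: "open J" "t0 \<in> J" "\<And>t. t \<in> J \<Longrightarrow> \<gamma>1 t \<in> ch_dom c \<and> \<gamma>2 t \<in> ch_dom c \<and> t \<in> I1 \<and> t \<in> I2"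
    unfolding eventually_nhds by blast
  define f where "f = (\<lambda>z. (snd z, - \<Gamma> c (fst z) (snd z) (snd z)))"
  define z1 where "z1 = (\<lambda>t. (ch_map c (\<gamma>1 t), tcoord A c (\<gamma>1 t) (V1 t)))"
  define z2 where "z2 = (\<lambda>t. (ch_map c (\<gamma>2 t), tcoord A c (\<gamma>2 t) (V2 t)))"
  have "lip_at (\<lambda>z. \<Gamma> c (fst z) (snd z) (snd z)) (z1 t0)"
    unfolding z1_def using c by (intro spray_lip_at) auto
  then have "lip_at (\<lambda>z. (0, - \<Gamma> c (fst z) (snd z) (snd z)) + (snd z, 0)) (z1 t0)"
    by (intro lip_at_add lip_at_bounded_linear[of "\<lambda>z. (snd z, 0)"]
        lip_at_compose[OF lip_at_bounded_linear[of "\<lambda>y. (0, - y)"]]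
        bounded_linear_Pair bounded_linear_zero bounded_linear_snd bounded_linear_minus bounded_linear_ident)
  then have "lip_at f (z1 t0)" by (simp add: f_def)
  moreover have "z1 t0 = z2 t0" by (simp add: z1_def z2_def eq)
  moreover have "(z1 has_vector_derivative f (z1 t)) (at t)" if "t \<in> J" for t
    unfolding z1_def f_def fst_conv snd_conv using J(3)[OF that]
    by (intro has_vector_derivative_Pair geodesic_curve_ode[OF 1(1) _ c(1)]) auto
  moreover have "(z2 has_vector_derivative f (z2 t)) (at t)" if "t \<in> J" for t
    unfolding z2_def f_def fst_conv snd_conv using J(3)[OF that]
    by (intro has_vector_derivative_Pair geodesic_curve_ode[OF 2(1) _ c(1)]) auto
  ultimately obtain d where d: "d > 0" "\<And>t. \<bar>t - t0\<bar> < d \<Longrightarrow> z1 t = z2 t"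
    using ode_unique_local[of f z1 t0 z2 J] J(1,2) by blast
  then have "eventually (\<lambda>t. z1 t = z2 t) (nhds t0)"
    unfolding eventually_nhds_metric by (auto simp: dist_real_def)
  with ev show ?thesis
  proof eventually_elim
    case (elim t)
    then have "ch_inv c (ch_map c (\<gamma>1 t)) = ch_inv c (ch_map c (\<gamma>2 t))" by (simp add: z1_def z2_def)
    then have "\<gamma>1 t = \<gamma>2 t" using elim c(1) by simp
    moreover have "V1 t = V2 t"
      using elim tcoord_inject[OF c(1), of "\<gamma>1 t" "V1 t" "V2 t"] calculation by (simp add: z1_def z2_def)
    ultimately show ?case by simp
  qed
qed

text \<open>The set of parameters at which position and velocity agree is open by local uniqueness, and
  closed since the manifold is Hausdorff and velocities are continuous in charts.\<close>
lemma geodesic_unique: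
  assumes 1: "geodesic_curve I1 \<gamma>1 V1" and 2: "geodesic_curve I2 \<gamma>2 V2"
    and t0: "t0 \<in> I1" "t0 \<in> I2" and eq: "\<gamma>1 t0 = \<gamma>2 t0" "V1 t0 = V2 t0"
    and t: "t \<in> I1" "t \<in> I2"
  shows "\<gamma>1 t = \<gamma>2 t \<and> V1 t = V2 t"
proof -
  let ?I = "I1 \<inter> I2"
  define E where "E = {t \<in> ?I. \<gamma>1 t = \<gamma>2 t \<and> V1 t = V2 t}"
  have I: "open ?I" "connected ?I"
    using 1 2 by (auto simp: geodesic_curve_def is_interval_connected_1[symmetric] is_interval_Int)
  have ev: "eventually (\<lambda>s. s \<in> ?I) (nhds s)" if "s \<in> ?I" for s
    by (rule eventually_nhds_in_open[OF I(1) that])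
  have "open E"
  proof (subst open_subopen, intro ballI)
    fix s assume s: "s \<in> E"
    then have "eventually (\<lambda>t. \<gamma>1 t = \<gamma>2 t \<and> V1 t = V2 t) (nhds s)"
      by (intro geodesic_unique_local[OF 1 _ 2]) (auto simp: E_def)
    moreover have "eventually (\<lambda>t. t \<in> ?I) (nhds s)" using s by (intro ev) (auto simp: E_def)
    ultimately have "eventually (\<lambda>t. t \<in> E) (nhds s)" by eventually_elim (simp add: E_def)
    then show "\<exists>T. open T \<and> s \<in> T \<and> T \<subseteq> E" unfolding eventually_nhds by blast
  qed
  moreover have "open (?I - E)"
  proof (subst open_subopen, intro ballI)
    fix s assume s: "s \<in> ?I - E"
    then have s1: "s \<in> I1" and s2: "s \<in> I2" by auto
    have c1: "isCont \<gamma>1 s" by (rule has_velocity_isCont[OF geodesic_curve_velocity[OF 1 s1]])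
    have c2: "isCont \<gamma>2 s" by (rule has_velocity_isCont[OF geodesic_curve_velocity[OF 2 s2]])
    have "eventually (\<lambda>t. \<not> (\<gamma>1 t = \<gamma>2 t \<and> V1 t = V2 t)) (nhds s)"
    proof (cases "\<gamma>1 s = \<gamma>2 s")
      case False
      then obtain U1 U2 where U: "open U1" "open U2" "\<gamma>1 s \<in> U1" "\<gamma>2 s \<in> U2" "U1 \<inter> U2 = {}"
        using hausdorff[OF False] by blast
      have "eventually (\<lambda>t. \<gamma>1 t \<in> U1) (nhds s)" by (rule isCont_eventually_in[OF c1 U(1,3)])
      moreover have "eventually (\<lambda>t. \<gamma>2 t \<in> U2) (nhds s)" by (rule isCont_eventually_in[OF c2 U(2,4)])
      ultimately show ?thesis by eventually_elim (use U(5) in auto)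
    next
      case True
      then have V: "V1 s \<noteq> V2 s" using s by (auto simp: E_def)
      obtain c where c: "c \<in> A" "\<gamma>1 s \<in> ch_dom c" by (rule chart_around)
      then have c2: "\<gamma>2 s \<in> ch_dom c" using True by simp
      let ?h = "\<lambda>t. tcoord A c (\<gamma>1 t) (V1 t) - tcoord A c (\<gamma>2 t) (V2 t)"
      have "isCont ?h s"
        using has_vector_derivative_continuous[OF geodesic_curve_ode(2)[OF 1 s1 c]]
          has_vector_derivative_continuous[OF geodesic_curve_ode(2)[OF 2 s2 c(1) c2]]
        by (intro isCont_diff) auto
      moreover have "?h s \<in> - {0}" using V True tcoord_inject[OF c, of "V1 s" "V2 s"] by simp
      ultimately have "\<exists>U. open U \<and> s \<in> U \<and> (\<forall>t\<in>U. ?h t \<in> - {0})"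
        unfolding continuous_at_open by (meson open_Compl closed_singleton)
      then have "eventually (\<lambda>t. ?h t \<noteq> 0) (nhds s)" unfolding eventually_nhds by auto
      then show ?thesis by eventually_elim auto
    qed
    moreover have "eventually (\<lambda>t. t \<in> ?I) (nhds s)" using s by (intro ev) auto
    ultimately have "eventually (\<lambda>t. t \<in> ?I - E) (nhds s)" by eventually_elim (auto simp: E_def)
    then show "\<exists>T. open T \<and> s \<in> T \<and> T \<subseteq> ?I - E" unfolding eventually_nhds by blast
  qed
  ultimately have "E \<inter> ?I = {} \<or> (?I - E) \<inter> ?I = {}"
    by (intro connectedD[OF I(2)]) auto
  moreover have "t0 \<in> E" using t0 eq by (simp add: E_def)
  ultimately have "t \<in> E" using t0 t by blast
  then show ?thesis by (simp add: E_def)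
qed

lemma geod_eq:
  assumes "geodesic_curve I \<gamma> V" "0 \<in> I" "t \<in> I"
  shows "geod A g (\<gamma> 0) (V 0) t = \<gamma> t"
  unfolding geod_def
proof (rule the_equality)
  show "\<exists>I \<gamma>'. geodesic_from A g (\<gamma> 0) (V 0) I \<gamma>' \<and> t \<in> I \<and> \<gamma> t = \<gamma>' t"
    using assms geodesic_from_iff by blast
  fix y assume "\<exists>I \<gamma>'. geodesic_from A g (\<gamma> 0) (V 0) I \<gamma>' \<and> t \<in> I \<and> y = \<gamma>' t"
  then obtain I' \<gamma>' V' where *: "geodesic_curve I' \<gamma>' V'" "0 \<in> I'" "t \<in> I'" "\<gamma>' 0 = \<gamma> 0" "V' 0 = V 0" "y = \<gamma>' t"
    unfolding geodesic_from_iff by blast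
  show "y = \<gamma> t"
    using geodesic_unique[OF *(1) assms(1) *(2) assms(2) *(4,5,3) assms(3)] *(6) by simp
qed

text \<open>Uniqueness makes the definite description in \<open>geod\<close> meaningful, so the exponential map
  follows every given geodesic.  The case \<open>s = 0\<close> is included.\<close>
lemma expmap_scaleR:
  assumes "geodesic_curve I \<gamma> V" "0 \<in> I" "s \<in> I"
  shows "expmap_defined A g (\<gamma> 0) (s *\<^sub>R V 0)" "expmap A g (\<gamma> 0) (s *\<^sub>R V 0) = \<gamma> s"
proof -
  note * = geodesic_curve_affine[OF assms(1), of 0 s]
  have I: "0 \<in> (\<lambda>t. 0 + s * t) -` I" "1 \<in> (\<lambda>t. 0 + s * t) -` I" using assms by auto
  show "expmap A g (\<gamma> 0) (s *\<^sub>R V 0) = \<gamma> s"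
    unfolding expmap_def using geod_eq[OF * I] by simp
  have "geodesic_from A g (\<gamma> 0) (s *\<^sub>R V 0) ((\<lambda>t. 0 + s * t) -` I) (\<lambda>t. \<gamma> (0 + s * t))"
    unfolding geodesic_from_iff by (intro conjI I exI[of _ "\<lambda>t. s *\<^sub>R V (0 + s * t)"] *) simp_all
  then show "expmap_defined A g (\<gamma> 0) (s *\<^sub>R V 0)"
    unfolding expmap_defined_def geod_defined_def using I by blast
qed

lemma expmap_definedE:
  assumes "expmap_defined A g q v"
  obtains I \<gamma> V where "geodesic_curve I \<gamma> V" "0 \<in> I" "1 \<in> I" "\<gamma> 0 = q" "V 0 = v"
  using assms unfolding expmap_defined_def geod_defined_def geodesic_from_iff by blast

text \<open>The Koszul formula with all arguments equal to the velocity cancels the derivative of the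
  energy.\<close>
lemma geodesic_energy_constant:
  assumes \<gamma>: "geodesic_curve I \<gamma> V" and st: "s \<in> I" "t \<in> I"
  shows "g (\<gamma> s) (V s) (V s) = g (\<gamma> t) (V t) (V t)"
proof -
  let ?f = "\<lambda>t. g (\<gamma> t) (V t) (V t)"
  have der: "(?f has_vector_derivative 0) (at t within I)" if t: "t \<in> I" for t
  proof -
    obtain c where c: "c \<in> A" "\<gamma> t \<in> ch_dom c" by (rule chart_around)
    let ?y = "ch_map c (\<gamma> t)" and ?w = "tcoord A c (\<gamma> t) (V t)"
    have y: "?y \<in> ch_map c ` ch_dom c" using c by blast
    note ode = geodesic_curve_ode[OF \<gamma> t c]
    have "((\<lambda>t. G c (ch_map c (\<gamma> t)) (tcoord A c (\<gamma> t) (V t)) (tcoord A c (\<gamma> t) (V t))) has_vector_derivative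
       DG c ?y ?w ?w ?w + G c ?y (- \<Gamma> c ?y ?w ?w) ?w + G c ?y ?w (- \<Gamma> c ?y ?w ?w)) (at t)"
      by (rule has_vector_derivative_bilinear_family[OF G_bilinear[OF c(1)] open_chart_image[OF c(1)] y
          G_differentiable[OF c(1)] ode(1,2,2)])
    also have "DG c ?y ?w ?w ?w + G c ?y (- \<Gamma> c ?y ?w ?w) ?w + G c ?y ?w (- \<Gamma> c ?y ?w ?w) = 0"
      using christoffel_koszul[OF c(1) y, of ?w ?w ?w] G_sym[of c ?y ?w "\<Gamma> c ?y ?w ?w"]
      by (simp add: bilinear_lneg[OF G_bilinear[OF c(1) y]] bilinear_rneg[OF G_bilinear[OF c(1) y]])
    finally have *: "((\<lambda>t. G c (ch_map c (\<gamma> t)) (tcoord A c (\<gamma> t) (V t)) (tcoord A c (\<gamma> t) (V t))) has_vector_derivative 0) (at t)" .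
    have "eventually (\<lambda>t. G c (ch_map c (\<gamma> t)) (tcoord A c (\<gamma> t) (V t)) (tcoord A c (\<gamma> t) (V t)) = ?f t) (nhds t)"
      using geodesic_curve_in_chart[OF \<gamma> t c] by eventually_elim (simp add: c(1))
    then have "(?f has_vector_derivative 0) (at t)"
      by (rule has_vector_derivative_eventually_cong[OF *])
    then show ?thesis by (rule has_vector_derivative_at_within)
  qed
  have "convex I" using \<gamma> by (simp add: geodesic_curve_def is_interval_convex)
  then have "\<exists>k. \<forall>t\<in>I. ?f t = k"
    by (rule has_vector_derivative_zero_constant[OF _ der]) auto
  then show ?thesis using st by auto
qed

end

section \<open>The exponential map of a normal neighbourhood\<close>

context lorentz_manifold
begin

text \<open>The chart of the tangent bundle over a chart of the manifold.\<close>
definition tchart :: "('m, 'n model) chart \<Rightarrow> 'm \<times> 'n model \<Rightarrow> 'n model \<times> 'n model" where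
  "tchart c = (\<lambda>(x, v). (ch_map c x, tcoord A c x v))"

lemma tchart_in_atlas: "c \<in> A \<Longrightarrow> (ch_dom c \<times> UNIV, tchart c) \<in> tangent_atlas A"
  unfolding tangent_atlas_def tchart_def by blast

lemma tchart_inj: "c \<in> A \<Longrightarrow> inj_on (tchart c) (ch_dom c \<times> UNIV)"
proof (rule inj_onI)
  fix p p' assume c: "c \<in> A" and p: "p \<in> ch_dom c \<times> UNIV" "p' \<in> ch_dom c \<times> UNIV" and eq: "tchart c p = tchart c p'"
  obtain x v x' v' where [simp]: "p = (x, v)" "p' = (x', v')" by (cases p, cases p')
  have xd: "x \<in> ch_dom c" "x' \<in> ch_dom c" using p by auto
  have "ch_map c x = ch_map c x'" using eq by (simp add: tchart_def)
  then have "ch_inv c (ch_map c x) = ch_inv c (ch_map c x')" by simp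
  then have x: "x = x'" using xd c by simp
  have "tcoord A c x v = tcoord A c x v'" using eq x by (simp add: tchart_def)
  then show "p = p'" using x tcoord_inject[OF c xd(1)] by simp
qed

lemma tchart_inv:
  "c \<in> A \<Longrightarrow> x \<in> ch_dom c \<Longrightarrow> inv_into (ch_dom c \<times> UNIV) (tchart c) (ch_map c x, tcoord A c x v) = (x, v)"
  using inv_into_f_f[OF tchart_inj, of c "(x, v)"] by (simp add: tchart_def)

lemma prod_chart_in_atlas:
  "a \<in> A \<Longrightarrow> b \<in> A \<Longrightarrow> (ch_dom a \<times> ch_dom b, map_prod (ch_map a) (ch_map b)) \<in> prod_atlas A A"
  unfolding prod_atlas_def by blast

lemma prod_chart_inv:
  assumes "a \<in> A" "b \<in> A" "x \<in> ch_dom a" "y \<in> ch_dom b"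
  shows "inv_into (ch_dom a \<times> ch_dom b) (map_prod (ch_map a) (ch_map b)) (ch_map a x, ch_map b y) = (x, y)"
proof -
  have "inj_on (ch_map c) (ch_dom c)" if "c \<in> A" for c
    by (rule inj_on_inverseI[of _ "ch_inv c"]) (use that in simp)
  then have "inj_on (map_prod (ch_map a) (ch_map b)) (ch_dom a \<times> ch_dom b)"
    using assms by (intro map_prod_inj_on)
  from inv_into_f_f[OF this, of "(x, y)"] assms show ?thesis by simp
qed

lemma smooth_map_onD:
  assumes "smooth_map_on B C S f" "a \<in> B" "b \<in> C"
  shows "open (ch_map a ` {x \<in> S \<inter> ch_dom a. f x \<in> ch_dom b})"
    "smooth_on (ch_map a ` {x \<in> S \<inter> ch_dom a. f x \<in> ch_dom b}) (\<lambda>y. ch_map b (f (ch_inv a y)))"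
  using assms unfolding smooth_map_on_def Let_def by blast+

lemma vector_field_smooth_in_chart:
  assumes X: "smooth_vector_field_on A S X" and c: "c \<in> A"
  shows "open (ch_map c ` (S \<inter> ch_dom c))"
    "smooth_on (ch_map c ` (S \<inter> ch_dom c)) (\<lambda>y. tcoord A c (ch_inv c y) (X (ch_inv c y)))"
proof -
  note * = smooth_map_onD[OF X[unfolded smooth_vector_field_on_def] c tchart_in_atlas[OF c]]
  have eq: "{x \<in> S \<inter> ch_dom c. (x, X x) \<in> ch_dom (ch_dom c \<times> UNIV, tchart c)} = S \<inter> ch_dom c" by auto
  show o: "open (ch_map c ` (S \<inter> ch_dom c))" using *(1) unfolding eq .
  have "smooth_on (ch_map c ` (S \<inter> ch_dom c)) (\<lambda>y. tchart c (ch_inv c y, X (ch_inv c y)))"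
    using *(2) unfolding eq by simp
  from smooth_on_snd[OF o this]
  show "smooth_on (ch_map c ` (S \<inter> ch_dom c)) (\<lambda>y. tcoord A c (ch_inv c y) (X (ch_inv c y)))"
    by (simp add: tchart_def)
qed

end

text \<open>The data hidden in \<open>convex_normal_nbhd\<close>: the star-shaped domain \<open>D\<close> on which the
  exponential map is a diffeomorphism onto \<open>N \<times> N\<close>.\<close>
locale normal_nbhd = lorentz_manifold A g
  for A :: "('m::t2_space, 'n::finite) atlas" and g +
  fixes N :: "'m set" and D :: "('m \<times> 'n model) set"
  assumes N_open: "open N"
    and D_open: "atlas_open (tangent_atlas A) D"
    and D_defined: "(q, v) \<in> D \<Longrightarrow> expmap_defined A g q v"
    and D_star: "(q, v) \<in> D \<Longrightarrow> 0 \<le> s \<Longrightarrow> s \<le> 1 \<Longrightarrow> (q, s *\<^sub>R v) \<in> D"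
    and D_diffeo: "diffeo_between (tangent_atlas A) (prod_atlas A A) D (N \<times> N) (\<lambda>(q, v). (q, expmap A g q v))"
begin

lemma Exp_bij: "bij_betw (\<lambda>(q, v). (q, expmap A g q v)) D (N \<times> N)"
  using D_diffeo unfolding diffeo_between_def by blast

text \<open>The inverse of \<open>(q, v) \<mapsto> (q, exp\<^sub>q v)\<close> only changes the second component.\<close>
definition Log :: "'m \<Rightarrow> 'm \<Rightarrow> 'n model" where
  "Log x y = snd (inv_into D (\<lambda>(q, v). (q, expmap A g q v)) (x, y))"

lemma Exp_inv:
  assumes "x \<in> N" "y \<in> N"
  shows "inv_into D (\<lambda>(q, v). (q, expmap A g q v)) (x, y) = (x, Log x y)"
    and Log_in_D: "(x, Log x y) \<in> D" and expmap_Log: "expmap A g x (Log x y) = y"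
proof -
  let ?E = "\<lambda>(q, v). (q, expmap A g q v)"
  define p where "p = inv_into D ?E (x, y)"
  have im: "(x, y) \<in> ?E ` D" using Exp_bij assms by (simp add: bij_betw_def)
  have "?E p = (x, y)" unfolding p_def by (rule f_inv_into_f[OF im])
  then have 1: "fst p = x" "expmap A g x (snd p) = y" by (auto simp: split_def)
  have "p \<in> D" unfolding p_def by (rule inv_into_into[OF im])
  moreover have "p = (x, Log x y)" using 1(1) unfolding Log_def p_def[symmetric] by (simp add: prod_eq_iff)
  ultimately show "inv_into D ?E (x, y) = (x, Log x y)" "(x, Log x y) \<in> D" "expmap A g x (Log x y) = y"
    using 1 by (auto simp: p_def)
qed

lemma D_base: "(q, v) \<in> D \<Longrightarrow> q \<in> N" and D_exp: "(q, v) \<in> D \<Longrightarrow> expmap A g q v \<in> N"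
  using Exp_bij unfolding bij_betw_def by auto

lemma Log_expmap:
  assumes "(q, v) \<in> D" shows "Log q (expmap A g q v) = v"
proof -
  have "inj_on (\<lambda>(q, v). (q, expmap A g q v)) D" using Exp_bij by (simp add: bij_betw_def)
  from inv_into_f_f[OF this assms] show ?thesis by (simp add: Log_def)
qed

lemma D_chart_open: "c \<in> A \<Longrightarrow> open (tchart c ` (D \<inter> (ch_dom c \<times> UNIV)))"
  using D_open tchart_in_atlas[of c] unfolding atlas_open_def by fastforce

lemma in_D_chart:
  assumes "c \<in> A" "q \<in> ch_dom c"
  shows "(ch_map c q, tcoord A c q v) \<in> tchart c ` (D \<inter> (ch_dom c \<times> UNIV)) \<longleftrightarrow> (q, v) \<in> D"
proof
  assume "(ch_map c q, tcoord A c q v) \<in> tchart c ` (D \<inter> (ch_dom c \<times> UNIV))"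
  then obtain p where p: "p \<in> D" "p \<in> ch_dom c \<times> UNIV" "tchart c (q, v) = tchart c p"
    by (auto simp: tchart_def)
  have "(q, v) = p" by (rule inj_onD[OF tchart_inj[OF assms(1)] p(3)]) (use assms p in auto)
  then show "(q, v) \<in> D" using p by simp
next
  assume "(q, v) \<in> D"
  then have "tchart c (q, v) \<in> tchart c ` (D \<inter> (ch_dom c \<times> UNIV))" using assms by (intro imageI) auto
  then show "(ch_map c q, tcoord A c q v) \<in> tchart c ` (D \<inter> (ch_dom c \<times> UNIV))" by (simp add: tchart_def)
qed

text \<open>The exponential map in charts around the base point and around the end point.\<close>
definition Exp_dom where
  "Exp_dom a b = tchart a ` {p \<in> D. fst p \<in> ch_dom a \<and> expmap A g (fst p) (snd p) \<in> ch_dom b}"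

definition Exp_chart where
  "Exp_chart a b = (\<lambda>(y, w). ch_map b (expmap A g (ch_inv a y) (tvec A a (ch_inv a y) w)))"

lemma Exp_chart_eq:
  "a \<in> A \<Longrightarrow> q \<in> ch_dom a \<Longrightarrow> Exp_chart a b (ch_map a q, tcoord A a q v) = ch_map b (expmap A g q v)"
  by (simp add: Exp_chart_def)

lemma in_Exp_dom:
  assumes "a \<in> A" "q \<in> ch_dom a" "(q, v) \<in> D" "expmap A g q v \<in> ch_dom b"
  shows "(ch_map a q, tcoord A a q v) \<in> Exp_dom a b"
proof -
  have "tchart a (q, v) \<in> Exp_dom a b" unfolding Exp_dom_def using assms by (intro imageI) auto
  then show ?thesis by (simp add: tchart_def)
qed

lemma Exp_domE:
  assumes "a \<in> A" "z \<in> Exp_dom a b"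
  obtains q v where "z = (ch_map a q, tcoord A a q v)" "q \<in> ch_dom a" "(q, v) \<in> D" "expmap A g q v \<in> ch_dom b"
  using assms unfolding Exp_dom_def tchart_def by auto

lemma Exp_chart_smooth:
  assumes a: "a \<in> A" and b: "b \<in> A"
  shows "open (Exp_dom a b)" "smooth_on (Exp_dom a b) (Exp_chart a b)"
proof -
  have "smooth_map_on (tangent_atlas A) (prod_atlas A A) D (\<lambda>(q, v). (q, expmap A g q v))"
    using D_diffeo unfolding diffeo_between_def by blast
  note * = smooth_map_onD[OF this tchart_in_atlas[OF a] prod_chart_in_atlas[OF a b]]
  have eq: "ch_map (ch_dom a \<times> UNIV, tchart a) ` {x \<in> D \<inter> ch_dom (ch_dom a \<times> UNIV, tchart a). (case x of (q, v) \<Rightarrow> (q, expmap A g q v))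
      \<in> ch_dom (ch_dom a \<times> ch_dom b, map_prod (ch_map a) (ch_map b))} = Exp_dom a b"
    unfolding Exp_dom_def by (auto simp: split_def intro!: imageI)
  show o: "open (Exp_dom a b)" using *(1) unfolding eq .
  from smooth_on_snd[OF o *(2)[unfolded eq]] show "smooth_on (Exp_dom a b) (Exp_chart a b)"
  proof (rule smooth_on_cong[OF o, rotated])
    fix z assume "z \<in> Exp_dom a b"
    then obtain q v where z: "z = (ch_map a q, tcoord A a q v)" "q \<in> ch_dom a"
      by (rule Exp_domE[OF a])
    show "snd (ch_map (ch_dom a \<times> ch_dom b, map_prod (ch_map a) (ch_map b))
          (case ch_inv (ch_dom a \<times> UNIV, tchart a) z of (q, v) \<Rightarrow> (q, expmap A g q v))) = Exp_chart a b z"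
      unfolding z(1) fst_conv snd_conv tchart_inv[OF a z(2)] Exp_chart_eq[OF a z(2)] by simp
  qed
qed

definition Log_chart where
  "Log_chart a b = (\<lambda>(y, z). tcoord A a (ch_inv a y) (Log (ch_inv a y) (ch_inv b z)))"

lemma Log_chart_continuous:
  assumes a: "a \<in> A" and b: "b \<in> A" and xy: "x \<in> N" "x \<in> ch_dom a" "y \<in> N" "y \<in> ch_dom b"
  shows "isCont (Log_chart a b) (ch_map a x, ch_map b y)"
proof -
  let ?E = "\<lambda>(q, v). (q, expmap A g q v)"
  let ?ab = "(ch_dom a \<times> ch_dom b, map_prod (ch_map a) (ch_map b))"
  have "smooth_map_on (prod_atlas A A) (tangent_atlas A) (N \<times> N) (inv_into D ?E)"
    using D_diffeo unfolding diffeo_between_def by blast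
  note * = smooth_map_onD[OF this prod_chart_in_atlas[OF a b] tchart_in_atlas[OF a]]
  let ?O = "map_prod (ch_map a) (ch_map b) ` ((N \<inter> ch_dom a) \<times> (N \<inter> ch_dom b))"
  have eq: "ch_map ?ab ` {x \<in> N \<times> N \<inter> ch_dom ?ab. inv_into D ?E x \<in> ch_dom (ch_dom a \<times> UNIV, tchart a)} = ?O"
    unfolding fst_conv snd_conv by (rule arg_cong[where f = "image _"]) (auto simp: Exp_inv)
  have o: "open ?O" using *(1) unfolding eq .
  from smooth_on_snd[OF o *(2)[unfolded eq]] have "smooth_on ?O (Log_chart a b)"
  proof (rule smooth_on_cong[OF o, rotated])
    fix z assume "z \<in> ?O"
    then obtain x y where z: "z = (ch_map a x, ch_map b y)" "x \<in> N" "x \<in> ch_dom a" "y \<in> N" "y \<in> ch_dom b"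
      by auto
    show "snd (ch_map (ch_dom a \<times> UNIV, tchart a) (inv_into D ?E (ch_inv ?ab z))) = Log_chart a b z"
      unfolding z(1) fst_conv snd_conv prod_chart_inv[OF a b z(3,5)] Exp_inv[OF z(2,4)]
      using a b z by (simp add: tchart_def Log_chart_def)
  qed
  then have "continuous_on ?O (Log_chart a b)" by (rule smooth_on_imp_continuous_on)
  then have "\<forall>p\<in>?O. isCont (Log_chart a b) p" by (simp only: continuous_on_eq_continuous_at[OF o])
  moreover have "(ch_map a x, ch_map b y) \<in> ?O" using xy by force
  ultimately show ?thesis by (rule bspec)
qed

lemma Log_chart_eq:
  "a \<in> A \<Longrightarrow> b \<in> A \<Longrightarrow> x \<in> ch_dom a \<Longrightarrow> y \<in> ch_dom b \<Longrightarrow>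
    Log_chart a b (ch_map a x, ch_map b y) = tcoord A a x (Log x y)"
  by (simp add: Log_chart_def)

text \<open>A geodesic that stays in \<open>N\<close> is a ray of the exponential map inside \<open>D\<close>.  The parameters for
  which this holds form an open set because \<open>D\<close> is open, and a closed one because there the
  continuous vector \<open>Log\<close> of the end point agrees with the multiple of the initial velocity.\<close>
lemma geodesic_in_D:
  assumes \<gamma>: "geodesic_curve I \<gamma> V" and I: "0 \<in> I" "1 \<in> I"
    and inN: "\<And>t. 0 \<le> t \<Longrightarrow> t \<le> 1 \<Longrightarrow> \<gamma> t \<in> N"
    and t: "0 \<le> t" "t \<le> 1"
  shows "(\<gamma> 0, t *\<^sub>R V 0) \<in> D"
proof -
  let ?q = "\<gamma> 0" and ?v = "V 0"
  have q: "?q \<in> N" by (rule inN) auto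
  obtain a where a: "a \<in> A" "?q \<in> ch_dom a" by (rule chart_around)
  have subI: "{0..1} \<subseteq> I" by (rule geodesic_curve_interval[OF \<gamma> I])
  define W where "W = (\<lambda>s. tcoord A a ?q (Log ?q (\<gamma> s)) - s *\<^sub>R tcoord A a ?q ?v)"
  define T where "T = {s \<in> {0..1}. (?q, s *\<^sub>R ?v) \<in> D}"
  have T_W: "s \<in> T \<longleftrightarrow> W s = 0" if s: "s \<in> {0..1}" for s
  proof
    assume "s \<in> T"
    then have "(?q, s *\<^sub>R ?v) \<in> D" by (simp add: T_def)
    from Log_expmap[OF this] have "Log ?q (\<gamma> s) = s *\<^sub>R ?v"
      using expmap_scaleR(2)[OF \<gamma> I(1)] s subI by auto
    then show "W s = 0" by (simp add: W_def tcoord_scaleR[OF a])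
  next
    assume "W s = 0"
    then have "tcoord A a ?q (Log ?q (\<gamma> s)) = tcoord A a ?q (s *\<^sub>R ?v)"
      by (simp add: W_def tcoord_scaleR[OF a])
    then have "Log ?q (\<gamma> s) = s *\<^sub>R ?v" using tcoord_inject[OF a] by blast
    then show "s \<in> T" using Log_in_D[OF q inN[of s]] s by (simp add: T_def)
  qed
  have "isCont W s" if s: "s \<in> {0..1}" for s
  proof -
    obtain b where b: "b \<in> A" "\<gamma> s \<in> ch_dom b" by (rule chart_around)
    have sI: "s \<in> I" using s subI by blast
    have c: "isCont \<gamma> s" by (rule has_velocity_isCont[OF geodesic_curve_velocity[OF \<gamma> sI]])
    have "isCont (\<lambda>s. (ch_map a ?q, ch_map b (\<gamma> s))) s"
      by (intro continuous_Pair continuous_const isCont_o2[OF c isCont_chart[OF b]])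
    from isCont_o2[OF this Log_chart_continuous[OF a(1) b(1) q a(2) inN b(2)]]
    have "isCont (\<lambda>s. Log_chart a b (ch_map a ?q, ch_map b (\<gamma> s)) - s *\<^sub>R tcoord A a ?q ?v) s"
      using s by (intro continuous_intros) auto
    moreover have "eventually (\<lambda>s. \<gamma> s \<in> ch_dom b) (nhds s)"
      by (rule isCont_eventually_in[OF c open_dom[OF b(1)] b(2)])
    then have "eventually (\<lambda>s. Log_chart a b (ch_map a ?q, ch_map b (\<gamma> s)) - s *\<^sub>R tcoord A a ?q ?v = W s) (nhds s)"
      by eventually_elim (simp add: W_def Log_chart_eq[OF a(1) b(1) a(2)])
    ultimately show ?thesis by (simp add: isCont_cong)
  qed
  then have "continuous_on {0..1} W" by (intro continuous_at_imp_continuous_on) blast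
  then have "closedin (top_of_set {0..1}) {s \<in> {0..1}. W s = 0}"
    by (rule continuous_closedin_preimage_constant)
  moreover have "{s \<in> {0..1}. W s = 0} = T" using T_W by (auto simp: T_def)
  ultimately have closed: "closedin (top_of_set {0..1}) T" by simp
  let ?ray = "\<lambda>s. (ch_map a ?q, s *\<^sub>R tcoord A a ?q ?v)"
  have "open (?ray -` (tchart a ` (D \<inter> (ch_dom a \<times> UNIV))))"
    by (intro open_vimage D_chart_open[OF a(1)] continuous_intros)
  moreover have "T = {0..1} \<inter> ?ray -` (tchart a ` (D \<inter> (ch_dom a \<times> UNIV)))"
  proof -
    have "?ray s \<in> tchart a ` (D \<inter> (ch_dom a \<times> UNIV)) \<longleftrightarrow> (?q, s *\<^sub>R ?v) \<in> D" for s
      using in_D_chart[OF a, of "s *\<^sub>R ?v"] by (simp add: tcoord_scaleR[OF a])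
    then show ?thesis unfolding T_def vimage_def by blast
  qed
  ultimately have "openin (top_of_set {0..1}) T" by (simp add: openin_open_Int)
  moreover have "connected {0..1::real}" by simp
  ultimately have "T = {} \<or> T = {0..1}" using closed connected_clopen[of "{0..1::real}"] by simp
  moreover have "0 \<in> T" using D_star[OF Log_in_D[OF q q], of 0] by (simp add: T_def)
  ultimately have "T = {0..1}" by blast
  then have "t \<in> T" using t by simp
  then show ?thesis unfolding T_def by blast
qed

lemma Log_geodesic:
  assumes "geodesic_curve I \<gamma> V" "0 \<in> I" "1 \<in> I" "\<And>t. 0 \<le> t \<Longrightarrow> t \<le> 1 \<Longrightarrow> \<gamma> t \<in> N"
  shows "Log (\<gamma> 0) (\<gamma> 1) = V 0"
proof -
  have D: "(\<gamma> 0, 1 *\<^sub>R V 0) \<in> D" by (rule geodesic_in_D[OF assms]) auto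
  from Log_expmap[OF D] expmap_scaleR(2)[OF assms(1-3)] show ?thesis by simp
qed

end

section \<open>The Gauss lemma for families of null geodesics\<close>

context normal_nbhd
begin

lemma expmap_0:
  assumes "q \<in> N" shows "expmap A g q 0 = q"
proof -
  obtain I \<gamma> V where \<gamma>: "geodesic_curve I \<gamma> V" "0 \<in> I" "1 \<in> I" "\<gamma> 0 = q" "V 0 = Log q q"
    by (rule expmap_definedE[OF D_defined[OF Log_in_D[OF assms assms]]])
  from expmap_scaleR(2)[OF \<gamma>(1,2,2)] \<gamma>(4) show ?thesis by simp
qed

text \<open>Rescaling gives a geodesic with the prescribed initial velocity \<open>v\<close> that lasts until \<open>s\<close>.\<close>
lemma geodesic_of_D:
  assumes "(q, s *\<^sub>R v) \<in> D" "s \<noteq> 0"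
  obtains I \<gamma> V where "geodesic_curve I \<gamma> V" "0 \<in> I" "s \<in> I" "\<gamma> 0 = q" "V 0 = v"
proof -
  obtain I \<gamma> V where \<gamma>: "geodesic_curve I \<gamma> V" "0 \<in> I" "1 \<in> I" "\<gamma> 0 = q" "V 0 = s *\<^sub>R v"
    by (rule expmap_definedE[OF D_defined[OF assms(1)]])
  show ?thesis
    by (rule that[OF geodesic_curve_affine[OF \<gamma>(1), of 0 "1 / s"]]) (use \<gamma> assms(2) in auto)
qed

lemma Exp_chart_velocity:
  assumes a: "a \<in> A" "\<gamma> 0 \<in> ch_dom a" and b: "b \<in> A" "\<gamma> s \<in> ch_dom b"
    and \<gamma>: "geodesic_curve I \<gamma> V" "0 \<in> I" "s \<in> I"
    and dom: "(ch_map a (\<gamma> 0), s *\<^sub>R tcoord A a (\<gamma> 0) (V 0)) \<in> Exp_dom a b"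
  shows "frechet_derivative (Exp_chart a b) (at (ch_map a (\<gamma> 0), s *\<^sub>R tcoord A a (\<gamma> 0) (V 0)))
     (0, tcoord A a (\<gamma> 0) (V 0)) = tcoord A b (\<gamma> s) (V s)"
proof -
  let ?y = "ch_map a (\<gamma> 0)" and ?v = "tcoord A a (\<gamma> 0) (V 0)"
  have I: "open I" using \<gamma>(1) by (simp add: geodesic_curve_def)
  have "(Exp_chart a b has_derivative frechet_derivative (Exp_chart a b) (at (?y, s *\<^sub>R ?v))) (at (?y, s *\<^sub>R ?v))"
    using smooth_on_imp_differentiable[OF Exp_chart_smooth(2)[OF a(1) b(1)] dom]
    by (simp only: frechet_derivative_works)
  moreover have "((\<lambda>s. (?y, s *\<^sub>R ?v)) has_vector_derivative (0, ?v)) (at s)"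
    by (intro has_vector_derivative_Pair) (auto intro!: derivative_eq_intros)
  ultimately have "((\<lambda>s. Exp_chart a b (?y, s *\<^sub>R ?v)) has_vector_derivative
      frechet_derivative (Exp_chart a b) (at (?y, s *\<^sub>R ?v)) (0, ?v)) (at s)"
    using vector_derivative_diff_chain_within[of "\<lambda>s. (?y, s *\<^sub>R ?v)" "(0, ?v)" s UNIV "Exp_chart a b"]
    by (simp add: o_def has_derivative_at_withinI)
  then have "((\<lambda>s. ch_map b (\<gamma> s)) has_vector_derivative
      frechet_derivative (Exp_chart a b) (at (?y, s *\<^sub>R ?v)) (0, ?v)) (at s)"
  proof (rule has_vector_derivative_transform_within_open[OF _ I \<gamma>(3)])
    fix s assume "s \<in> I"
    from Exp_chart_eq[OF a, of b "s *\<^sub>R V 0"] expmap_scaleR(2)[OF \<gamma>(1,2) this]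
    show "Exp_chart a b (?y, s *\<^sub>R ?v) = ch_map b (\<gamma> s)" by (simp add: tcoord_scaleR[OF a])
  qed
  from vector_derivative_unique_at[OF this geodesic_curve_ode(1)[OF \<gamma>(1,3) b]] show ?thesis .
qed

text \<open>By conservation of energy.  It is phrased with the derivative of the exponential map in charts,
  because it is needed for all neighbouring geodesics of a variation at once.\<close>
lemma Exp_chart_null:
  assumes a: "a \<in> A" "q \<in> ch_dom a" and b: "b \<in> A" and null: "g q v v = 0"
    and dom: "(ch_map a q, s *\<^sub>R tcoord A a q v) \<in> Exp_dom a b"
  defines "X \<equiv> frechet_derivative (Exp_chart a b) (at (ch_map a q, s *\<^sub>R tcoord A a q v)) (0, tcoord A a q v)"
  shows "G b (Exp_chart a b (ch_map a q, s *\<^sub>R tcoord A a q v)) X X = 0"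
proof -
  let ?v = "tcoord A a q v"
  obtain q' v' where qv: "(ch_map a q, s *\<^sub>R ?v) = (ch_map a q', tcoord A a q' v')" "q' \<in> ch_dom a"
    "(q', v') \<in> D" "expmap A g q' v' \<in> ch_dom b"
    by (rule Exp_domE[OF a(1) dom])
  have "ch_inv a (ch_map a q) = ch_inv a (ch_map a q')" using qv(1) by simp
  then have q': "q' = q" using a qv(2) by simp
  have "tcoord A a q (s *\<^sub>R v) = tcoord A a q v'" using qv(1) q' by (simp add: tcoord_scaleR[OF a])
  then have v': "v' = s *\<^sub>R v" unfolding tcoord_inject[OF a] by (rule sym)
  have inD: "(q, s *\<^sub>R v) \<in> D" and inb: "expmap A g q (s *\<^sub>R v) \<in> ch_dom b" using qv(3,4) q' v' by auto
  obtain I \<gamma> V where \<gamma>: "geodesic_curve I \<gamma> V" "0 \<in> I" "s \<in> I" "\<gamma> 0 = q" "V 0 = v"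
  proof (cases "s = 0")
    case False
    show ?thesis by (rule geodesic_of_D[OF inD False]) (rule that)
  next
    case True
    \<comment> \<open>\<open>D\<close> being open, it contains a short multiple of \<open>v\<close>\<close>
    have "open ((\<lambda>s. (ch_map a q, s *\<^sub>R ?v)) -` (tchart a ` (D \<inter> (ch_dom a \<times> UNIV))))"
      by (intro open_vimage D_chart_open[OF a(1)] continuous_intros)
    moreover have "0 \<in> (\<lambda>s. (ch_map a q, s *\<^sub>R ?v)) -` (tchart a ` (D \<inter> (ch_dom a \<times> UNIV)))"
      using in_D_chart[OF a, of "0 *\<^sub>R v"] inD True by (simp add: tcoord_scaleR[OF a] tcoord_0[OF a])
    ultimately obtain d where d: "d > 0"
      "ball 0 d \<subseteq> (\<lambda>s. (ch_map a q, s *\<^sub>R ?v)) -` (tchart a ` (D \<inter> (ch_dom a \<times> UNIV)))"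
      using open_contains_ball by blast
    have "(ch_map a q, (d/2) *\<^sub>R ?v) \<in> tchart a ` (D \<inter> (ch_dom a \<times> UNIV))"
      using subsetD[OF d(2), of "d/2"] d(1) by simp
    then have "(q, (d/2) *\<^sub>R v) \<in> D" using in_D_chart[OF a, of "(d/2) *\<^sub>R v"] by (simp add: tcoord_scaleR[OF a])
    then obtain I \<gamma> V where "geodesic_curve I \<gamma> V" "0 \<in> I" "\<gamma> 0 = q" "V 0 = v"
      by (rule geodesic_of_D) (use d(1) in auto)
    then show ?thesis by (intro that[of I \<gamma> V]) (simp_all add: True)
  qed
  have s: "\<gamma> s = expmap A g q (s *\<^sub>R v)" using expmap_scaleR(2)[OF \<gamma>(1-3)] \<gamma>(4,5) by simp
  have a': "\<gamma> 0 \<in> ch_dom a" and b': "\<gamma> s \<in> ch_dom b" using a \<gamma>(4) s inb by auto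
  have "X = tcoord A b (\<gamma> s) (V s)"
    unfolding X_def using Exp_chart_velocity[OF a(1) a' b b' \<gamma>(1-3)] dom \<gamma>(4,5) by simp
  moreover have "Exp_chart a b (ch_map a q, s *\<^sub>R ?v) = ch_map b (\<gamma> s)"
    using Exp_chart_eq[OF a, of b "s *\<^sub>R v"] s by (simp add: tcoord_scaleR[OF a])
  moreover have "g (\<gamma> s) (V s) (V s) = 0"
    using geodesic_energy_constant[OF \<gamma>(1,3,2)] \<gamma>(4,5) null by simp
  ultimately show ?thesis using G_tcoord[OF b b'] by simp
qed

text \<open>The Gauss lemma for a variation through null geodesics with moving base point: the product
  of the variation field with the velocity is constant along the geodesic.  Write \<open>F(\<epsilon>, s)\<close> for the
  variation.  In a chart, the derivative of \<open>g(\<partial>\<^sub>\<epsilon>F, \<partial>\<^sub>sF)\<close> in \<open>s\<close> is computed with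
  the geodesic equation; its term with the mixed derivative is half the \<open>\<epsilon>\<close>-derivative of
  \<open>g(\<partial>\<^sub>sF, \<partial>\<^sub>sF) = 0\<close> up to derivatives of the metric, and these cancel by the Koszul formula.
  Using the exponential map rather than the Temple chart makes \<open>F\<close> regular at the vertex
  \<open>s = 0\<close>, so the constant can be evaluated there.\<close>
lemma gauss_null_variation:
  assumes \<gamma>: "geodesic_curve I \<gamma> V" and I: "0 \<in> I" "1 \<in> I"
    and inD: "\<And>s. 0 \<le> s \<Longrightarrow> s \<le> 1 \<Longrightarrow> (\<gamma> 0, s *\<^sub>R V 0) \<in> D"
    and \<beta>: "has_velocity A \<beta> w 0" "\<beta> 0 = \<gamma> 0" and k0: "k 0 = V 0"
    and a: "a \<in> A" "\<gamma> 0 \<in> ch_dom a"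
    and k': "((\<lambda>\<epsilon>. tcoord A a (\<beta> \<epsilon>) (k \<epsilon>)) has_vector_derivative k') (at 0)"
    and null: "eventually (\<lambda>\<epsilon>. g (\<beta> \<epsilon>) (k \<epsilon>) (k \<epsilon>) = 0) (nhds 0)"
  shows "\<exists>J. has_velocity A (\<lambda>\<epsilon>. expmap A g (\<beta> \<epsilon>) (k \<epsilon>)) J 0 \<and> g (\<gamma> 1) J (V 1) = g (\<gamma> 0) w (V 0)"
proof -
  define F where "F = (\<lambda>\<epsilon> s. expmap A g (\<beta> \<epsilon>) (s *\<^sub>R k \<epsilon>))"
  define y where "y = (\<lambda>\<epsilon>. ch_map a (\<beta> \<epsilon>))"
  define kk where "kk = (\<lambda>\<epsilon>. tcoord A a (\<beta> \<epsilon>) (k \<epsilon>))"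
  define y' where "y' = tcoord A a (\<gamma> 0) w"
  define J where "J = (\<lambda>s. THE j. has_velocity A (\<lambda>\<epsilon>. F \<epsilon> s) j 0)"
  have J_eq: "J s = j" if "has_velocity A (\<lambda>\<epsilon>. F \<epsilon> s) j 0" for s j
    unfolding J_def by (rule the_equality[where P = "\<lambda>j. has_velocity A (\<lambda>\<epsilon>. F \<epsilon> s) j 0", OF that]) (rule has_velocity_unique[OF _ that])
  have contb: "isCont \<beta> 0" by (rule has_velocity_isCont[OF \<beta>(1)])
  have \<beta>a: "eventually (\<lambda>\<epsilon>. \<beta> \<epsilon> \<in> ch_dom a) (nhds 0)"
    by (rule isCont_eventually_in[OF contb open_dom[OF a(1)]]) (simp add: \<beta> a)
  have yd: "(y has_vector_derivative y') (at 0)"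
    using has_velocityD[OF \<beta>(1) a(1)] a(2) by (simp add: y_def y'_def \<beta>(2))
  have kd: "(kk has_vector_derivative k') (at 0)" using k' by (simp add: kk_def)
  have y0: "y 0 = ch_map a (\<gamma> 0)" and kk0: "kk 0 = tcoord A a (\<gamma> 0) (V 0)"
    by (simp_all add: y_def kk_def \<beta>(2) k0)
  have subI: "{0..1} \<subseteq> I" by (rule geodesic_curve_interval[OF \<gamma> I])
  have Iopen: "open I" using \<gamma> by (simp add: geodesic_curve_def)
  have F0: "F 0 s = \<gamma> s" if "s \<in> I" for s
    using expmap_scaleR(2)[OF \<gamma> I(1) that] by (simp add: F_def \<beta>(2) k0)
  \<comment> \<open>Near \<open>s0\<close>, in a chart \<open>b\<close> around \<open>\<gamma>(s0)\<close>: \<open>Y\<close> is the variation field along \<open>\<gamma>\<close>,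
    \<open>X\<close> is the velocity across the variation at \<open>s0\<close>, and \<open>W\<close> is their common mixed derivative.\<close>
  have local: "\<exists>Y X S. open S \<and> s0 \<in> S \<and> b \<in> A \<and>
      (\<forall>s\<in>S. s \<in> I \<and> \<gamma> s \<in> ch_dom b \<and> has_velocity A (\<lambda>\<epsilon>. F \<epsilon> s) (tvec A b (\<gamma> s) (Y s)) 0) \<and>
      (\<exists>W. (Y has_vector_derivative W) (at s0) \<and> (X has_vector_derivative W) (at 0)) \<and>
      X 0 = tcoord A b (\<gamma> s0) (V s0) \<and>
      ((\<lambda>\<epsilon>. ch_map b (F \<epsilon> s0)) has_vector_derivative Y s0) (at 0) \<and>
      eventually (\<lambda>\<epsilon>. G b (ch_map b (F \<epsilon> s0)) (X \<epsilon>) (X \<epsilon>) = 0) (nhds 0)"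
    if s0: "s0 \<in> {0..1}" and b: "b \<in> A" "\<gamma> s0 \<in> ch_dom b" for s0 b
  proof -
    have s0I: "s0 \<in> I" using s0 subI by blast
    let ?H = "Exp_chart a b" and ?O = "Exp_dom a b"
    note H = Exp_chart_smooth(2)[OF a(1) b(1)] and O = Exp_chart_smooth(1)[OF a(1) b(1)]
    define Y where "Y = (\<lambda>s. frechet_derivative ?H (at (y 0, s *\<^sub>R kk 0)) (y', s *\<^sub>R k'))"
    define X where "X = (\<lambda>\<epsilon>. frechet_derivative ?H (at (y \<epsilon>, s0 *\<^sub>R kk \<epsilon>)) (0, kk \<epsilon>))"
    define S where "S = I \<inter> (\<lambda>s. (y 0, s *\<^sub>R kk 0)) -` ?O"
    have So: "open S" unfolding S_def by (intro open_Int Iopen open_vimage O continuous_intros)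
    have dom0: "(y 0, s *\<^sub>R kk 0) \<in> ?O \<longleftrightarrow> (ch_map a (\<gamma> 0), tcoord A a (\<gamma> 0) (s *\<^sub>R V 0)) \<in> ?O" for s
      by (simp add: y0 kk0 tcoord_scaleR[OF a])
    have s0S: "s0 \<in> S"
      unfolding S_def using s0I dom0[of s0] in_Exp_dom[OF a, of "s0 *\<^sub>R V 0" b] inD[of s0] s0 b
        expmap_scaleR(2)[OF \<gamma> I(1) s0I] by auto
    have ydom: "eventually (\<lambda>\<epsilon>. (y \<epsilon>, s *\<^sub>R kk \<epsilon>) \<in> ?O) (nhds 0)" if "s \<in> S" for s
    proof -
      have "isCont (\<lambda>\<epsilon>. (y \<epsilon>, s *\<^sub>R kk \<epsilon>)) 0"
        by (intro continuous_Pair continuous_scaleR continuous_const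
            has_vector_derivative_continuous[OF yd] has_vector_derivative_continuous[OF kd])
      moreover have "(y 0, s *\<^sub>R kk 0) \<in> ?O" using that by (simp add: S_def)
      ultimately show ?thesis using O unfolding continuous_at_open eventually_nhds by blast
    qed
    have HF: "F \<epsilon> s \<in> ch_dom b \<and> ?H (y \<epsilon>, s *\<^sub>R kk \<epsilon>) = ch_map b (F \<epsilon> s)"
      if z: "(y \<epsilon>, s *\<^sub>R kk \<epsilon>) \<in> ?O" "\<beta> \<epsilon> \<in> ch_dom a" for \<epsilon> s
    proof -
      obtain q v where qv: "(y \<epsilon>, s *\<^sub>R kk \<epsilon>) = (ch_map a q, tcoord A a q v)" "q \<in> ch_dom a"
        "(q, v) \<in> D" "expmap A g q v \<in> ch_dom b"
        by (rule Exp_domE[OF a(1) z(1)])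
      have "ch_inv a (ch_map a q) = ch_inv a (ch_map a (\<beta> \<epsilon>))" using qv(1) by (simp add: y_def)
      then have q: "q = \<beta> \<epsilon>" using a qv(2) z(2) by simp
      have "tcoord A a q (s *\<^sub>R k \<epsilon>) = tcoord A a q v"
        using qv(1,2) q by (simp add: kk_def tcoord_scaleR[OF a(1)])
      then have v: "v = s *\<^sub>R k \<epsilon>" unfolding tcoord_inject[OF a(1) qv(2)] by (rule sym)
      have "F \<epsilon> s \<in> ch_dom b" using qv(4) by (simp add: F_def q v)
      moreover have "?H (y \<epsilon>, s *\<^sub>R kk \<epsilon>) = ch_map b (F \<epsilon> s)"
        unfolding qv(1) Exp_chart_eq[OF a(1) qv(2)] by (simp add: F_def q v)
      ultimately show ?thesis ..
    qed
    have ev: "eventually (\<lambda>\<epsilon>. F \<epsilon> s \<in> ch_dom b \<and> ?H (y \<epsilon>, s *\<^sub>R kk \<epsilon>) = ch_map b (F \<epsilon> s)) (nhds 0)"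
      if "s \<in> S" for s
      using ydom[OF that] \<beta>a by eventually_elim (rule HF)
    have Fd: "((\<lambda>\<epsilon>. ch_map b (F \<epsilon> s)) has_vector_derivative Y s) (at 0)" if s: "s \<in> S" for s
    proof -
      have "((\<lambda>\<epsilon>. ?H (y \<epsilon>, s *\<^sub>R kk \<epsilon>)) has_vector_derivative Y s) (at 0)"
        unfolding Y_def using s by (intro fan_mixed_derivatives(1)[OF H O yd kd]) (simp add: S_def)
      moreover have "eventually (\<lambda>\<epsilon>. ?H (y \<epsilon>, s *\<^sub>R kk \<epsilon>) = ch_map b (F \<epsilon> s)) (nhds 0)"
        using ev[OF s] by eventually_elim simp
      ultimately show ?thesis by (rule has_vector_derivative_eventually_cong)
    qed
    have vel: "s \<in> I \<and> \<gamma> s \<in> ch_dom b \<and> has_velocity A (\<lambda>\<epsilon>. F \<epsilon> s) (tvec A b (\<gamma> s) (Y s)) 0" if s: "s \<in> S" for s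
    proof -
      have sI: "s \<in> I" using s by (simp add: S_def)
      have evb: "eventually (\<lambda>\<epsilon>. F \<epsilon> s \<in> ch_dom b) (nhds 0)" using ev[OF s] by eventually_elim simp
      have c: "isCont (\<lambda>\<epsilon>. F \<epsilon> s) 0"
        by (rule isCont_of_chart[OF b(1) evb has_vector_derivative_continuous[OF Fd[OF s]]])
      have "F 0 s \<in> ch_dom b" using evb by (rule eventually_nhds_x_imp_x)
      from has_velocity_chartI[OF c b(1) this Fd[OF s]] this sI show ?thesis by (simp add: F0)
    qed
    have Xd: "\<exists>W. (Y has_vector_derivative W) (at s0) \<and> (X has_vector_derivative W) (at 0)"
      unfolding Y_def X_def using s0S by (intro fan_mixed_derivatives(3)[OF H O yd kd]) (simp add: S_def)
    have X0: "X 0 = tcoord A b (\<gamma> s0) (V s0)"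
      unfolding X_def y0 kk0
      by (rule Exp_chart_velocity[OF a b \<gamma> I(1) s0I]) (use s0S in \<open>simp add: S_def y0 kk0\<close>)
    have "eventually (\<lambda>\<epsilon>. G b (ch_map b (F \<epsilon> s0)) (X \<epsilon>) (X \<epsilon>) = 0) (nhds 0)"
      using ydom[OF s0S] ev[OF s0S] \<beta>a null
    proof eventually_elim
      case (elim \<epsilon>)
      have "G b (?H (y \<epsilon>, s0 *\<^sub>R kk \<epsilon>)) (X \<epsilon>) (X \<epsilon>) = 0"
        unfolding X_def y_def kk_def
        by (rule Exp_chart_null[OF a(1) elim(3) b(1) elim(4)]) (use elim(1) in \<open>simp add: y_def kk_def\<close>)
      then show ?case using elim(2) by simp
    qed
    with So s0S b(1) vel Xd X0 Fd[OF s0S] show ?thesis by blast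
  qed
  define P where "P = (\<lambda>s. g (\<gamma> s) (J s) (V s))"
  have P': "(P has_vector_derivative 0) (at s0 within {0..1})" if s0: "s0 \<in> {0..1}" for s0
  proof -
    obtain b where b: "b \<in> A" "\<gamma> s0 \<in> ch_dom b" by (rule chart_around)
    from local[OF s0 b] obtain Y X S W where S: "open S" "s0 \<in> S"
      and SI: "\<forall>s\<in>S. s \<in> I \<and> \<gamma> s \<in> ch_dom b \<and> has_velocity A (\<lambda>\<epsilon>. F \<epsilon> s) (tvec A b (\<gamma> s) (Y s)) 0"
      and W: "(Y has_vector_derivative W) (at s0)" "(X has_vector_derivative W) (at 0)"
      and X0: "X 0 = tcoord A b (\<gamma> s0) (V s0)"
      and Fd: "((\<lambda>\<epsilon>. ch_map b (F \<epsilon> s0)) has_vector_derivative Y s0) (at 0)"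
      and nul: "eventually (\<lambda>\<epsilon>. G b (ch_map b (F \<epsilon> s0)) (X \<epsilon>) (X \<epsilon>) = 0) (nhds 0)"
      by blast
    let ?z = "ch_map b (\<gamma> s0)"
    have s0I: "s0 \<in> I" using s0 subI by blast
    have z: "?z \<in> ch_map b ` ch_dom b" using b by blast
    note ode = geodesic_curve_ode[OF \<gamma> s0I b]
    have P1: "((\<lambda>s. G b (ch_map b (\<gamma> s)) (Y s) (tcoord A b (\<gamma> s) (V s))) has_vector_derivative
        DG b ?z (X 0) (Y s0) (X 0) + G b ?z W (X 0) + G b ?z (Y s0) (- \<Gamma> b ?z (X 0) (X 0))) (at s0)"
      using has_vector_derivative_bilinear_family[OF G_bilinear[OF b(1)] open_chart_image[OF b(1)] z
          G_differentiable[OF b(1)] ode(1) W(1) ode(2)] by (simp add: X0)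
    have F0': "F 0 s0 = \<gamma> s0" by (rule F0[OF s0I])
    have z': "ch_map b (F 0 s0) \<in> ch_map b ` ch_dom b" using z by (simp add: F0')
    have "((\<lambda>\<epsilon>. G b (ch_map b (F \<epsilon> s0)) (X \<epsilon>) (X \<epsilon>)) has_vector_derivative
        DG b ?z (Y s0) (X 0) (X 0) + G b ?z W (X 0) + G b ?z (X 0) W) (at 0)"
      using has_vector_derivative_bilinear_family[OF G_bilinear[OF b(1)] open_chart_image[OF b(1)] z'
          G_differentiable[OF b(1)] Fd W(2) W(2)] by (simp add: F0')
    from has_vector_derivative_eventually_cong[OF this nul]
    have "((\<lambda>\<epsilon>. 0) has_vector_derivative
        DG b ?z (Y s0) (X 0) (X 0) + G b ?z W (X 0) + G b ?z (X 0) W) (at (0::real))" .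
    from vector_derivative_unique_at[OF this has_vector_derivative_const]
    have "DG b ?z (Y s0) (X 0) (X 0) + 2 * G b ?z W (X 0) = 0"
      using G_sym[of b ?z "X 0" W] by simp
    moreover have "2 * G b ?z (Y s0) (\<Gamma> b ?z (X 0) (X 0)) = 2 * DG b ?z (X 0) (Y s0) (X 0) - DG b ?z (Y s0) (X 0) (X 0)"
      using christoffel_koszul(1)[OF b(1) z, of "X 0" "X 0" "Y s0"] G_sym[of b ?z "Y s0"]
        DG_sym[of b "X 0" "Y s0" ?z "X 0"] by simp
    ultimately have "DG b ?z (X 0) (Y s0) (X 0) + G b ?z W (X 0) + G b ?z (Y s0) (- \<Gamma> b ?z (X 0) (X 0)) = 0"
      by (simp add: bilinear_rneg[OF G_bilinear[OF b(1) z]])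
    with P1 have P2: "((\<lambda>s. G b (ch_map b (\<gamma> s)) (Y s) (tcoord A b (\<gamma> s) (V s))) has_vector_derivative 0) (at s0)"
      by simp
    have "(P has_vector_derivative 0) (at s0)"
    proof (rule has_vector_derivative_transform_within_open[OF P2 S])
      fix s assume "s \<in> S"
      with SI have s: "s \<in> I" "\<gamma> s \<in> ch_dom b" "J s = tvec A b (\<gamma> s) (Y s)" by (auto intro: J_eq)
      have "Y s = tcoord A b (\<gamma> s) (J s)" using s b(1) by simp
      then show "G b (ch_map b (\<gamma> s)) (Y s) (tcoord A b (\<gamma> s) (V s)) = P s"
        using G_tcoord[OF b(1) s(2)] by (simp add: P_def)
    qed
    then show ?thesis by (rule has_vector_derivative_at_within)
  qed
  have "convex {0..1::real}" by simp
  then have "\<exists>c. \<forall>s\<in>{0..1}. P s = c"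
    by (rule has_vector_derivative_zero_constant[OF _ P']) auto
  then have P10: "P 1 = P 0" by auto
  have "\<gamma> 0 \<in> N" using D_base inD[of 0] by simp
  then have "eventually (\<lambda>\<epsilon>. \<beta> \<epsilon> \<in> N) (nhds 0)"
    by (intro isCont_eventually_in[OF contb N_open]) (simp add: \<beta>)
  then have "eventually (\<lambda>\<epsilon>. \<beta> \<epsilon> = F \<epsilon> 0) (nhds 0)"
    by eventually_elim (simp add: F_def expmap_0)
  from J_eq[OF has_velocity_cong[OF \<beta>(1) this]] have "J 0 = w" .
  obtain b where b: "b \<in> A" "\<gamma> 1 \<in> ch_dom b" by (rule chart_around)
  have "\<exists>j. has_velocity A (\<lambda>\<epsilon>. F \<epsilon> 1) j 0" using local[OF _ b] by auto
  then obtain j where "has_velocity A (\<lambda>\<epsilon>. F \<epsilon> 1) j 0" by blast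
  with J_eq[OF this] have "has_velocity A (\<lambda>\<epsilon>. expmap A g (\<beta> \<epsilon>) (k \<epsilon>)) (J 1) 0"
    by (simp add: F_def)
  moreover have "g (\<gamma> 1) (J 1) (V 1) = g (\<gamma> 0) w (V 0)"
    using P10 \<open>J 0 = w\<close> by (simp add: P_def)
  ultimately show ?thesis by blast
qed

end

section \<open>The gradient of the optical function\<close>

context lorentz_manifold
begin

text \<open>If the differential of \<open>f\<close> is \<open>- g(\<cdot>, v)/l\<close> for a null vector \<open>v\<close>, then its Riemannian
  gradient arises from \<open>- v/l\<close> by reflecting the \<open>e0\<close>-component, and its length is read off
  from that component.\<close>
lemma riem_norm_grad_null:
  assumes e0: "g x (e None x) (e None x) = -1" and v: "g x v v = 0" and l: "l > 0"
    and f: "\<And>X. dir_deriv A f x X = - g x X v / l"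
  shows "riem_norm g e x (riem_grad A g e f x) = sqrt 2 * \<bar>g x v (e None x)\<bar> / l"
proof -
  let ?e = "e None x"
  define a where "a = g x v ?e"
  define Z where "Z = (- 1 / l) *\<^sub>R (v + (2 * a) *\<^sub>R ?e)"
  have Ze: "g x Z ?e = a / l"
    using l by (simp add: Z_def g_simps e0 a_def field_simps)
  have ZX: "riem_metric g e x Z X = dir_deriv A f x X" for X
  proof -
    have "g x Z X = - (g x X v + 2 * a * g x X ?e) / l"
      using l by (simp add: Z_def g_simps g_sym[of x v X] g_sym[of x ?e X] field_simps)
    then show ?thesis
      unfolding riem_metric_def Ze f using l by (simp add: field_simps)
  qed
  have "riem_grad A g e f x = Z"
    unfolding riem_grad_def
  proof (rule the_equality)
    show "\<forall>X. riem_metric g e x Z X = dir_deriv A f x X" using ZX by simp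
    fix Y assume Y: "\<forall>X. riem_metric g e x Y X = dir_deriv A f x X"
    let ?d = "Y - Z"
    have d: "2 * g x ?d ?e * g x X ?e + g x ?d X = 0" for X
    proof -
      have "riem_metric g e x Y X = riem_metric g e x Z X" using Y ZX by simp
      then show ?thesis by (simp add: riem_metric_def g_simps algebra_simps)
    qed
    have "g x ?d ?e = 0" using d[of ?e] e0 by simp
    then have "g x ?d X = 0" for X using d[of X] by simp
    then have "?d = 0" by (rule g_nondegenerate)
    then show "Y = Z" by simp
  qed
  moreover have "riem_metric g e x Z Z = (sqrt 2 * \<bar>a\<bar> / l)\<^sup>2"
  proof -
    have "g x Z v = - 2 * a\<^sup>2 / l"
      using l by (simp add: Z_def g_simps v g_sym[of x ?e v] a_def power2_eq_square field_simps)
    then have "riem_metric g e x Z Z = 2 * a\<^sup>2 / l / l" unfolding ZX f by simp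
    moreover have "(sqrt 2 * \<bar>a\<bar> / l)\<^sup>2 = 2 * a\<^sup>2 / (l * l)"
      by (simp add: power_mult_distrib power_divide power2_eq_square[of l])
    ultimately show ?thesis by simp
  qed
  ultimately show ?thesis
    unfolding riem_norm_def using l by (simp add: a_def)
qed

lemma cone_vector_null:
  assumes e0: "g y (e None y) (e None y) = -1"
    and ei: "\<And>i. g y (e (Some i) y) (e (Some i) y) = 1"
    and ab: "\<And>a b. a \<noteq> b \<Longrightarrow> g y (e a y) (e b y) = 0"
  shows "g y (cone_vector e y x) (cone_vector e y x) = 0"
    and "g y (e None y) (cone_vector e y x) = - norm x"
proof -
  have lin: "linear (g y u)" "linear (\<lambda>u. g y u v)" for u v
    using g_bilinear[of y] unfolding bilinear_def by blast+
  let ?s = "\<Sum>i\<in>UNIV. x $ i *\<^sub>R e (Some i) y"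
  have e0s: "g y (e None y) ?s = 0"
    by (simp add: linear_sum[OF lin(1)] linear_cmul[OF lin(1)] ab)
  have eis: "g y (e (Some i) y) ?s = x $ i" for i
  proof -
    have "g y (e (Some i) y) ?s = (\<Sum>j\<in>UNIV. x $ j * g y (e (Some i) y) (e (Some j) y))"
      by (simp add: linear_sum[OF lin(1)] linear_cmul[OF lin(1)])
    also have "\<dots> = (\<Sum>j\<in>UNIV. if j = i then x $ i else 0)"
      by (intro sum.cong) (auto simp: ei ab)
    finally show ?thesis by simp
  qed
  have "g y ?s ?s = (\<Sum>i\<in>UNIV. x $ i * g y (e (Some i) y) ?s)"
    by (subst linear_sum[OF lin(2)]) (simp add: linear_cmul[OF lin(2)])
  also have "\<dots> = (norm x)\<^sup>2" by (simp only: eis power2_norm_eq_inner inner_vec_def inner_real_def)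
  finally have ss: "g y ?s ?s = (norm x)\<^sup>2" .
  show "g y (e None y) (cone_vector e y x) = - norm x"
    unfolding cone_vector_def by (simp add: g_simps e0 e0s)
  show "g y (cone_vector e y x) (cone_vector e y x) = 0"
    unfolding cone_vector_def
    by (simp add: g_simps e0 e0s ss g_sym[of y ?s "e None y"] power2_eq_square)
qed

end

lemma cone_vector_scaleR: "0 \<le> s \<Longrightarrow> cone_vector e y (s *\<^sub>R x) = s *\<^sub>R cone_vector e y x"
  unfolding cone_vector_def by (simp add: scaleR_add_right scaleR_sum_right)

text \<open>One uniform Temple chart, centred at \<open>q\<close>, with the frame relations on \<open>K\<close> written without
  absolute values.\<close>
locale temple_chart = normal_nbhd A g N D
  for A :: "('m::t2_space, 'n::finite) atlas" and g N D +
  fixes K :: "'m set" and e :: "('m, 'n) frame" and r :: real and q :: 'm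
  assumes K_sub: "K \<subseteq> N"
    and frame_ortho: "y \<in> K \<Longrightarrow> a \<noteq> b \<Longrightarrow> g y (e a y) (e b y) = 0"
    and frame_time: "y \<in> K \<Longrightarrow> g y (e None y) (e None y) = -1"
    and frame_space: "y \<in> K \<Longrightarrow> g y (e (Some i) y) (e (Some i) y) = 1"
    and central_in: "\<bar>t\<bar> < r \<Longrightarrow> central_geod A g e q t \<in> K"
    and central_velocity: "\<bar>t\<bar> < r \<Longrightarrow>
      has_velocity A (central_geod A g e q) (e None (central_geod A g e q t)) t"
    and central_parallel: "\<bar>t\<bar> < r \<Longrightarrow>
      has_cov_deriv A g (central_geod A g e q) (\<lambda>t. e a (central_geod A g e q t)) 0 t"
    and cone_defined: "(t, x) \<in> cylinder r \<Longrightarrow>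
      expmap_defined A g (central_geod A g e q t) (cone_vector e (central_geod A g e q t) x)"
    and temple_inj: "inj_on (temple_map A g e q) (cylinder r)"
    and temple_diffeo: "diffeo_between std_atlas A {z \<in> cylinder r. snd z \<noteq> 0}
      (temple_map A g e q ` {z \<in> cylinder r. snd z \<noteq> 0}) (temple_map A g e q)"
    and temple_sub: "temple_dom A g e r q \<subseteq> K"
begin

abbreviation "\<eta> \<equiv> central_geod A g e q"
abbreviation "\<Phi> \<equiv> temple_map A g e q"

lemma cylinder_iff: "(t, x) \<in> cylinder r \<longleftrightarrow> \<bar>t\<bar> < r \<and> norm x < r"
  by (auto simp: cylinder_def)

text \<open>The part of the coordinate cylinder on which the Temple chart is smooth.\<close>
definition "Z0 = {z \<in> cylinder r :: 'n model set. snd z \<noteq> 0}"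

lemma Phi_in_K: "z \<in> cylinder r \<Longrightarrow> \<Phi> z \<in> K"
  using temple_sub unfolding temple_dom_def by blast

lemma Phi_axis: "\<bar>t\<bar> < r \<Longrightarrow> \<Phi> (t, 0) = \<eta> t"
  using central_in[of t] K_sub by (auto simp: temple_map_def cone_vector_def expmap_0)

text \<open>The generator of the light cone through \<open>\<Phi>(t, x)\<close>.\<close>
lemma generator:
  assumes z: "(t, x) \<in> cylinder r"
  obtains I \<gamma> V where "geodesic_curve I \<gamma> V" "0 \<in> I" "1 \<in> I" "\<gamma> 0 = \<eta> t" "V 0 = cone_vector e (\<eta> t) x"
    "\<And>s. s \<in> I \<Longrightarrow> 0 \<le> s \<Longrightarrow> \<Phi> (t, s *\<^sub>R x) = \<gamma> s"
proof -
  obtain I \<gamma> V where \<gamma>: "geodesic_curve I \<gamma> V" "0 \<in> I" "1 \<in> I" "\<gamma> 0 = \<eta> t" "V 0 = cone_vector e (\<eta> t) x"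
    by (rule expmap_definedE[OF cone_defined[OF z]])
  show ?thesis
  proof (rule that[OF \<gamma>])
    fix s assume s: "s \<in> I" "0 \<le> s"
    have "\<Phi> (t, s *\<^sub>R x) = expmap A g (\<gamma> 0) (s *\<^sub>R V 0)"
      by (simp add: temple_map_def cone_vector_scaleR[OF s(2)] \<gamma>(4,5))
    also have "\<dots> = \<gamma> s" by (rule expmap_scaleR(2)[OF \<gamma>(1,2) s(1)])
    finally show "\<Phi> (t, s *\<^sub>R x) = \<gamma> s" .
  qed
qed

lemma Phi_smooth:
  assumes c: "c \<in> A" and z: "z \<in> Z0" "\<Phi> z \<in> ch_dom c"
  shows "(\<lambda>z. ch_map c (\<Phi> z)) differentiable (at z)"
proof -
  have "smooth_map_on std_atlas A Z0 \<Phi>"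
    using temple_diffeo unfolding diffeo_between_def Z0_def by blast
  from smooth_map_onD(2)[OF this _ c, of "(UNIV, id)"]
  have "smooth_on {z \<in> Z0. \<Phi> z \<in> ch_dom c} (\<lambda>z. ch_map c (\<Phi> z))"
    by (simp add: std_atlas_def)
  then show ?thesis by (rule smooth_on_imp_differentiable) (use z in simp)
qed

lemma Psi_smooth:
  assumes c: "c \<in> A"
  shows "open (ch_map c ` (\<Phi> ` Z0 \<inter> ch_dom c))"
    "smooth_on (ch_map c ` (\<Phi> ` Z0 \<inter> ch_dom c)) (\<lambda>y. inv_into Z0 \<Phi> (ch_inv c y))"
proof -
  have "smooth_map_on A std_atlas (\<Phi> ` Z0) (inv_into Z0 \<Phi>)"
    using temple_diffeo unfolding diffeo_between_def Z0_def by blast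
  from smooth_map_onD[OF this c, of "(UNIV, id)"]
  show "open (ch_map c ` (\<Phi> ` Z0 \<inter> ch_dom c))"
    "smooth_on (ch_map c ` (\<Phi> ` Z0 \<inter> ch_dom c)) (\<lambda>y. inv_into Z0 \<Phi> (ch_inv c y))"
    by (simp_all add: std_atlas_def Int_def)
qed

lemma Phi_inv:
  assumes "z \<in> cylinder r" shows "inv_into (cylinder r) \<Phi> (\<Phi> z) = z"
  by (rule inv_into_f_f[OF temple_inj assms])

lemma Psi_inv:
  assumes "z \<in> Z0" shows "inv_into Z0 \<Phi> (\<Phi> z) = z"
  by (rule inv_into_f_f[OF inj_on_subset[OF temple_inj] assms]) (auto simp: Z0_def)

lemma open_Phi_Z0: "open (\<Phi> ` Z0)"
proof (subst open_subopen, intro ballI)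
  fix x assume x: "x \<in> \<Phi> ` Z0"
  obtain c where c: "c \<in> A" "x \<in> ch_dom c" by (rule chart_around)
  let ?O = "ch_map c ` (\<Phi> ` Z0 \<inter> ch_dom c)"
  have cont: "continuous_on (ch_dom c) (ch_map c)" using homeo[OF c(1)] by (simp add: homeomorphism_def)
  have "open (ch_dom c \<inter> ch_map c -` ?O)"
    by (rule continuous_open_preimage[OF cont open_dom[OF c(1)] Psi_smooth(1)[OF c(1)]])
  moreover have "x \<in> ch_dom c \<inter> ch_map c -` ?O" using x c by blast
  moreover have "ch_dom c \<inter> ch_map c -` ?O \<subseteq> \<Phi> ` Z0"
  proof
    fix y assume y: "y \<in> ch_dom c \<inter> ch_map c -` ?O"
    then obtain y' where y': "y' \<in> \<Phi> ` Z0" "y' \<in> ch_dom c" "ch_map c y = ch_map c y'" by auto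
    have "ch_inv c (ch_map c y) = ch_inv c (ch_map c y')" using y'(3) by simp
    then have "y = y'" using y y'(2) c(1) by simp
    then show "y \<in> \<Phi> ` Z0" using y' by simp
  qed
  ultimately show "\<exists>T. open T \<and> x \<in> T \<and> T \<subseteq> \<Phi> ` Z0" by blast
qed

text \<open>The smooth part of a Temple chart is open and contained in \<open>K\<close>, so off their vertices the
  generators run in the interior of \<open>K\<close>.\<close>
lemma Phi_interior: "z \<in> cylinder r \<Longrightarrow> snd z \<noteq> 0 \<Longrightarrow> \<Phi> z \<in> interior K"
proof (rule interiorI[OF open_Phi_Z0])
  show "\<Phi> ` Z0 \<subseteq> K" using Phi_in_K by (auto simp: Z0_def)
qed (auto simp: Z0_def)

text \<open>Pulling \<open>X\<close> back through the Temple chart to \<open>(\<tau>, \<xi>)\<close> gives \<open>d\<omega>(X) = \<tau>\<close>, and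
  \<open>X\<close> is the variation field at the tip of the generators through \<open>\<Phi>(t + \<epsilon> \<tau>, x + \<epsilon> \<xi>)\<close>.
  The vertices of these move with velocity \<open>\<tau> e\<^sub>0\<close>, so the Gauss lemma gives
  \<open>g(X, V 1) = \<tau> g(e\<^sub>0, V 0) = - \<tau> |x|\<close>.\<close>
lemma optical_derivative:
  assumes z: "(t, x) \<in> cylinder r" and x: "x \<noteq> 0"
    and \<gamma>: "geodesic_curve I \<gamma> V" "0 \<in> I" "1 \<in> I" "\<gamma> 0 = \<eta> t" "V 0 = cone_vector e (\<eta> t) x"
      "\<And>s. s \<in> I \<Longrightarrow> 0 \<le> s \<Longrightarrow> \<Phi> (t, s *\<^sub>R x) = \<gamma> s"
  shows "dir_deriv A (optical A g e r q) (\<gamma> 1) X = - g (\<gamma> 1) X (V 1) / norm x"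
proof -
  let ?p = "\<gamma> 1"
  let ?c = "pref A ?p"
  have c: "?c \<in> A" "?p \<in> ch_dom ?c" by (rule pref)+
  have p: "?p = \<Phi> (t, x)" using \<gamma>(6)[OF \<gamma>(3)] by simp
  have zZ: "(t, x) \<in> Z0" using z x by (simp add: Z0_def)
  have tr: "\<bar>t\<bar> < r" "norm x < r" using z by (auto simp: cylinder_iff)
  let ?y = "ch_map ?c ?p" and ?O = "ch_map ?c ` (\<Phi> ` Z0 \<inter> ch_dom ?c)"
  let ?\<Psi> = "\<lambda>y. inv_into Z0 \<Phi> (ch_inv ?c y)"
  have yO: "?y \<in> ?O" using zZ c(2) p by blast
  obtain \<Psi>' where \<Psi>': "(?\<Psi> has_derivative \<Psi>') (at ?y)"
    using smooth_on_imp_differentiable[OF Psi_smooth(2)[OF c(1)] yO] unfolding differentiable_def by blast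
  have \<Psi>y: "?\<Psi> ?y = (t, x)" using c by (simp add: p Psi_inv[OF zZ])
  obtain \<Phi>' where \<Phi>': "((\<lambda>z. ch_map ?c (\<Phi> z)) has_derivative \<Phi>') (at (t, x))"
    using Phi_smooth[OF c(1) zZ] c(2) p unfolding differentiable_def by auto
  have \<Psi>in: "?\<Psi> y \<in> Z0 \<and> \<Phi> (?\<Psi> y) = ch_inv ?c y" if "y \<in> ?O" for y
  proof -
    from that obtain x' where x': "y = ch_map ?c x'" "x' \<in> \<Phi> ` Z0" "x' \<in> ch_dom ?c" by blast
    have "ch_inv ?c y = x'" using x' c(1) by simp
    then show ?thesis using inv_into_into[OF x'(2)] f_inv_into_f[OF x'(2)] by simp
  qed
  have yimg: "y \<in> ch_map ?c ` ch_dom ?c" if "y \<in> ?O" for y using that by blast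
  have "((\<lambda>z. ch_map ?c (\<Phi> z)) \<circ> ?\<Psi> has_derivative \<Phi>' \<circ> \<Psi>') (at ?y)"
    by (rule diff_chain_at[OF \<Psi>']) (simp only: \<Psi>y \<Phi>')
  then have "((\<lambda>y. y) has_derivative \<Phi>' \<circ> \<Psi>') (at ?y)"
  proof (rule has_derivative_transform_within_open[OF _ Psi_smooth(1)[OF c(1)] yO])
    fix y assume "y \<in> ?O"
    with \<Psi>in[OF this] yimg[OF this] c(1) show "((\<lambda>z. ch_map ?c (\<Phi> z)) \<circ> ?\<Psi>) y = y" by simp
  qed
  from fun_cong[OF has_derivative_unique[OF this has_derivative_ident]]
  have \<Phi>\<Psi>: "\<Phi>' (\<Psi>' X) = X" by simp
  obtain \<tau> \<xi> where \<tau>: "\<Psi>' X = (\<tau>, \<xi>)" by (cases "\<Psi>' X")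
  \<comment> \<open>the optical function is the first component of the inverse chart\<close>
  have "((\<lambda>y. fst (?\<Psi> y)) has_derivative (\<lambda>v. fst (\<Psi>' v))) (at ?y)"
    by (rule has_derivative_fst[OF \<Psi>'])
  then have "((optical A g e r q \<circ> ch_inv ?c) has_derivative (\<lambda>v. fst (\<Psi>' v))) (at ?y)"
  proof (rule has_derivative_transform_within_open[OF _ Psi_smooth(1)[OF c(1)] yO])
    fix y assume "y \<in> ?O"
    from \<Psi>in[OF this] have "?\<Psi> y \<in> cylinder r" "\<Phi> (?\<Psi> y) = ch_inv ?c y" by (auto simp: Z0_def)
    with Phi_inv[OF this(1)] show "fst (?\<Psi> y) = (optical A g e r q \<circ> ch_inv ?c) y"
      by (simp add: optical_def)
  qed
  from fun_cong[OF frechet_derivative_at[OF this], of X]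
  have dd: "dir_deriv A (optical A g e r q) ?p X = \<tau>" by (simp add: dir_deriv_def \<tau>)
  \<comment> \<open>the vertex and the initial velocity of the varied generators\<close>
  define \<beta> where "\<beta> = (\<lambda>\<epsilon>. \<eta> (t + \<tau> * \<epsilon>))"
  define k where "k = (\<lambda>\<epsilon>. cone_vector e (\<beta> \<epsilon>) (x + \<epsilon> *\<^sub>R \<xi>))"
  have \<beta>0: "\<beta> 0 = \<gamma> 0" and k0: "k 0 = V 0" by (simp_all add: \<beta>_def k_def \<gamma>(4,5))
  have \<beta>v: "has_velocity A \<beta> (\<tau> *\<^sub>R e None (\<gamma> 0)) 0"
    unfolding \<beta>_def using central_velocity[OF tr(1)] \<gamma>(4)
    by (intro has_velocity_affine) simp
  obtain a where a: "a \<in> A" "\<gamma> 0 \<in> ch_dom a" by (rule chart_around)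
  have near: "eventually (\<lambda>\<epsilon>. \<bar>t + \<tau> * \<epsilon>\<bar> < r) (nhds 0)"
  proof -
    have "open ((\<lambda>\<epsilon>. \<bar>t + \<tau> * \<epsilon>\<bar>) -` {..<r})" by (intro open_vimage continuous_intros open_lessThan)
    from eventually_nhds_in_open[OF this, of 0] tr show ?thesis by simp
  qed
  have \<beta>a: "eventually (\<lambda>\<epsilon>. \<beta> \<epsilon> \<in> ch_dom a) (nhds 0)"
    by (rule isCont_eventually_in[OF has_velocity_isCont[OF \<beta>v] open_dom[OF a(1)]]) (simp add: \<beta>0 a)
  have "\<exists>k'. ((\<lambda>\<epsilon>. tcoord A a (\<beta> \<epsilon>) (k \<epsilon>)) has_vector_derivative k') (at 0)"
  proof -
    have "\<exists>E'. ((\<lambda>\<epsilon>. tcoord A a (\<beta> \<epsilon>) (e i (\<beta> \<epsilon>))) has_vector_derivative E') (at 0)" for i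
    proof -
      have "((\<lambda>\<epsilon>. t + \<tau> * \<epsilon>) has_real_derivative \<tau>) (at 0)" by (auto intro!: derivative_eq_intros)
      then have lin: "((\<lambda>\<epsilon>. t + \<tau> * \<epsilon>) has_vector_derivative \<tau>) (at 0)"
        by (simp add: has_real_derivative_iff_has_vector_derivative)
      have "\<eta> t \<in> ch_dom a" using a \<gamma>(4) by simp
      from has_cov_derivD[OF central_parallel[OF tr(1)] central_velocity[OF tr(1)] a(1) this, of i]
      obtain E where "((\<lambda>s. tcoord A a (\<eta> s) (e i (\<eta> s))) has_vector_derivative E) (at (t + \<tau> * 0))"
        by auto
      from vector_diff_chain_at[OF lin this] show ?thesis by (auto simp: o_def \<beta>_def)
    qed
    then obtain E where E: "\<And>i. ((\<lambda>\<epsilon>. tcoord A a (\<beta> \<epsilon>) (e i (\<beta> \<epsilon>))) has_vector_derivative E i) (at 0)"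
      by metis
    have "((\<lambda>\<epsilon>. x + \<epsilon> *\<^sub>R \<xi>) has_derivative (\<lambda>h. h *\<^sub>R \<xi>)) (at 0)" by (auto intro!: derivative_eq_intros)
    moreover have "(norm has_derivative (\<lambda>h. inner h (sgn x))) (at (x + 0 *\<^sub>R \<xi>))"
      using has_derivative_norm[OF x] by simp
    ultimately have "(norm \<circ> (\<lambda>\<epsilon>. x + \<epsilon> *\<^sub>R \<xi>) has_derivative (\<lambda>h. inner h (sgn x)) \<circ> (\<lambda>h. h *\<^sub>R \<xi>)) (at 0)"
      by (rule diff_chain_at)
    then have "((\<lambda>\<epsilon>. norm (x + \<epsilon> *\<^sub>R \<xi>)) has_real_derivative inner \<xi> (sgn x)) (at 0)"
      unfolding has_real_derivative_iff_has_vector_derivative has_vector_derivative_def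
      by (simp add: o_def)
    from has_vector_derivative_scaleR[OF this E]
    obtain d0 where d0: "((\<lambda>\<epsilon>. norm (x + \<epsilon> *\<^sub>R \<xi>) *\<^sub>R tcoord A a (\<beta> \<epsilon>) (e None (\<beta> \<epsilon>))) has_vector_derivative d0) (at 0)"
      by blast
    have "\<exists>d. ((\<lambda>\<epsilon>. (x + \<epsilon> *\<^sub>R \<xi>) $ i *\<^sub>R tcoord A a (\<beta> \<epsilon>) (e (Some i) (\<beta> \<epsilon>))) has_vector_derivative d) (at 0)" for i
    proof -
      have "((\<lambda>\<epsilon>. (x + \<epsilon> *\<^sub>R \<xi>) $ i) has_real_derivative \<xi> $ i) (at 0)"
        by (auto intro!: derivative_eq_intros)
      from has_vector_derivative_scaleR[OF this E] show ?thesis by blast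
    qed
    then have "\<exists>d. \<forall>i. ((\<lambda>\<epsilon>. (x + \<epsilon> *\<^sub>R \<xi>) $ i *\<^sub>R tcoord A a (\<beta> \<epsilon>) (e (Some i) (\<beta> \<epsilon>))) has_vector_derivative d i) (at 0)"
      by (intro choice allI)
    then obtain d where d: "\<And>i. ((\<lambda>\<epsilon>. (x + \<epsilon> *\<^sub>R \<xi>) $ i *\<^sub>R tcoord A a (\<beta> \<epsilon>) (e (Some i) (\<beta> \<epsilon>))) has_vector_derivative d i) (at 0)"
      by blast
    have *: "((\<lambda>\<epsilon>. norm (x + \<epsilon> *\<^sub>R \<xi>) *\<^sub>R tcoord A a (\<beta> \<epsilon>) (e None (\<beta> \<epsilon>)) +
        (\<Sum>i\<in>UNIV. (x + \<epsilon> *\<^sub>R \<xi>) $ i *\<^sub>R tcoord A a (\<beta> \<epsilon>) (e (Some i) (\<beta> \<epsilon>)))) has_vector_derivative d0 + (\<Sum>i\<in>UNIV. d i)) (at 0)"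
      by (intro has_vector_derivative_add d0 has_vector_derivative_sum d)
    have "eventually (\<lambda>\<epsilon>. norm (x + \<epsilon> *\<^sub>R \<xi>) *\<^sub>R tcoord A a (\<beta> \<epsilon>) (e None (\<beta> \<epsilon>)) +
        (\<Sum>i\<in>UNIV. (x + \<epsilon> *\<^sub>R \<xi>) $ i *\<^sub>R tcoord A a (\<beta> \<epsilon>) (e (Some i) (\<beta> \<epsilon>))) = tcoord A a (\<beta> \<epsilon>) (k \<epsilon>)) (nhds 0)"
      using \<beta>a
    proof eventually_elim
      case (elim \<epsilon>)
      note l = tcoord_linear[OF a(1) elim]
      show ?case
        unfolding k_def cone_vector_def by (simp only: linear_add[OF l] linear_sum[OF l] linear_cmul[OF l])
    qed
    from has_vector_derivative_eventually_cong[OF * this]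
    show ?thesis by blast
  qed
  then obtain k' where k': "((\<lambda>\<epsilon>. tcoord A a (\<beta> \<epsilon>) (k \<epsilon>)) has_vector_derivative k') (at 0)" by blast
  have null: "eventually (\<lambda>\<epsilon>. g (\<beta> \<epsilon>) (k \<epsilon>) (k \<epsilon>) = 0) (nhds 0)"
    using near
  proof eventually_elim
    case (elim \<epsilon>)
    then have "\<beta> \<epsilon> \<in> K" unfolding \<beta>_def by (rule central_in)
    then show ?case unfolding k_def
      by (intro cone_vector_null(1) frame_time frame_space frame_ortho)
  qed
  have inD: "(\<gamma> 0, s *\<^sub>R V 0) \<in> D" if s: "0 \<le> s" "s \<le> 1" for s
  proof (rule geodesic_in_D[OF \<gamma>(1-3) _ s])
    fix s :: real assume s: "0 \<le> s" "s \<le> 1"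
    have "s \<in> I" using geodesic_curve_interval[OF \<gamma>(1-3)] s by auto
    moreover have "norm (s *\<^sub>R x) < r"
      using s tr(2) by (simp add: order_le_less_trans[OF mult_left_le_one_le])
    ultimately show "\<gamma> s \<in> N"
      using \<gamma>(6)[of s] s Phi_in_K[of "(t, s *\<^sub>R x)"] tr(1) K_sub by (auto simp: cylinder_iff)
  qed
  obtain J where J: "has_velocity A (\<lambda>\<epsilon>. expmap A g (\<beta> \<epsilon>) (k \<epsilon>)) J 0"
    "g ?p J (V 1) = g (\<gamma> 0) (\<tau> *\<^sub>R e None (\<gamma> 0)) (V 0)"
    using gauss_null_variation[OF \<gamma>(1-3) inD \<beta>v \<beta>0 k0 a k' null] by blast
  have curve: "expmap A g (\<beta> \<epsilon>) (k \<epsilon>) = \<Phi> ((t, x) + \<epsilon> *\<^sub>R (\<tau>, \<xi>))" for \<epsilon>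
    by (simp add: temple_map_def k_def \<beta>_def mult.commute)
  have c1: "((\<lambda>\<epsilon>. (t, x) + \<epsilon> *\<^sub>R (\<tau>, \<xi>)) has_vector_derivative (\<tau>, \<xi>)) (at 0)"
    by (auto intro!: derivative_eq_intros)
  have c2: "((\<lambda>z. ch_map ?c (\<Phi> z)) has_derivative \<Phi>') (at ((t, x) + 0 *\<^sub>R (\<tau>, \<xi>)))"
    using \<Phi>' by (simp add: zero_prod_def[symmetric])
  have "((\<lambda>z. ch_map ?c (\<Phi> z)) \<circ> (\<lambda>\<epsilon>. (t, x) + \<epsilon> *\<^sub>R (\<tau>, \<xi>)) has_vector_derivative \<Phi>' (\<tau>, \<xi>)) (at 0)"
    by (rule vector_derivative_diff_chain_within[OF c1 has_derivative_at_withinI[OF c2]])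
  then have 1: "((\<lambda>\<epsilon>. ch_map ?c (expmap A g (\<beta> \<epsilon>) (k \<epsilon>))) has_vector_derivative X) (at 0)"
    using \<Phi>\<Psi> by (simp add: curve o_def \<tau>)
  have p0: "expmap A g (\<beta> 0) (k 0) = ?p" using curve[of 0] p by (simp add: zero_prod_def[symmetric])
  have "((\<lambda>\<epsilon>. ch_map ?c (expmap A g (\<beta> \<epsilon>) (k \<epsilon>))) has_vector_derivative J) (at 0)"
    using has_velocityD[OF J(1) c(1)] c(2) by (simp add: p0)
  from vector_derivative_unique_at[OF this 1] have "J = X" .
  moreover have "g (\<gamma> 0) (e None (\<gamma> 0)) (V 0) = - norm x"
    unfolding \<gamma>(4,5) using central_in[OF tr(1)]
    by (intro cone_vector_null(2) frame_time frame_space frame_ortho)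
  ultimately have "g ?p X (V 1) = - \<tau> * norm x" using J(2) by (simp add: g_simps)
  then show ?thesis using dd x by (simp add: field_simps)
qed

end

text \<open>All facts about the generator through \<open>x\<close> that the estimate uses, with the length of the gradient
  expressed by the velocity at the tip.  The generator continues past the tip because the coordinate
  ball is open.\<close>
lemma (in temple_chart) gradient_at_tip:
  assumes x: "x \<in> temple_dom A g e r q - central_image A g e r q"
  obtains I \<gamma> V where "geodesic_curve I \<gamma> V" "{0..1} \<subseteq> I"
    "\<And>t. t \<in> I \<Longrightarrow> 0 < t \<Longrightarrow> t < r / radial A g e r q x \<Longrightarrow> \<gamma> t \<in> interior K"
    "1 < r / radial A g e r q x" "\<gamma> 0 \<in> K"
    "\<And>t. t \<in> I \<Longrightarrow> g (\<gamma> t) (V t) (V t) = 0"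
    "radial A g e r q x > 0" "g (\<gamma> 0) (V 0) (e None (\<gamma> 0)) = - radial A g e r q x"
    "riem_norm g e x (riem_grad A g e (optical A g e r q) x)
      = sqrt 2 * \<bar>g (\<gamma> 1) (V 1) (e None (\<gamma> 1))\<bar> / radial A g e r q x"
proof -
  from x obtain t y where ty: "(t, y) \<in> cylinder r" "x = \<Phi> (t, y)"
    unfolding temple_dom_def by auto
  have tr: "\<bar>t\<bar> < r" "norm y < r" using ty(1) by (auto simp: cylinder_iff)
  have y0: "y \<noteq> 0"
  proof
    assume "y = 0"
    then have "x = \<eta> t" using Phi_axis[OF tr(1)] ty(2) by simp
    then show False using x tr(1) by (auto simp: central_image_def abs_less_iff)
  qed
  have rad: "radial A g e r q x = norm y" unfolding radial_def ty(2) Phi_inv[OF ty(1)] by simp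
  obtain I \<gamma> V where \<gamma>: "geodesic_curve I \<gamma> V" "0 \<in> I" "1 \<in> I" "\<gamma> 0 = \<eta> t" "V 0 = cone_vector e (\<eta> t) y"
    and ray: "\<And>s. s \<in> I \<Longrightarrow> 0 \<le> s \<Longrightarrow> \<Phi> (t, s *\<^sub>R y) = \<gamma> s"
    by (rule generator[OF ty(1)]) blast
  have \<eta>K: "\<eta> t \<in> K" by (rule central_in[OF tr(1)])
  have sub: "{0..1} \<subseteq> I" by (rule geodesic_curve_interval[OF \<gamma>(1-3)])
  have one: "1 < r / norm y" using tr(2) y0 by (simp add: less_divide_eq)
  have inK: "\<gamma> s \<in> interior K" if s: "s \<in> I" "0 < s" "s < r / norm y" for s
  proof -
    have "norm (s *\<^sub>R y) < r" using s y0 by (simp add: less_divide_eq)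
    then have "(t, s *\<^sub>R y) \<in> cylinder r" using tr(1) by (simp add: cylinder_iff)
    from Phi_interior[OF this] ray[of s] s y0 show ?thesis by simp
  qed
  have null: "g (\<gamma> s) (V s) (V s) = 0" if "s \<in> I" for s
    using geodesic_energy_constant[OF \<gamma>(1) that \<gamma>(2)] cone_vector_null(1)[of "\<eta> t" e y]
      frame_time[OF \<eta>K] frame_space[OF \<eta>K] frame_ortho[OF \<eta>K] \<gamma>(4,5) by simp
  have init: "g (\<gamma> 0) (V 0) (e None (\<gamma> 0)) = - norm y"
    using cone_vector_null(2)[of "\<eta> t" e y] frame_time[OF \<eta>K] frame_space[OF \<eta>K] frame_ortho[OF \<eta>K]
      \<gamma>(4,5) g_sym[of "\<eta> t" "cone_vector e (\<eta> t) y"] by simp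
  have x1: "\<gamma> 1 = x" using ray[OF \<gamma>(3)] ty(2) by simp
  have xK: "\<gamma> 1 \<in> K" using Phi_in_K[OF ty(1)] ty(2) x1 by simp
  have "riem_norm g e (\<gamma> 1) (riem_grad A g e (optical A g e r q) (\<gamma> 1))
      = sqrt 2 * \<bar>g (\<gamma> 1) (V 1) (e None (\<gamma> 1))\<bar> / norm y"
    using y0 optical_derivative[OF ty(1) y0 \<gamma> ray]
    by (intro riem_norm_grad_null frame_time[OF xK] null[OF \<gamma>(3)]) auto
  then have grad: "riem_norm g e x (riem_grad A g e (optical A g e r q) x)
      = sqrt 2 * \<bar>g (\<gamma> 1) (V 1) (e None (\<gamma> 1))\<bar> / radial A g e r q x" by (simp add: x1 rad)
  show ?thesis
    by (rule that[OF \<gamma>(1) sub _ _ _ null _ _ grad])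
      (use inK one y0 init \<eta>K \<gamma>(4) in \<open>auto simp: rad\<close>)
qed

section \<open>Uniform estimates on a compact set\<close>

text \<open>As long as \<open>|f| \<le> 2 l\<close>, the derivative is at most \<open>4 B l\<^sup>2\<close>, and over unit time
  this changes \<open>f\<close> by at most \<open>l / 2\<close>.  So \<open>|f|\<close> cannot reach \<open>2 l\<close> for the first time.\<close>
lemma riccati_small:
  fixes f :: "real \<Rightarrow> real"
  assumes cont: "continuous_on {0..1} f"
    and der: "\<And>t. 0 < t \<Longrightarrow> t \<le> 1 \<Longrightarrow> \<exists>d. (f has_real_derivative d) (at t) \<and> \<bar>d\<bar> \<le> B * (f t)\<^sup>2"
    and B: "B > 0" and l: "l > 0" "8 * B * l \<le> 1" and f0: "\<bar>f 0\<bar> = l"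
  shows "\<bar>f 1 - f 0\<bar> \<le> 4 * B * l\<^sup>2"
proof -
  have step: "\<bar>f s - f 0\<bar> \<le> 4 * B * l\<^sup>2"
    if s: "0 < s" "s \<le> 1" and small: "\<And>t. 0 < t \<Longrightarrow> t < s \<Longrightarrow> \<bar>f t\<bar> \<le> 2 * l" for s
  proof -
    have c: "continuous_on {0..s} f" using s by (intro continuous_on_subset[OF cont]) auto
    have diff: "f differentiable (at t)" if t: "0 < t" "t < s" for t
    proof -
      obtain d where "(f has_real_derivative d) (at t)" using der[of t] t s by auto
      then show ?thesis by (auto simp: differentiable_def has_field_derivative_def)
    qed
    obtain D t where t: "0 < t" "t < s" "(f has_real_derivative D) (at t)" "f s - f 0 = (s - 0) * D"
      using MVT[OF s(1) c diff] by auto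
    obtain d where d: "(f has_real_derivative d) (at t)" "\<bar>d\<bar> \<le> B * (f t)\<^sup>2" using der[of t] t s by auto
    have D: "D = d" by (rule DERIV_unique[OF t(3) d(1)])
    have "(f t)\<^sup>2 \<le> (2 * l)\<^sup>2" using small[OF t(1,2)] abs_le_square_iff[of "f t" "2 * l"] l by simp
    then have "B * (f t)\<^sup>2 \<le> B * (2 * l)\<^sup>2" using B by (intro mult_left_mono) auto
    then have "\<bar>D\<bar> \<le> B * (2 * l)\<^sup>2" using d D by simp
    then have "s * \<bar>D\<bar> \<le> 1 * (B * (2 * l)\<^sup>2)" using s by (intro mult_mono) auto
    then show ?thesis using t(4) s by (simp add: abs_mult power_mult_distrib mult_ac)
  qed
  have small: "\<bar>f t\<bar> < 2 * l" if "0 \<le> t" "t \<le> 1" for t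
  proof (rule ccontr)
    assume neg: "\<not> \<bar>f t\<bar> < 2 * l"
    define T where "T = {0..1} \<inter> (\<lambda>t. \<bar>f t\<bar>) -` {2 * l..}"
    have "closed T"
      unfolding T_def by (intro continuous_closed_preimage continuous_intros cont closed_atLeast closed_atLeastAtMost)
    moreover have "bounded T" by (rule bounded_subset[of "{0..1}"]) (auto simp: T_def)
    ultimately have "compact T" by (simp add: compact_eq_bounded_closed)
    moreover have "T \<noteq> {}" using neg that by (auto simp: T_def)
    ultimately have "\<exists>s\<in>T. \<forall>t\<in>T. s \<le> t" by (rule compact_attains_inf)
    then obtain s where s: "s \<in> T" "\<And>t. t \<in> T \<Longrightarrow> s \<le> t" by blast
    have fs: "\<bar>f s\<bar> \<ge> 2 * l" "0 \<le> s" "s \<le> 1" using s(1) by (auto simp: T_def)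
    have "s \<noteq> 0" using fs(1) f0 l by auto
    then have s0: "0 < s" using fs by simp
    have "\<bar>f s - f 0\<bar> \<le> 4 * B * l\<^sup>2"
    proof (rule step[OF s0 fs(3)])
      fix t assume t: "0 < t" "t < s"
      then have "t \<notin> T" using s(2)[of t] by auto
      then show "\<bar>f t\<bar> \<le> 2 * l" using t fs by (auto simp: T_def)
    qed
    also have "\<dots> = (8 * B * l) * l / 2" by (simp add: power2_eq_square)
    also have "\<dots> \<le> 1 * l / 2" using l by (intro divide_right_mono mult_right_mono) auto
    finally show False using fs(1) f0 l abs_triangle_ineq2[of "f s" "f 0"] by simp
  qed
  show ?thesis by (rule step) (use small in \<open>auto intro: less_imp_le\<close>)
qed

text \<open>By a finite subcover.  \<open>P y z B\<close> stands for a bound \<open>B\<close> at the point \<open>y\<close>, with \<open>z\<close> a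
  further argument such as a tangent vector.\<close>
lemma compact_bounded_locally:
  fixes h :: "'a::topological_space \<Rightarrow> 'b \<Rightarrow> real"
  assumes "compact K" and loc: "\<And>x. x \<in> K \<Longrightarrow> \<exists>U B. open U \<and> x \<in> U \<and> (\<forall>y\<in>U \<inter> K. \<forall>z. P y z B)"
    and mono: "\<And>y z B B'. P y z B \<Longrightarrow> B \<le> B' \<Longrightarrow> P y z B'"
  shows "\<exists>B>(0::real). \<forall>y\<in>K. \<forall>z. P y z B"
proof -
  from loc have "\<forall>x\<in>K. \<exists>UB. open (fst UB) \<and> x \<in> fst UB \<and> (\<forall>y\<in>fst UB \<inter> K. \<forall>z. P y z (snd UB))"
    by (metis fst_conv snd_conv)
  from bchoice[OF this] obtain W where W: "\<forall>x\<in>K. open (fst (W x)) \<and> x \<in> fst (W x) \<and>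
      (\<forall>y\<in>fst (W x) \<inter> K. \<forall>z. P y z (snd (W x)))" by blast
  have "K \<subseteq> (\<Union>x\<in>K. fst (W x))" using W by blast
  then obtain F where F: "F \<subseteq> K" "finite F" "K \<subseteq> (\<Union>x\<in>F. fst (W x))"
    using compactE_image[OF assms(1), of K "\<lambda>x. fst (W x)"] W by blast
  define B where "B = Max (insert 1 ((\<lambda>x. snd (W x)) ` F))"
  have B1: "1 \<le> B" unfolding B_def using F(2) by (intro Max_ge) auto
  have "P y z B" if y: "y \<in> K" for y z
  proof -
    obtain x where x: "x \<in> F" "y \<in> fst (W x)" using F(3) y by blast
    then have "P y z (snd (W x))" using W F(1) y by blast
    moreover have "snd (W x) \<le> B" unfolding B_def using F(2) x by (intro Max_ge) auto
    ultimately show ?thesis by (rule mono)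
  qed
  then show ?thesis using B1 by (intro exI[of _ B]) auto
qed

text \<open>The part of a frame on which the constant depends: \<open>e\<^sub>0\<close> near the compact set \<open>K\<close>.\<close>
locale framed = lorentz_manifold A g
  for A :: "('m::t2_space, 'n::finite) atlas" and g +
  fixes S K :: "'m set" and e :: "('m, 'n) frame"
  assumes S_open: "open S" and K_S: "K \<subseteq> S" and K_compact: "compact K"
    and e0_smooth: "smooth_vector_field_on A S (e None)"
    and e0_unit: "y \<in> S \<Longrightarrow> g y (e None y) (e None y) = -1"
begin

text \<open>Splitting \<open>v\<close> into its \<open>e\<^sub>0\<close>-component and the orthogonal complement, on which \<open>g\<close>
  is positive, diagonalises \<open>g\<^sub>R\<close>.\<close>
lemma riem_pos:
  assumes y: "y \<in> S" and v: "v \<noteq> 0" shows "riem_metric g e y v v > 0"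
proof -
  let ?e = "e None y"
  define a where "a = g y v ?e"
  define w where "w = v + a *\<^sub>R ?e"
  have we: "g y w ?e = 0" by (simp add: w_def g_simps e0_unit[OF y] a_def)
  have ww: "g y w w = g y v v + a\<^sup>2"
    by (simp add: w_def g_simps e0_unit[OF y] a_def[symmetric] g_sym[of y ?e v] power2_eq_square algebra_simps)
  have eq: "riem_metric g e y v v = g y w w + a\<^sup>2"
    by (simp add: riem_metric_def ww a_def power2_eq_square)
  show ?thesis
  proof (cases "w = 0")
    case True
    then have "a \<noteq> 0" using v by (auto simp: w_def)
    then show ?thesis unfolding eq True by (simp add: g_simps)
  next
    case False
    have "g y w w > 0" by (rule orthogonal_timelike_pos[OF _ we False]) (simp add: e0_unit[OF y])
    then show ?thesis unfolding eq by (simp add: add_pos_nonneg)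
  qed
qed

text \<open>The field \<open>e\<^sub>0\<close>, and below the square of the \<open>g\<^sub>R\<close>-norm, in a chart.\<close>
definition E where "E c y = tcoord A c (ch_inv c y) (e None (ch_inv c y))"

definition riem_chart where "riem_chart c z = 2 * (G c (fst z) (snd z) (E c (fst z)))\<^sup>2 + G c (fst z) (snd z) (snd z)"

text \<open>One half of the Lie derivative of the metric along \<open>e0\<close>, evaluated on \<open>(v, v)\<close>.\<close>
definition lie_chart where "lie_chart c z = DG c (fst z) (E c (fst z)) (snd z) (snd z) / 2
    + G c (fst z) (snd z) (frechet_derivative (E c) (at (fst z)) (snd z))"

lemma E_smooth: "c \<in> A \<Longrightarrow> smooth_on (ch_map c ` (S \<inter> ch_dom c)) (E c)"
  using vector_field_smooth_in_chart(2)[OF e0_smooth] unfolding E_def by blast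

lemma E_eq: "c \<in> A \<Longrightarrow> x \<in> ch_dom c \<Longrightarrow> E c (ch_map c x) = tcoord A c x (e None x)"
  by (simp add: E_def)

lemma riem_chart_eq:
  "c \<in> A \<Longrightarrow> x \<in> ch_dom c \<Longrightarrow> riem_chart c (ch_map c x, tcoord A c x v) = riem_metric g e x v v"
  by (simp add: riem_chart_def riem_metric_def E_eq power2_eq_square)

lemma chart_forms_continuous:
  assumes c: "c \<in> A"
  shows "continuous_on (ch_map c ` (S \<inter> ch_dom c) \<times> UNIV) (riem_chart c)"
    and "continuous_on (ch_map c ` (S \<inter> ch_dom c) \<times> UNIV) (lie_chart c)"
proof -
  let ?P = "ch_map c ` (S \<inter> ch_dom c)"
  let ?T = "?P \<times> (UNIV :: 'n model set)"
  have sub: "?P \<subseteq> ch_map c ` ch_dom c" by blast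
  have img: "fst ` ?T \<subseteq> ?P" by auto
  have lin: "linear (\<lambda>u. G c y u v)" "linear (\<lambda>v. G c y u v)" if "y \<in> ?P" for y u v
    using G_bilinear[OF c, of y] that sub unfolding bilinear_def by blast+
  have dlin: "linear (\<lambda>a. DG c y a u v)" "linear (\<lambda>u. DG c y a u v)" "linear (\<lambda>v. DG c y a u v)"
    if "y \<in> ?P" for y a u v using DG_linear[OF c, of y] that sub by blast+
  have cf: "continuous_on ?T fst" and cs: "continuous_on ?T snd" by (auto intro: continuous_intros)
  have Ec: "continuous_on ?T (\<lambda>z. E c (fst z))"
    by (rule continuous_on_compose2[OF smooth_on_imp_continuous_on[OF E_smooth[OF c]] cf img])
  have Gc: "continuous_on ?P (\<lambda>y. G c y u v)" for u v
    by (rule continuous_on_subset[OF smooth_on_imp_continuous_on[OF G_smooth[OF c]] sub])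
  have G1: "continuous_on ?T (\<lambda>z. G c (fst z) (p z) v)" if p: "continuous_on ?T p" for p v
    by (rule continuous_on_linear_family[OF lin(1) Gc cf img p])
  have G2: "continuous_on ?T (\<lambda>z. G c (fst z) (p z) (w z))" if p: "continuous_on ?T p" "continuous_on ?T w" for p w
  proof (rule continuous_on_linear_family[where L = "\<lambda>z v. G c (fst z) (p z) v" and p = "\<lambda>z. z" and S = ?T])
    show "linear (\<lambda>v. G c (fst z) (p z) v)" if "z \<in> ?T" for z using lin(2)[of "fst z" "p z"] that by auto
  qed (use G1[OF p(1)] p(2) in \<open>auto simp: continuous_on_id\<close>)
  have D1: "continuous_on ?P (\<lambda>y. DG c y a u v)" for a u v
    by (rule continuous_on_subset[OF smooth_on_imp_continuous_on[OF smooth_on_frechet_derivative[OF G_smooth[OF c]]] sub])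
  have D2: "continuous_on ?T (\<lambda>z. DG c (fst z) (E c (fst z)) u v)" for u v
    by (rule continuous_on_linear_family[OF dlin(1) D1 cf img Ec])
  have D3: "continuous_on ?T (\<lambda>z. DG c (fst z) (E c (fst z)) (snd z) v)" for v
  proof (rule continuous_on_linear_family[where L = "\<lambda>z u. DG c (fst z) (E c (fst z)) u v" and p = "\<lambda>z. z" and S = ?T])
    show "linear (\<lambda>u. DG c (fst z) (E c (fst z)) u v)" if "z \<in> ?T" for z using that by (intro dlin(2)) auto
  qed (use D2 cs in \<open>auto simp: continuous_on_id\<close>)
  have D4: "continuous_on ?T (\<lambda>z. DG c (fst z) (E c (fst z)) (snd z) (snd z))"
  proof (rule continuous_on_linear_family[where L = "\<lambda>z v. DG c (fst z) (E c (fst z)) (snd z) v" and p = "\<lambda>z. z" and S = ?T])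
    show "linear (\<lambda>v. DG c (fst z) (E c (fst z)) (snd z) v)" if "z \<in> ?T" for z using that by (intro dlin(3)) auto
  qed (use D3 cs in \<open>auto simp: continuous_on_id\<close>)
  have elin: "linear (frechet_derivative (E c) (at y))" if "y \<in> ?P" for y
    by (rule linear_frechet_derivative[OF smooth_on_imp_differentiable[OF E_smooth[OF c] that]])
  have DE: "continuous_on ?T (\<lambda>z. frechet_derivative (E c) (at (fst z)) (snd z))"
    by (rule continuous_on_linear_family[OF elin
          smooth_on_imp_continuous_on[OF smooth_on_frechet_derivative[OF E_smooth[OF c]]] cf img cs])
  show "continuous_on ?T (riem_chart c)"
    unfolding riem_chart_def by (intro continuous_intros G2 cs Ec)
  show "continuous_on ?T (lie_chart c)"
    unfolding lie_chart_def by (intro continuous_intros G2 cs DE D4) simp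
qed

lemma chart_forms_scale:
  assumes c: "c \<in> A" and y: "y \<in> ch_map c ` (S \<inter> ch_dom c)"
  shows "riem_chart c (y, s *\<^sub>R v) = s\<^sup>2 * riem_chart c (y, v)"
    and "lie_chart c (y, s *\<^sub>R v) = s\<^sup>2 * lie_chart c (y, v)"
proof -
  have y': "y \<in> ch_map c ` ch_dom c" using y by blast
  note bil = G_bilinear[OF c y']
  have elin: "linear (frechet_derivative (E c) (at y))"
    by (rule linear_frechet_derivative[OF smooth_on_imp_differentiable[OF E_smooth[OF c] y]])
  show "riem_chart c (y, s *\<^sub>R v) = s\<^sup>2 * riem_chart c (y, v)"
    by (simp add: riem_chart_def bilinear_lmul[OF bil] bilinear_rmul[OF bil] power2_eq_square algebra_simps)
  show "lie_chart c (y, s *\<^sub>R v) = s\<^sup>2 * lie_chart c (y, v)"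
    by (simp add: lie_chart_def bilinear_lmul[OF bil] bilinear_rmul[OF bil] DG_scale[OF c y']
        linear_cmul[OF elin] power2_eq_square algebra_simps)
qed

text \<open>The Koszul formula turns the connection term of the geodesic equation into derivatives of the
  metric, which combine with the derivative of \<open>e\<^sub>0\<close> to the form \<open>lie_chart\<close>.\<close>
lemma geodesic_e0_derivative:
  assumes \<gamma>: "geodesic_curve I \<gamma> V" "t \<in> I" and c: "c \<in> A" "\<gamma> t \<in> ch_dom c" and S: "\<gamma> t \<in> S"
  shows "((\<lambda>t. g (\<gamma> t) (V t) (e None (\<gamma> t))) has_real_derivative
    lie_chart c (ch_map c (\<gamma> t), tcoord A c (\<gamma> t) (V t))) (at t)"
proof -
  let ?y = "ch_map c (\<gamma> t)" and ?w = "tcoord A c (\<gamma> t) (V t)"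
  have y: "?y \<in> ch_map c ` ch_dom c" and yP: "?y \<in> ch_map c ` (S \<inter> ch_dom c)" using c S by auto
  note ode = geodesic_curve_ode[OF \<gamma> c]
  have dE: "(E c has_derivative frechet_derivative (E c) (at ?y)) (at ?y)"
    using smooth_on_imp_differentiable[OF E_smooth[OF c(1)] yP] by (simp only: frechet_derivative_works)
  have "(E c \<circ> (\<lambda>s. ch_map c (\<gamma> s)) has_vector_derivative frechet_derivative (E c) (at ?y) ?w) (at t)"
    by (rule vector_derivative_diff_chain_within[OF ode(1) has_derivative_at_withinI[OF dE]])
  then have e': "((\<lambda>s. E c (ch_map c (\<gamma> s))) has_vector_derivative frechet_derivative (E c) (at ?y) ?w) (at t)"
    by (simp add: o_def)
  have "((\<lambda>s. G c (ch_map c (\<gamma> s)) (tcoord A c (\<gamma> s) (V s)) (E c (ch_map c (\<gamma> s)))) has_vector_derivative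
      DG c ?y ?w ?w (E c ?y) + G c ?y (- \<Gamma> c ?y ?w ?w) (E c ?y) + G c ?y ?w (frechet_derivative (E c) (at ?y) ?w)) (at t)"
    by (rule has_vector_derivative_bilinear_family[OF G_bilinear[OF c(1)] open_chart_image[OF c(1)] y
          G_differentiable[OF c(1)] ode(1,2) e'])
  also have "DG c ?y ?w ?w (E c ?y) + G c ?y (- \<Gamma> c ?y ?w ?w) (E c ?y) + G c ?y ?w (frechet_derivative (E c) (at ?y) ?w)
      = lie_chart c (?y, ?w)"
    using christoffel_koszul(1)[OF c(1) y, of ?w ?w "E c ?y"]
    by (simp add: lie_chart_def bilinear_lneg[OF G_bilinear[OF c(1) y]])
  finally have *: "((\<lambda>s. G c (ch_map c (\<gamma> s)) (tcoord A c (\<gamma> s) (V s)) (E c (ch_map c (\<gamma> s)))) has_vector_derivative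
      lie_chart c (?y, ?w)) (at t)" .
  have "eventually (\<lambda>s. G c (ch_map c (\<gamma> s)) (tcoord A c (\<gamma> s) (V s)) (E c (ch_map c (\<gamma> s)))
      = g (\<gamma> s) (V s) (e None (\<gamma> s))) (nhds t)"
    using geodesic_curve_in_chart[OF \<gamma> c] by eventually_elim (simp add: c(1) E_eq)
  from has_vector_derivative_eventually_cong[OF * this]
  have "((\<lambda>t. g (\<gamma> t) (V t) (e None (\<gamma> t))) has_vector_derivative lie_chart c (?y, ?w)) (at t)" .
  then show ?thesis by (simp add: has_real_derivative_iff_has_vector_derivative)
qed

text \<open>Both quadratic forms are homogeneous, so on a compact coordinate ball a quotient of extrema
  over the unit sphere bundle compares them.\<close>
lemma lie_bound_local:
  assumes x: "x \<in> S" and c: "c \<in> A" "x \<in> ch_dom c"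
  shows "\<exists>U B. open U \<and> x \<in> U \<and> U \<subseteq> S \<inter> ch_dom c \<and>
    (\<forall>y\<in>U. \<forall>v. \<bar>lie_chart c (ch_map c y, tcoord A c y v)\<bar> \<le> B * riem_metric g e y v v)"
proof -
  let ?P = "ch_map c ` (S \<inter> ch_dom c)" and ?x = "ch_map c x"
  have "open ?P" by (rule open_image[OF c(1) S_open])
  moreover have "?x \<in> ?P" using x c by blast
  ultimately obtain d where d: "d > 0" "cball ?x d \<subseteq> ?P" using open_contains_cball by blast
  let ?C = "cball ?x d \<times> sphere (0::'n model) 1"
  have C: "compact ?C" by (intro compact_Times compact_cball compact_sphere)
  have CP: "?C \<subseteq> ?P \<times> UNIV" using d by auto
  have "(?x, SOME b. b \<in> (Basis::'n model set)) \<in> ?C" using d(1) by (simp add: norm_Basis some_in_eq)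
  then have ne: "?C \<noteq> {}" by blast
  have cr: "continuous_on ?C (riem_chart c)" and cl: "continuous_on ?C (\<lambda>z. \<bar>lie_chart c z\<bar>)"
    by (intro continuous_intros continuous_on_subset[OF chart_forms_continuous(1)[OF c(1)] CP]
        continuous_on_subset[OF chart_forms_continuous(2)[OF c(1)] CP])+
  obtain z0 where z0: "z0 \<in> ?C" "\<forall>z\<in>?C. riem_chart c z0 \<le> riem_chart c z"
    using continuous_attains_inf[OF C ne cr] by blast
  obtain z1 where z1: "z1 \<in> ?C" "\<forall>z\<in>?C. \<bar>lie_chart c z\<bar> \<le> \<bar>lie_chart c z1\<bar>"
    using continuous_attains_sup[OF C ne cl] by blast
  define m where "m = riem_chart c z0"
  define M where "M = \<bar>lie_chart c z1\<bar>"
  have m: "m > 0"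
  proof -
    obtain y w where yw: "z0 = (y, w)" "y \<in> cball ?x d" "norm w = 1" using z0(1) by auto
    then obtain y' where y': "y = ch_map c y'" "y' \<in> S" "y' \<in> ch_dom c" using d(2) by blast
    have "w = tcoord A c y' (tvec A c y' w)" using c(1) y' by simp
    then have "m = riem_metric g e y' (tvec A c y' w) (tvec A c y' w)"
      unfolding m_def yw(1) y'(1) using riem_chart_eq[OF c(1) y'(3), of "tvec A c y' w"] by simp
    moreover have "tvec A c y' w \<noteq> 0"
      using \<open>w = tcoord A c y' (tvec A c y' w)\<close> tcoord_0[OF c(1) y'(3)] yw(3) by auto
    ultimately show ?thesis using riem_pos[OF y'(2)] by simp
  qed
  have bound: "\<bar>lie_chart c (y, v)\<bar> \<le> M / m * riem_chart c (y, v)" if y: "y \<in> cball ?x d" for y v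
  proof (cases "v = 0")
    case True
    then show ?thesis
      using chart_forms_scale[OF c(1), of y 0 v] y d(2) by auto
  next
    case False
    let ?u = "v /\<^sub>R norm v"
    have u: "(y, ?u) \<in> ?C" using y False by simp
    have yP: "y \<in> ?P" using y d(2) by blast
    have v: "v = norm v *\<^sub>R ?u" using False by simp
    have "\<bar>lie_chart c (y, ?u)\<bar> \<le> M" using z1(2) u unfolding M_def by blast
    also have "M = M / m * m" using m by simp
    also have "\<dots> \<le> M / m * riem_chart c (y, ?u)"
      using z0(2) u m unfolding m_def[symmetric] by (intro mult_left_mono) (auto simp: M_def)
    finally have "(norm v)\<^sup>2 * \<bar>lie_chart c (y, ?u)\<bar> \<le> (norm v)\<^sup>2 * (M / m * riem_chart c (y, ?u))"
      by (rule mult_left_mono) simp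
    moreover have "lie_chart c (y, v) = (norm v)\<^sup>2 * lie_chart c (y, ?u)"
      using chart_forms_scale(2)[OF c(1) yP, of "norm v" ?u] v by simp
    moreover have "riem_chart c (y, v) = (norm v)\<^sup>2 * riem_chart c (y, ?u)"
      using chart_forms_scale(1)[OF c(1) yP, of "norm v" ?u] v by simp
    ultimately show ?thesis by (simp add: abs_mult mult_ac)
  qed
  let ?U = "S \<inter> (ch_dom c \<inter> ch_map c -` ball ?x d)"
  have cont: "continuous_on (ch_dom c) (ch_map c)" using homeo[OF c(1)] by (simp add: homeomorphism_def)
  have "open ?U"
    by (intro open_Int S_open continuous_open_preimage[OF cont open_dom[OF c(1)] open_ball])
  moreover have "\<bar>lie_chart c (ch_map c y, tcoord A c y v)\<bar> \<le> M / m * riem_metric g e y v v" if "y \<in> ?U" for y v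
    using bound[of "ch_map c y" "tcoord A c y v"] that riem_chart_eq[OF c(1), of y v] by simp
  ultimately show ?thesis using x c d(1) by (intro exI[of _ ?U] exI[of _ "M / m"]) auto
qed

lemma geodesic_e0_bound:
  "\<exists>B>0. \<forall>I \<gamma> V t. geodesic_curve I \<gamma> V \<longrightarrow> t \<in> I \<longrightarrow> \<gamma> t \<in> K \<longrightarrow>
    (\<exists>d. ((\<lambda>t. g (\<gamma> t) (V t) (e None (\<gamma> t))) has_real_derivative d) (at t) \<and>
      \<bar>d\<bar> \<le> B * riem_metric g e (\<gamma> t) (V t) (V t))"
proof -
  define P where "P = (\<lambda>y v B. \<exists>c\<in>A. y \<in> ch_dom c \<and>
    \<bar>lie_chart c (ch_map c y, tcoord A c y v)\<bar> \<le> B * riem_metric g e y v v)"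
  have nonneg: "riem_metric g e y v v \<ge> 0" if "y \<in> S" for y v
    using riem_pos[OF that, of v] by (cases "v = 0") (auto simp: riem_metric_def g_simps)
  have "\<exists>B>0. \<forall>y\<in>K. \<forall>v. y \<in> S \<and> P y v B"
  proof (rule compact_bounded_locally[OF K_compact])
    fix x assume x: "x \<in> K"
    obtain c where c: "c \<in> A" "x \<in> ch_dom c" by (rule chart_around)
    have "x \<in> S" using x K_S by blast
    from lie_bound_local[OF this c] obtain U B where U: "open U" "x \<in> U" "U \<subseteq> S \<inter> ch_dom c"
      "\<forall>y\<in>U. \<forall>v. \<bar>lie_chart c (ch_map c y, tcoord A c y v)\<bar> \<le> B * riem_metric g e y v v"
      by (elim exE conjE)
    have "y \<in> S \<and> P y v B" if y: "y \<in> U" for y v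
    proof -
      have "y \<in> S" "y \<in> ch_dom c" using subsetD[OF U(3) y] by auto
      moreover have "\<bar>lie_chart c (ch_map c y, tcoord A c y v)\<bar> \<le> B * riem_metric g e y v v"
        by (rule spec[OF bspec[OF U(4) y]])
      ultimately show ?thesis unfolding P_def using c(1) by (intro conjI bexI[of _ c])
    qed
    then have "\<forall>y\<in>U \<inter> K. \<forall>v. y \<in> S \<and> P y v B" by simp
    with U(1,2) show "\<exists>U B. open U \<and> x \<in> U \<and> (\<forall>y\<in>U \<inter> K. \<forall>v. y \<in> S \<and> P y v B)" by blast
  next
    fix y v and B B' :: real assume P: "y \<in> S \<and> P y v B" and B: "B \<le> B'"
    have "B * riem_metric g e y v v \<le> B' * riem_metric g e y v v"
      using nonneg[of y v] P B by (intro mult_right_mono) auto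
    with P show "y \<in> S \<and> P y v B'" unfolding P_def by (auto intro: order_trans)
  qed
  then obtain B where B: "B > 0" "\<forall>y\<in>K. \<forall>v. y \<in> S \<and> P y v B" by (elim exE conjE)
  show ?thesis
  proof (rule exI[of _ B], intro conjI allI impI B(1))
    fix I \<gamma> V t assume \<gamma>: "geodesic_curve I \<gamma> V" "t \<in> I" and K: "\<gamma> t \<in> K"
    from spec[OF bspec[OF B(2) K], of "V t"] obtain c where c: "c \<in> A" "\<gamma> t \<in> ch_dom c"
      "\<bar>lie_chart c (ch_map c (\<gamma> t), tcoord A c (\<gamma> t) (V t))\<bar> \<le> B * riem_metric g e (\<gamma> t) (V t) (V t)"
      unfolding P_def by blast
    have "\<gamma> t \<in> S" using K K_S by blast
    from geodesic_e0_derivative[OF \<gamma> c(1,2) this] c(3)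
    show "\<exists>d. ((\<lambda>t. g (\<gamma> t) (V t) (e None (\<gamma> t))) has_real_derivative d) (at t) \<and>
      \<bar>d\<bar> \<le> B * riem_metric g e (\<gamma> t) (V t) (V t)" by (intro exI conjI)
  qed
qed

end

locale framed_normal = framed A g S K e + normal_nbhd A g N D
  for A :: "('m::t2_space, 'n::finite) atlas" and g S K e N D +
  assumes K_N: "K \<subseteq> N"
begin

text \<open>The logarithm is continuous on \<open>N \<times> N\<close> in charts, hence locally bounded.\<close>
lemma Log_bound: "\<exists>C>0. \<forall>x\<in>K. \<forall>y\<in>K. riem_metric g e x (Log x y) (Log x y) \<le> C"
proof -
  have "\<exists>C>0. \<forall>p\<in>K \<times> K. \<forall>u::unit. riem_metric g e (fst p) (Log (fst p) (snd p)) (Log (fst p) (snd p)) \<le> C"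
  proof (rule compact_bounded_locally)
    show "compact (K \<times> K)" by (intro compact_Times K_compact)
    fix p assume "p \<in> K \<times> K"
    then obtain x y where p: "p = (x, y)" "x \<in> K" "y \<in> K" by auto
    obtain a where a: "a \<in> A" "x \<in> ch_dom a" by (rule chart_around)
    obtain b where b: "b \<in> A" "y \<in> ch_dom b" by (rule chart_around)
    let ?L = "\<lambda>p. Log_chart a b (ch_map a (fst p), ch_map b (snd p))"
    let ?P = "ch_map a ` (S \<inter> ch_dom a) \<times> (UNIV :: 'n model set)"
    have "isCont (\<lambda>p. ch_map a (fst p)) p"
      using isCont_o2[OF isCont_fst[OF continuous_ident] isCont_chart[OF a(1)], of p] p(1) a(2) by simp
    moreover have "isCont (\<lambda>p. ch_map b (snd p)) p"
      using isCont_o2[OF isCont_snd[OF continuous_ident] isCont_chart[OF b(1)], of p] p(1) b(2) by simp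
    ultimately have "isCont (\<lambda>p. (ch_map a (fst p), ch_map b (snd p))) p" by (rule isCont_Pair)
    moreover have "isCont (Log_chart a b) (ch_map a (fst p), ch_map b (snd p))"
      using p K_N by (auto intro!: Log_chart_continuous a b)
    ultimately have "isCont ?L p" by (rule isCont_o2)
    with \<open>isCont (\<lambda>p. ch_map a (fst p)) p\<close> have 1: "isCont (\<lambda>p. (ch_map a (fst p), ?L p)) p"
      by (rule isCont_Pair)
    have "open ?P" by (intro open_Times open_image[OF a(1) S_open] open_UNIV)
    from chart_forms_continuous(1)[OF a(1)] have "\<forall>z\<in>?P. isCont (riem_chart a) z"
      by (simp only: continuous_on_eq_continuous_at[OF \<open>open ?P\<close>])
    moreover have "(ch_map a (fst p), ?L p) \<in> ?P" using p a K_S by auto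
    ultimately have "isCont (riem_chart a) (ch_map a (fst p), ?L p)" by (rule bspec)
    from isCont_o2[OF 1 this] have h: "isCont (\<lambda>p. riem_chart a (ch_map a (fst p), ?L p)) p" .
    let ?B = "riem_chart a (ch_map a (fst p), ?L p) + 1"
    have "\<exists>U. open U \<and> p \<in> U \<and> (\<forall>p'\<in>U. riem_chart a (ch_map a (fst p'), ?L p') \<in> {..<?B})"
      using h[unfolded continuous_at_open] by (elim allE[of _ "{..<?B}"]) auto
    then obtain U where U: "open U" "p \<in> U" "\<And>p'. p' \<in> U \<Longrightarrow> riem_chart a (ch_map a (fst p'), ?L p') < ?B"
      by auto
    let ?W = "U \<inter> ch_dom a \<times> ch_dom b"
    have "open ?W" by (intro open_Int open_Times U(1) open_dom a b)
    moreover have "p \<in> ?W" using U p a b by auto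
    moreover have "riem_metric g e (fst p') (Log (fst p') (snd p')) (Log (fst p') (snd p')) \<le> ?B" if p': "p' \<in> ?W \<inter> K \<times> K" for p'
    proof -
      have d: "fst p' \<in> ch_dom a" "snd p' \<in> ch_dom b" "p' \<in> U" using p' by auto
      have "?L p' = tcoord A a (fst p') (Log (fst p') (snd p'))" by (rule Log_chart_eq[OF a(1) b(1) d(1,2)])
      with U(3)[OF d(3)] riem_chart_eq[OF a(1) d(1)] show ?thesis by simp
    qed
    ultimately show "\<exists>U B. open U \<and> p \<in> U \<and> (\<forall>p'\<in>U \<inter> K \<times> K. \<forall>u::unit.
        riem_metric g e (fst p') (Log (fst p') (snd p')) (Log (fst p') (snd p')) \<le> B)" by blast
  qed auto
  then show ?thesis by (metis SigmaI fst_conv snd_conv)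
qed

text \<open>The quantitative estimate for a null geodesic in \<open>K\<close>, parametrised on \<open>[0, 1]\<close>, whose
  initial \<open>e0\<close>-component has size \<open>l\<close>.  For small \<open>l\<close> the Riccati comparison applies.  For large
  \<open>l\<close> the second half of the geodesic, run backwards, is a ray of the exponential map
  between points of \<open>K\<close>, which bounds its velocity.\<close>
lemma null_geodesic_estimate:
  "\<exists>C>0. \<forall>I \<gamma> V f l. geodesic_curve I \<gamma> V \<longrightarrow> {0<..1} \<subseteq> I \<longrightarrow>
     (\<forall>t. 0 < t \<and> t \<le> 1 \<longrightarrow> \<gamma> t \<in> K \<and> g (\<gamma> t) (V t) (V t) = 0) \<longrightarrow>
     continuous_on {0..1} f \<longrightarrow> (\<forall>t\<in>I. 0 < t \<longrightarrow> f t = g (\<gamma> t) (V t) (e None (\<gamma> t))) \<longrightarrow>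
     0 < l \<longrightarrow> f 0 = - l \<longrightarrow> \<bar>\<bar>f 1\<bar> - l\<bar> < C * l\<^sup>2"
proof -
  obtain B where B: "B > 0" "\<And>I \<gamma> V t. geodesic_curve I \<gamma> V \<Longrightarrow> t \<in> I \<Longrightarrow> \<gamma> t \<in> K \<Longrightarrow>
    (\<exists>d. ((\<lambda>t. g (\<gamma> t) (V t) (e None (\<gamma> t))) has_real_derivative d) (at t) \<and>
      \<bar>d\<bar> \<le> B * riem_metric g e (\<gamma> t) (V t) (V t))"
    using geodesic_e0_bound by blast
  obtain C1 where C1: "C1 > 0" "\<And>x y. x \<in> K \<Longrightarrow> y \<in> K \<Longrightarrow> riem_metric g e x (Log x y) (Log x y) \<le> C1"
    using Log_bound by blast
  \<comment> \<open>\<open>2 B\<close> is the Riccati constant since \<open>g\<^sub>R(V, V) = 2 f\<^sup>2\<close>.  The first summand of \<open>C\<close> serves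
    \<open>8 B2 l \<le> 1\<close>; the middle one
    absorbs \<open>C2 + l\<close> by means of \<open>1 < 8 B2 l\<close>.\<close>
  define B2 where "B2 = 2 * B"
  define C2 where "C2 = sqrt (2 * C1)"
  define C where "C = 4 * B2 + (C2 * (8 * B2)\<^sup>2 + 8 * B2) + 1"
  have B2: "B2 > 0" and C2: "C2 > 0" using B(1) C1(1) by (auto simp: B2_def C2_def)
  have C: "C > 0" using B2 C2 by (auto simp: C_def intro!: add_pos_pos mult_pos_pos)
  have main: "\<bar>\<bar>f 1\<bar> - l\<bar> < C * l\<^sup>2"
    if \<gamma>: "geodesic_curve I \<gamma> V" and I: "{0<..1} \<subseteq> I"
      and K: "\<And>t. 0 < t \<Longrightarrow> t \<le> 1 \<Longrightarrow> \<gamma> t \<in> K \<and> g (\<gamma> t) (V t) (V t) = 0"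
      and cont: "continuous_on {0..1} f"
      and f: "\<And>t. t \<in> I \<Longrightarrow> 0 < t \<Longrightarrow> f t = g (\<gamma> t) (V t) (e None (\<gamma> t))"
      and l: "0 < l" "f 0 = - l" for I \<gamma> V f l
  proof (cases "8 * B2 * l \<le> 1")
    case True
    have "\<exists>d. (f has_real_derivative d) (at t) \<and> \<bar>d\<bar> \<le> B2 * (f t)\<^sup>2" if t: "0 < t" "t \<le> 1" for t
    proof -
      have tI: "t \<in> I" using t I by auto
      obtain d where d: "((\<lambda>t. g (\<gamma> t) (V t) (e None (\<gamma> t))) has_real_derivative d) (at t)"
        "\<bar>d\<bar> \<le> B * riem_metric g e (\<gamma> t) (V t) (V t)"
        using B(2)[OF \<gamma> tI] K[OF t] by blast
      have "open (I \<inter> {0<..})" "t \<in> I \<inter> {0<..}"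
        using \<gamma> tI t by (auto simp: geodesic_curve_def intro: open_Int)
      from has_field_derivative_transform_within_open[OF d(1) this] f
      have "(f has_real_derivative d) (at t)" by auto
      moreover have "riem_metric g e (\<gamma> t) (V t) (V t) = 2 * (f t)\<^sup>2"
        using K[OF t] f[OF tI t(1)] by (simp add: riem_metric_def power2_eq_square)
      ultimately show ?thesis using d(2) by (auto simp: B2_def)
    qed
    from riccati_small[OF cont this B2 l(1) True] l have "\<bar>f 1 + l\<bar> \<le> 4 * B2 * l\<^sup>2" by simp
    then have "\<bar>\<bar>f 1\<bar> - l\<bar> \<le> 4 * B2 * l\<^sup>2" using l(1) by (auto simp: abs_if split: if_splits)
    also have "\<dots> < C * l\<^sup>2"
    proof (rule mult_strict_right_mono)
      have "0 \<le> C2 * (8 * B2)\<^sup>2" using C2 by (intro mult_nonneg_nonneg) auto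
      then show "4 * B2 < C" unfolding C_def using B2 by linarith
    qed (use l in simp)
    finally show ?thesis .
  next
    case False
    let ?h = "\<lambda>s. 1 + (- (1/2)) * s"
    note \<sigma> = geodesic_curve_affine[OF \<gamma>, of 1 "- (1/2)"]
    have hI: "s \<in> ?h -` I" if "0 \<le> s" "s \<le> 1" for s using that I by auto
    have "Log (\<gamma> (?h 0)) (\<gamma> (?h 1)) = (- (1/2)) *\<^sub>R V (?h 0)"
    proof (rule Log_geodesic[OF \<sigma>])
      show "0 \<in> ?h -` I" "1 \<in> ?h -` I" by (rule hI; simp)+
      show "\<gamma> (?h s) \<in> N" if "0 \<le> s" "s \<le> 1" for s
        using K[of "?h s"] that K_N by auto
    qed
    then have "riem_metric g e (\<gamma> 1) ((- (1/2)) *\<^sub>R V 1) ((- (1/2)) *\<^sub>R V 1) \<le> C1"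
      using C1(2)[of "\<gamma> 1" "\<gamma> (1/2)"] K[of 1] K[of "1/2"] by simp
    moreover have "riem_metric g e (\<gamma> 1) ((- (1/2)) *\<^sub>R V 1) ((- (1/2)) *\<^sub>R V 1) = (f 1)\<^sup>2 / 2"
      using K[of 1] f[of 1] subsetD[OF I, of 1] by (simp add: riem_metric_def g_simps power2_eq_square)
    ultimately have "(f 1)\<^sup>2 \<le> 2 * C1" by simp
    then have f1: "\<bar>f 1\<bar> \<le> C2" unfolding C2_def by (rule real_le_rsqrt[of "\<bar>f 1\<bar>", simplified])
    have L: "1 \<le> 8 * B2 * l" using False by simp
    then have "1 \<le> (8 * B2 * l)\<^sup>2" by (simp add: one_le_power)
    then have "C2 * 1 \<le> C2 * (8 * B2 * l)\<^sup>2" using C2 by (intro mult_left_mono) auto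
    moreover have "1 * l \<le> (8 * B2 * l) * l" using L l by (intro mult_right_mono) auto
    moreover have "\<bar>\<bar>f 1\<bar> - l\<bar> \<le> C2 + l" using f1 l C2 by (auto simp: abs_if split: if_splits)
    ultimately have "\<bar>\<bar>f 1\<bar> - l\<bar> \<le> (C2 * (8 * B2)\<^sup>2 + 8 * B2) * l\<^sup>2"
      by (simp add: power2_eq_square algebra_simps)
    also have "\<dots> < C * l\<^sup>2" using B2 l by (intro mult_strict_right_mono) (auto simp: C_def)
    finally show ?thesis .
  qed
  show ?thesis
  proof (intro exI[of _ C] conjI C allI impI)
    fix I \<gamma> V f l
    assume "geodesic_curve I \<gamma> V" "{0<..1} \<subseteq> I"
      and K: "\<forall>t. 0 < t \<and> t \<le> 1 \<longrightarrow> \<gamma> t \<in> K \<and> g (\<gamma> t) (V t) (V t) = 0"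
      and "continuous_on {0..1} f"
      and f: "\<forall>t\<in>I. 0 < t \<longrightarrow> f t = g (\<gamma> t) (V t) (e None (\<gamma> t))"
      and "0 < l" "f 0 = - l"
    then show "\<bar>\<bar>f 1\<bar> - l\<bar> < C * l\<^sup>2"
      by (intro main[of I \<gamma> V f l]) simp_all
  qed
qed

end

section \<open>The constant is uniform\<close>

text \<open>On the interior of \<open>K\<close> the metrics agree together with their derivatives, hence so do the
  Christoffel symbols.\<close>
lemma geodesic_curve_transfer:
  assumes L: "lorentz_manifold A g" "lorentz_manifold A g'"
    and eq: "\<And>x. x \<in> K \<Longrightarrow> g' x = g x"
    and \<gamma>: "lorentz_manifold.geodesic_curve A g' I \<gamma> V" and in_K: "\<And>t. t \<in> I \<Longrightarrow> \<gamma> t \<in> interior K"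
  shows "lorentz_manifold.geodesic_curve A g I \<gamma> V"
proof -
  interpret L: lorentz_manifold A g by fact
  interpret L': lorentz_manifold A g' by fact
  have chr: "christoffel A g' c (ch_map c x) = christoffel A g c (ch_map c x)"
    if c: "c \<in> A" and x: "x \<in> ch_dom c" "x \<in> interior K" for c x
  proof -
    let ?O = "ch_map c ` (interior K \<inter> ch_dom c)"
    have O: "open ?O" by (rule L.open_image[OF c open_interior])
    have xO: "ch_map c x \<in> ?O" using x by blast
    have m: "metric_coord A g' c y = metric_coord A g c y" if y: "y \<in> ?O" for y
    proof -
      from y obtain x' where x': "y = ch_map c x'" "x' \<in> interior K" "x' \<in> ch_dom c" by blast
      have "ch_inv c y = x'" using x'(1,3) c by simp
      then have "ch_inv c y \<in> K" using x'(2) interior_subset by blast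
      from eq[OF this] show ?thesis by (intro ext) (simp add: metric_coord_def Let_def)
    qed
    have fd: "frechet_derivative (\<lambda>y. metric_coord A g' c y u v) (at (ch_map c x))
      = frechet_derivative (\<lambda>y. metric_coord A g c y u v) (at (ch_map c x))" for u v
    proof (rule frechet_derivative_transform_within_open[OF _ O xO])
      show "(\<lambda>y. metric_coord A g' c y u v) differentiable at (ch_map c x)"
        using x(1) by (intro L'.G_differentiable[OF c]) blast
    qed (simp add: m)
    show ?thesis unfolding christoffel_def fd m[OF xO] ..
  qed
  have "has_cov_deriv A g \<gamma> V 0 t" if "has_cov_deriv A g' \<gamma> V 0 t" "t \<in> I" for t
    using that(1) chr[OF _ _ in_K[OF that(2)]] unfolding has_cov_deriv_def by auto
  then show ?thesis
    using \<gamma> unfolding L.geodesic_curve_def L'.geodesic_curve_def parallel_along_def by blast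
qed

lemma geodesic_curve_restrict:
  assumes "lorentz_manifold A g" "lorentz_manifold.geodesic_curve A g I \<gamma> V"
    "open J" "is_interval J"
  shows "lorentz_manifold.geodesic_curve A g (I \<inter> J) \<gamma> V"
proof -
  interpret lorentz_manifold A g by fact
  show ?thesis using assms(2-4) unfolding geodesic_curve_def parallel_along_def
    by (auto intro: open_Int is_interval_Int)
qed

lemma lorentz_manifoldI: "spacetime A g \<tau> \<Longrightarrow> lorentz_manifold A g"
  by (simp add: spacetime_def lorentz_manifold_def smooth_manifold_def lorentz_manifold_axioms_def)

lemma normal_nbhdI:
  assumes "spacetime A g \<tau>" "convex_normal_nbhd A g p N"
  obtains D where "normal_nbhd A g N D"
proof -
  from assms(2) obtain D where D: "open N" "atlas_open (tangent_atlas A) D"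
        "\<forall>q v. (q, v) \<in> D \<longrightarrow> expmap_defined A g q v"
        "\<forall>q v. (q, v) \<in> D \<longrightarrow> (\<forall>s\<in>{0..1}. (q, s *\<^sub>R v) \<in> D)"
        "diffeo_between (tangent_atlas A) (prod_atlas A A) D (N \<times> N) (\<lambda>(q, v). (q, expmap A g q v))"
    unfolding convex_normal_nbhd_def by blast
  have "normal_nbhd A g N D"
    unfolding normal_nbhd_def normal_nbhd_axioms_def
    using lorentz_manifoldI[OF assms(1)] D by auto
  then show ?thesis by (rule that)
qed

lemma frame_unit:
  assumes "lorentz_manifold A g" and "frame_field_on A g \<tau> K e"
  obtains S where "open S" "K \<subseteq> S" "smooth_vector_field_on A S (e None)"
    "\<And>y. y \<in> S \<Longrightarrow> g y (e None y) (e None y) = -1"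
    "\<And>y i. y \<in> S \<Longrightarrow> g y (e (Some i) y) (e (Some i) y) = 1"
    "\<And>y a b. y \<in> S \<Longrightarrow> a \<noteq> b \<Longrightarrow> g y (e a y) (e b y) = 0"
proof -
  interpret lorentz_manifold A g by fact
  from assms(2) obtain S where S: "open S" "K \<subseteq> S" "\<forall>a. smooth_vector_field_on A S (e a)"
    and o: "\<forall>x\<in>S. (\<forall>a b. \<bar>g x (e a x) (e b x)\<bar> = (if a = b then 1 else 0)) \<and>
        future_timelike g \<tau> x (e None x) \<and> (\<forall>i. spacelike g x (e (Some i) x))"
    unfolding frame_field_on_def by blast
  have abs: "\<bar>g x (e a x) (e b x)\<bar> = (if a = b then 1 else 0)" if "x \<in> S" for x a b
    using o that by blast
  show ?thesis
  proof (rule that[OF S(1,2)])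
    show "smooth_vector_field_on A S (e None)" using S(3) by blast
    fix y assume y: "y \<in> S"
    have "g y (e None y) (e None y) < 0"
      using o y unfolding future_timelike_def timelike_def by blast
    then show "g y (e None y) (e None y) = -1" using abs[OF y, of None None] by (simp split: if_splits)
    show "g y (e a y) (e b y) = 0" if "a \<noteq> b" for a b using abs[OF y, of a b] that by simp
    fix i
    have sp: "spacelike g y (e (Some i) y)" using o y by blast
    have "e (Some i) y \<noteq> 0" using abs[OF y, of "Some i" "Some i"] by (auto simp: g_simps)
    then have "g y (e (Some i) y) (e (Some i) y) > 0" using sp unfolding spacelike_def by blast
    then show "g y (e (Some i) y) (e (Some i) y) = 1" using abs[OF y, of "Some i" "Some i"] by simp
  qed
qed

lemma temple_chartI:
  fixes A :: "('m::t2_space, 'n::finite) atlas"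
  assumes nn: "normal_nbhd A g N D" and KN: "K \<subseteq> N"
    and fr: "frame_field_on A g \<tau> K e" and U: "uniform_temple_nbhd A g p K e r U" and q: "q \<in> U"
  shows "temple_chart A g N D K e r q"
proof -
  interpret normal_nbhd A g N D by fact
  have lm: "lorentz_manifold A g" by unfold_locales
  obtain S where S: "open S" "K \<subseteq> S" "smooth_vector_field_on A S (e None)"
    "\<And>y. y \<in> S \<Longrightarrow> g y (e None y) (e None y) = -1"
    "\<And>y i. y \<in> S \<Longrightarrow> g y (e (Some i) y) (e (Some i) y) = 1"
    "\<And>y a b. y \<in> S \<Longrightarrow> a \<noteq> b \<Longrightarrow> g y (e a y) (e b y) = 0"
    by (rule frame_unit[OF lm fr]) blast
  from U q have
    1: "\<forall>t\<in>{-r<..<r}. geod_defined A g q (e None q) t \<and> central_geod A g e q t \<in> K \<and>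
           has_velocity A (central_geod A g e q) (e None (central_geod A g e q t)) t" and
    2: "\<forall>a. parallel_along A g (central_geod A g e q) {-r<..<r} (\<lambda>t. e a (central_geod A g e q t))" and
    3: "\<forall>(t, x)\<in>cylinder r. expmap_defined A g (central_geod A g e q t)
           (cone_vector e (central_geod A g e q t) x)" and
    4: "homeomorphism (cylinder r) (temple_dom A g e r q) (temple_map A g e q)
          (inv_into (cylinder r) (temple_map A g e q))" and
    5: "diffeo_between std_atlas A {z \<in> cylinder r. snd z \<noteq> 0}
          (temple_map A g e q ` {z \<in> cylinder r. snd z \<noteq> 0}) (temple_map A g e q)" and
    6: "temple_dom A g e r q \<subseteq> K"
    unfolding uniform_temple_nbhd_def by blast+
  have inj: "inj_on (temple_map A g e q) (cylinder r)"
    by (rule inj_on_inverseI[of _ "inv_into (cylinder r) (temple_map A g e q)"])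
      (rule homeomorphism_apply1[OF 4])
  show ?thesis
  proof unfold_locales
    show "K \<subseteq> N" by (rule KN)
    show "g y (e a y) (e b y) = 0" if "y \<in> K" "a \<noteq> b" for y a b using S(2,6) that by blast
    show "g y (e None y) (e None y) = -1" if "y \<in> K" for y using S(2,4) that by blast
    show "g y (e (Some i) y) (e (Some i) y) = 1" if "y \<in> K" for y i using S(2,5) that by blast
    fix t :: real assume "\<bar>t\<bar> < r"
    then have t: "t \<in> {-r<..<r}" by auto
    show "central_geod A g e q t \<in> K"
      "has_velocity A (central_geod A g e q) (e None (central_geod A g e q t)) t"
      using bspec[OF 1 t] by auto
    show "has_cov_deriv A g (central_geod A g e q) (\<lambda>t. e a (central_geod A g e q t)) 0 t" for a
      using spec[OF 2, of a] t unfolding parallel_along_def by blast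
  next
    fix t x assume "(t, x) \<in> (cylinder r :: 'n model set)"
    from bspec[OF 3 this] show "expmap_defined A g (central_geod A g e q t) (cone_vector e (central_geod A g e q t) x)"
      by simp
  qed (fact inj 5 6)+
qed

text \<open>The convex normal neighbourhood that determines \<open>C\<close> comes from one admissible setting, chosen
  once; if there is none, the claim is void.  The generators of any other setting are geodesics of the chosen
  metric for \<open>s > 0\<close>.  At \<open>s = 0\<close> only the continuity of \<open>f\<close> is used, and that holds in the
  other metric.\<close>
theorem proposition3p5:
  fixes A :: "('m::{t2_space,second_countable_topology}, 'n::finite) atlas"
    and g :: "('m, 'n) metric" and \<tau> :: "('m, 'n) vfield"
    and K :: "'m set" and e :: "('m, 'n) frame" and R :: real
  assumes "spacetime A g \<tau>"
    and "compact K"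
    and "frame_field_on A g \<tau> K e"
    and "R > 0"
  shows "\<exists>C>0. \<forall>g' \<tau>' e' p U.
    spacetime A g' \<tau>' \<longrightarrow>
    (\<forall>x\<in>K. g' x = g x \<and> (\<forall>a. e' a x = e a x)) \<longrightarrow>
    temple_setting A g' \<tau>' p K e' R U \<longrightarrow>
    (\<forall>r. 0 < r \<and> r \<le> R \<longrightarrow>
      (\<forall>q\<in>U r. \<forall>x\<in>temple_dom A g' e' r q - central_image A g' e' r q.
        \<bar>riem_norm g' e' x (riem_grad A g' e' (optical A g' e' r q) x) - sqrt 2\<bar>
          < C * radial A g' e' r q x))"
proof (cases "\<exists>g0 \<tau>0 e0 p0 U0. spacetime A g0 \<tau>0 \<and> (\<forall>x\<in>K. g0 x = g x \<and> (\<forall>a. e0 a x = e a x)) \<and>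
    temple_setting A g0 \<tau>0 p0 K e0 R U0")
  case False
  then show ?thesis by (intro exI[of _ 1] conjI allI impI zero_less_one) blast
next
  case True
  then obtain g0 \<tau>0 e0 p0 U0 where g0: "spacetime A g0 \<tau>0" "\<forall>x\<in>K. g0 x = g x \<and> (\<forall>a. e0 a x = e a x)"
    "temple_setting A g0 \<tau>0 p0 K e0 R U0" by blast
  from g0(3) obtain N where N: "convex_normal_nbhd A g0 p0 N" "K \<subseteq> N" and fr0: "frame_field_on A g0 \<tau>0 K e0"
    unfolding temple_setting_def by blast
  obtain D where D: "normal_nbhd A g0 N D" by (rule normal_nbhdI[OF g0(1) N(1)])
  note lm0 = lorentz_manifoldI[OF g0(1)]
  obtain S where S: "open S" "K \<subseteq> S" "smooth_vector_field_on A S (e0 None)"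
    "\<And>y. y \<in> S \<Longrightarrow> g0 y (e0 None y) (e0 None y) = -1"
    by (rule frame_unit[OF lm0 fr0]) blast
  have framed: "framed A g0 S K e0"
    using lm0 S assms(2) by (simp add: framed_def framed_axioms_def)
  interpret F: framed_normal A g0 S K e0 N D
    using framed D N(2) by (simp add: framed_normal_def framed_normal_axioms_def)
  obtain C where C: "C > 0" and est: "\<And>I \<gamma> V f l. F.geodesic_curve I \<gamma> V \<Longrightarrow> {0<..1} \<subseteq> I \<Longrightarrow>
     (\<forall>t. 0 < t \<and> t \<le> 1 \<longrightarrow> \<gamma> t \<in> K \<and> g0 (\<gamma> t) (V t) (V t) = 0) \<Longrightarrow>
     continuous_on {0..1} f \<Longrightarrow> (\<forall>t\<in>I. 0 < t \<longrightarrow> f t = g0 (\<gamma> t) (V t) (e0 None (\<gamma> t))) \<Longrightarrow>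
     0 < l \<Longrightarrow> f 0 = - l \<Longrightarrow> \<bar>\<bar>f 1\<bar> - l\<bar> < C * l\<^sup>2"
    using F.null_geodesic_estimate by (elim exE conjE) simp
  have main: "\<bar>riem_norm g' e' x (riem_grad A g' e' (optical A g' e' r q) x) - sqrt 2\<bar>
          < (sqrt 2 * C) * radial A g' e' r q x"
    if sp: "spacetime A g' \<tau>'" and agree: "\<forall>x\<in>K. g' x = g x \<and> (\<forall>a. e' a x = e a x)"
      and ts: "temple_setting A g' \<tau>' p K e' R U" and r: "0 < r" "r \<le> R" and q: "q \<in> U r"
      and x: "x \<in> temple_dom A g' e' r q - central_image A g' e' r q" for g' \<tau>' e' p U r q x
  proof -
    note lm' = lorentz_manifoldI[OF sp]
    from ts obtain N' where N': "convex_normal_nbhd A g' p N'" "K \<subseteq> N'" and fr': "frame_field_on A g' \<tau>' K e'"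
      unfolding temple_setting_def by blast
    obtain D' where D': "normal_nbhd A g' N' D'" by (rule normal_nbhdI[OF sp N'(1)])
    have un: "uniform_temple_nbhd A g' p K e' r (U r)" using ts r unfolding temple_setting_def by auto
    interpret T: temple_chart A g' N' D' K e' r q by (rule temple_chartI[OF D' N'(2) fr' un q])
    obtain S' where S': "open S'" "K \<subseteq> S'" "smooth_vector_field_on A S' (e' None)"
      "\<And>y. y \<in> S' \<Longrightarrow> g' y (e' None y) (e' None y) = -1"
      by (rule frame_unit[OF lm' fr']) blast
    interpret F': framed A g' S' K e'
      using lm' S' assms(2) by (simp add: framed_def framed_axioms_def)
    define l where "l = radial A g' e' r q x"
    obtain I \<gamma> V where \<gamma>: "T.geodesic_curve I \<gamma> V" "{0..1} \<subseteq> I"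
        "\<And>t. t \<in> I \<Longrightarrow> 0 < t \<Longrightarrow> t < r / l \<Longrightarrow> \<gamma> t \<in> interior K"
      "1 < r / l" "\<gamma> 0 \<in> K"
      "\<And>t. t \<in> I \<Longrightarrow> g' (\<gamma> t) (V t) (V t) = 0"
      "l > 0" "g' (\<gamma> 0) (V 0) (e' None (\<gamma> 0)) = - l"
      "riem_norm g' e' x (riem_grad A g' e' (optical A g' e' r q) x)
        = sqrt 2 * \<bar>g' (\<gamma> 1) (V 1) (e' None (\<gamma> 1))\<bar> / l"
      unfolding l_def by (rule T.gradient_at_tip[OF x]) blast
    have intK: "interior K \<subseteq> K" by (rule interior_subset)
    have eqK: "g' y = g0 y" "e' a y = e0 a y" if "y \<in> K" for y a
      using agree g0(2) that by auto
    let ?f = "\<lambda>t. g' (\<gamma> t) (V t) (e' None (\<gamma> t))"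
    let ?J = "I \<inter> {0<..<r / l}"
    have "T.geodesic_curve ?J \<gamma> V"
      by (rule geodesic_curve_restrict[OF lm' \<gamma>(1)]) (simp_all add: is_interval_1)
    moreover have "\<gamma> t \<in> interior K" if "t \<in> ?J" for t using that \<gamma>(3) by auto
    ultimately have 1: "F.geodesic_curve ?J \<gamma> V"
      by (intro geodesic_curve_transfer[OF lm0 lm' eqK(1)])
    have 2: "{0<..1} \<subseteq> ?J" using \<gamma>(2,4) by auto
    have tK: "\<gamma> t \<in> K" if "0 \<le> t" "t \<le> 1" for t
    proof (cases "t = 0")
      case False
      then have "t \<in> I" "0 < t" "t < r / l" using that \<gamma>(2,4) by auto
      from \<gamma>(3)[OF this] intK show ?thesis by blast
    qed (use \<gamma>(5) in simp)
    have 3: "\<forall>t. 0 < t \<and> t \<le> 1 \<longrightarrow> \<gamma> t \<in> K \<and> g0 (\<gamma> t) (V t) (V t) = 0"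
    proof (intro allI impI conjI)
      fix t :: real assume t: "0 < t \<and> t \<le> 1"
      then show k: "\<gamma> t \<in> K" by (intro tK) auto
      have "t \<in> I" using t \<gamma>(2) by auto
      from \<gamma>(6)[OF this] eqK(1)[OF k] show "g0 (\<gamma> t) (V t) (V t) = 0" by simp
    qed
    have 4: "continuous_on {0..1} ?f"
    proof (intro continuous_at_imp_continuous_on ballI)
      fix t :: real assume t: "t \<in> {0..1}"
      obtain c where c: "c \<in> A" "\<gamma> t \<in> ch_dom c" by (rule F.chart_around)
      have "\<gamma> t \<in> S'" "t \<in> I" using tK[of t] t S'(2) \<gamma>(2) by auto
      from DERIV_isCont[OF F'.geodesic_e0_derivative[OF \<gamma>(1) this(2) c this(1)]]
      show "isCont ?f t" .
    qed
    have 5: "\<forall>t\<in>?J. 0 < t \<longrightarrow> ?f t = g0 (\<gamma> t) (V t) (e0 None (\<gamma> t))"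
    proof (intro ballI impI)
      fix t assume "t \<in> ?J"
      then have "\<gamma> t \<in> K" using \<gamma>(3) intK by auto
      then show "?f t = g0 (\<gamma> t) (V t) (e0 None (\<gamma> t))" by (simp add: eqK)
    qed
    have "\<bar>\<bar>?f 1\<bar> - l\<bar> < C * l\<^sup>2" by (rule est[OF 1 2 3 4 5 \<gamma>(7,8)])
    then have "sqrt 2 / l * \<bar>\<bar>?f 1\<bar> - l\<bar> < sqrt 2 / l * (C * l\<^sup>2)"
      using \<gamma>(7) by (intro mult_strict_left_mono) auto
    moreover have "sqrt 2 * \<bar>?f 1\<bar> / l - sqrt 2 = sqrt 2 / l * (\<bar>?f 1\<bar> - l)"
      using \<gamma>(7) by (simp add: field_simps)
    then have "\<bar>sqrt 2 * \<bar>?f 1\<bar> / l - sqrt 2\<bar> = sqrt 2 / l * \<bar>\<bar>?f 1\<bar> - l\<bar>"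
      using \<gamma>(7) by (simp add: abs_mult)
    moreover have "sqrt 2 / l * (C * l\<^sup>2) = sqrt 2 * C * l" using \<gamma>(7) by (simp add: power2_eq_square)
    ultimately show ?thesis unfolding \<gamma>(9) l_def[symmetric] by simp
  qed
  show ?thesis
  proof (intro exI[of _ "sqrt 2 * C"] conjI allI impI ballI)
    show "0 < sqrt 2 * C" using C by simp
  qed (rule main; blast)
qed

end
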